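(* Let $N\ge3$, $T>0$, $\mu,\nu\ge0$. Let $(v,b,p)$ be a weak solution to $(MHD)_{\mu,\nu}$ on $\mathbb{R}^N\times(0,T)$ with $f,g\in L^1(0,T;L^1_{loc,\sigma}(\mathbb{R}^N))$ such that either (A) $$\int_0^T\int_{\mathbb{R}^N}\frac{|v(x,t)|^2+|b(x,t)|^2+|p(x,t)|}{1+|x|}\,dx\,dt<\infty,$$ or (B) $|p(x,t)|\to0$ as $|x|\to\infty$ for almost every $t\in(0,T)$, and $|v|+|b|\in L^2(0,T;L^q(\mathbb{R}^N))$ for some $q$ with $2<q<\frac{2N}{N-1}$. Suppose there exists $w\in L^1(0,\infty)$, which is positive and non-increasing on $[0,\infty)$, such that, for some constant $C>0$, $0<w(r)\le\frac{C}{1+r}$ for almost every $r\in[0,\infty)$, and $$\int_{\mathbb{R}^N}p(x,t)\left[w(|x|)+\frac{N-1}{|x|}\int_0^{|x|}w(s)\,ds\right]dx\ge0\quad\text{for almost every } t\in(0,T).$$ Then $v(x,t)=b(x,t)=0$ almost everywhere on $\mathbb{R}^N\times(0,T)$.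
   Context: $(MHD)_{\mu,\nu}$ denotes the magnetohydrodynamic equations on $\mathbb{R}^N$, $N\ge3$: $\partial_t v+(v\cdot\nabla)v=(b\cdot\nabla)b-\nabla(p+\frac12|b|^2)+\nu\Delta v+f$, $\ \partial_t b+(v\cdot\nabla)b=(b\cdot\nabla)v+\mu\Delta b+g$, $\ \operatorname{div}v=\operatorname{div}b=0$, where $v=(v_1,\dots,v_N)(x,t)$ is the velocity, $b=(b_1,\dots,b_N)(x,t)$ the magnetic field, $p(x,t)$ the scalar pressure, and $f,g$ are external forces. For $q\in[1,\infty]$, $L^q_{loc,\sigma}(\mathbb{R}^N)$ is the class of vector fields in $[L^q_{loc}(\mathbb{R}^N)]^N$ that are divergence free in the sense of distributions. For $a,c\in\mathbb{R}^N$, $(a\otimes c)_{ij}=a_ic_j$; for $N\times N$ matrices, $A:B=\sum_{i,j=1}^N A_{ij}B_{ij}$; $(\nabla\phi)_{ij}=\partial_i\phi_j$. Weak solution: a triple $(v,b,p)\in[L^2(0,T;L^2_{loc,\sigma}(\mathbb{R}^N))]^2\times L^1(0,T;L^1_{loc}(\mathbb{R}^N))$ is a weak solution of $(MHD)_{\mu,\nu}$ on $\mathbb{R}^N\times(0,T)$ if $$-\int_0^T\!\int_{\mathbb{R}^N} v\cdot\phi\,\xi'\,dx\,dt-\int_0^T\!\int_{\mathbb{R}^N} v\otimes v:\nabla\phi\,\xi\,dx\,dt=-\int_0^T\!\int_{\mathbb{R}^N} b\otimes b:\nabla\phi\,\xi\,dx\,dt+\int_0^T\!\int_{\mathbb{R}^N}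 p\,\operatorname{div}\phi\,\xi\,dx\,dt+\frac12\int_0^T\!\int_{\mathbb{R}^N}|b|^2\operatorname{div}\phi\,\xi\,dx\,dt+\nu\int_0^T\!\int_{\mathbb{R}^N} v\cdot\Delta\phi\,\xi\,dx\,dt+\int_0^T\!\int_{\mathbb{R}^N} f\cdot\phi\,\xi\,dx\,dt$$ and $$-\int_0^T\!\int_{\mathbb{R}^N} b\cdot\phi\,\xi'\,dx\,dt-\int_0^T\!\int_{\mathbb{R}^N} v\otimes b:\nabla\phi\,\xi\,dx\,dt=-\int_0^T\!\int_{\mathbb{R}^N} b\otimes v:\nabla\phi\,\xi\,dx\,dt+\mu\int_0^T\!\int_{\mathbb{R}^N} b\cdot\Delta\phi\,\xi\,dx\,dt+\int_0^T\!\int_{\mathbb{R}^N} g\cdot\phi\,\xi\,dx\,dt$$ for all $\xi=\xi(t)\in C^1_0(0,T)$ and $\phi=\phi(x)\in[C_0^2(\mathbb{R}^N)]^N$ (subscript $0$ denotes compact support). *)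

theory Defs
  imports "HOL-Analysis.Analysis"
begin

section \<open>Vector calculus and test functions\<close>

definition partial :: "'n \<Rightarrow> (real ^ 'n::finite \<Rightarrow> 'b::real_normed_vector) \<Rightarrow> real ^ 'n \<Rightarrow> 'b"
  where "partial i \<phi> x = frechet_derivative \<phi> (at x) (axis i 1)"

fun C_diff :: "nat \<Rightarrow> (real ^ 'n::finite \<Rightarrow> 'b::real_normed_vector) \<Rightarrow> bool"
  where
    "C_diff 0 \<phi> \<longleftrightarrow> continuous_on UNIV \<phi>"
  | "C_diff (Suc k) \<phi> \<longleftrightarrow> \<phi> differentiable_on UNIV \<and> (\<forall>i. C_diff k (partial i \<phi>))"

definition compact_support_in :: "'a::topological_space set \<Rightarrow> ('a \<Rightarrow> 'b::zero) \<Rightarrow> bool"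
  where "compact_support_in \<Omega> \<phi> \<longleftrightarrow> (\<exists>K. compact K \<and> K \<subseteq> \<Omega> \<and> (\<forall>x. x \<notin> K \<longrightarrow> \<phi> x = 0))"

definition grad :: "(real ^ 'n::finite \<Rightarrow> real) \<Rightarrow> real ^ 'n \<Rightarrow> real ^ 'n"
  where "grad \<psi> x = (\<chi> i. partial i \<psi> x)"

text \<open>The row index is the index of differentiation.\<close>

definition nabla :: "(real ^ 'n::finite \<Rightarrow> real ^ 'n) \<Rightarrow> real ^ 'n \<Rightarrow> real ^ 'n ^ 'n"
  where "nabla \<phi> x = (\<chi> i j. partial i \<phi> x $ j)"

definition divergence :: "(real ^ 'n::finite \<Rightarrow> real ^ 'n) \<Rightarrow> real ^ 'n \<Rightarrow> real"
  where "divergence \<phi> x = (\<Sum>i\<in>UNIV. partial i \<phi> x $ i)"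

definition laplacian :: "(real ^ 'n::finite \<Rightarrow> real ^ 'n) \<Rightarrow> real ^ 'n \<Rightarrow> real ^ 'n"
  where "laplacian \<phi> x = (\<Sum>i\<in>UNIV. partial i (partial i \<phi>) x)"

definition tensor :: "real ^ 'n::finite \<Rightarrow> real ^ 'n \<Rightarrow> real ^ 'n ^ 'n"
  where "tensor a c = (\<chi> i j. a $ i * c $ j)"

definition contract :: "real ^ 'n::finite ^ 'n \<Rightarrow> real ^ 'n ^ 'n \<Rightarrow> real"
  where "contract A B = (\<Sum>i\<in>UNIV. \<Sum>j\<in>UNIV. A $ i $ j * B $ i $ j)"


section \<open>Function spaces\<close>

text \<open>All function classes are rendered as predicates on representatives, and time-dependent
  fields are curried with the time variable first. Exponents are finite. Measurability is with
  respect to the Lebesgue (completed) sigma-algebra.\<close>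

definition in_L :: "real \<Rightarrow> 'a::euclidean_space set \<Rightarrow> ('a \<Rightarrow> 'b::euclidean_space) \<Rightarrow> bool"
  where "in_L q S u \<longleftrightarrow> u \<in> borel_measurable (lebesgue_on S) \<and>
           integrable (lebesgue_on S) (\<lambda>x. norm (u x) powr q)"

definition L_norm :: "real \<Rightarrow> 'a::euclidean_space set \<Rightarrow> ('a \<Rightarrow> 'b::euclidean_space) \<Rightarrow> real"
  where "L_norm q S u = (LINT x|lebesgue_on S. norm (u x) powr q) powr (1 / q)"

text \<open>The Bochner spaces \<open>L\<^sup>s(0,T; L\<^sup>q(S))\<close> and \<open>L\<^sup>s(0,T; L\<^sup>q\<^sub>l\<^sub>o\<^sub>c)\<close>. For finite exponents, Bochner
  measurability amounts to joint measurability in space and time.\<close>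

definition in_LL ::
    "real \<Rightarrow> real \<Rightarrow> real \<Rightarrow> 'a::euclidean_space set \<Rightarrow> (real \<Rightarrow> 'a \<Rightarrow> 'b::euclidean_space) \<Rightarrow> bool"
  where "in_LL s T q S u \<longleftrightarrow>
           (\<lambda>(t, x). u t x) \<in> borel_measurable (lebesgue_on ({0<..<T} \<times> S)) \<and>
           (AE t in lebesgue_on {0<..<T}. in_L q S (u t)) \<and>
           in_L s {0<..<T} (\<lambda>t. L_norm q S (u t))"

definition in_LLloc ::
    "real \<Rightarrow> real \<Rightarrow> real \<Rightarrow> (real \<Rightarrow> 'a::euclidean_space \<Rightarrow> 'b::euclidean_space) \<Rightarrow> bool"
  where "in_LLloc s T q u \<longleftrightarrow> (\<forall>K. compact K \<longrightarrow> in_LL s T q K u)"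

text \<open>Divergence free in the sense of distributions, for locally integrable fields.\<close>

definition div_free :: "(real ^ 'n::finite \<Rightarrow> real ^ 'n) \<Rightarrow> bool"
  where "div_free u \<longleftrightarrow>
           (\<forall>\<psi> :: real ^ 'n \<Rightarrow> real. (\<forall>k. C_diff k \<psi>) \<and> compact_support_in UNIV \<psi> \<longrightarrow>
              (LINT x|lebesgue. u x \<bullet> grad \<psi> x) = 0)"

definition in_LLloc_sigma ::
    "real \<Rightarrow> real \<Rightarrow> real \<Rightarrow> (real \<Rightarrow> real ^ 'n::finite \<Rightarrow> real ^ 'n) \<Rightarrow> bool"
  where "in_LLloc_sigma s T q u \<longleftrightarrow>
           in_LLloc s T q u \<and> (AE t in lebesgue_on {0<..<T}. div_free (u t))"


section \<open>Weak solutions of the magnetohydrodynamic equations\<close>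

definition st_integral :: "real \<Rightarrow> (real \<Rightarrow> 'a::euclidean_space \<Rightarrow> real) \<Rightarrow> real"
  where "st_integral T F = (LINT t|lebesgue_on {0<..<T}. LINT x|lebesgue. F t x)"

text \<open>A test function in \<open>C\<^sup>1\<^sub>0(0,T)\<close> is represented by its extension by zero to the real line.\<close>

definition MHD_weak_solution ::
    "real \<Rightarrow> real \<Rightarrow> real \<Rightarrow> (real \<Rightarrow> real ^ 'n::finite \<Rightarrow> real ^ 'n) \<Rightarrow> (real \<Rightarrow> real ^ 'n \<Rightarrow> real ^ 'n) \<Rightarrow>
     (real \<Rightarrow> real ^ 'n \<Rightarrow> real ^ 'n) \<Rightarrow> (real \<Rightarrow> real ^ 'n \<Rightarrow> real ^ 'n) \<Rightarrow> (real \<Rightarrow> real ^ 'n \<Rightarrow> real) \<Rightarrow> bool"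
  where "MHD_weak_solution \<mu> \<nu> T f g v b p \<longleftrightarrow>
    in_LLloc_sigma 2 T 2 v \<and> in_LLloc_sigma 2 T 2 b \<and> in_LLloc 1 T 1 p \<and>
    (\<forall>(\<xi> :: real \<Rightarrow> real) (\<phi> :: real ^ 'n \<Rightarrow> real ^ 'n).
       \<xi> C1_differentiable_on UNIV \<and> compact_support_in {0<..<T} \<xi> \<and>
       C_diff 2 \<phi> \<and> compact_support_in UNIV \<phi> \<longrightarrow>
       - st_integral T (\<lambda>t x. (v t x \<bullet> \<phi> x) * deriv \<xi> t)
         - st_integral T (\<lambda>t x. contract (tensor (v t x) (v t x)) (nabla \<phi> x) * \<xi> t)
       = - st_integral T (\<lambda>t x. contract (tensor (b t x) (b t x)) (nabla \<phi> x) * \<xi> t)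
         + st_integral T (\<lambda>t x. p t x * divergence \<phi> x * \<xi> t)
         + 1 / 2 * st_integral T (\<lambda>t x. (norm (b t x))\<^sup>2 * divergence \<phi> x * \<xi> t)
         + \<nu> * st_integral T (\<lambda>t x. (v t x \<bullet> laplacian \<phi> x) * \<xi> t)
         + st_integral T (\<lambda>t x. (f t x \<bullet> \<phi> x) * \<xi> t)
       \<and>
       - st_integral T (\<lambda>t x. (b t x \<bullet> \<phi> x) * deriv \<xi> t)
         - st_integral T (\<lambda>t x. contract (tensor (v t x) (b t x)) (nabla \<phi> x) * \<xi> t)
       = - st_integral T (\<lambda>t x. contract (tensor (b t x) (v t x)) (nabla \<phi> x) * \<xi> t)
         + \<mu> * st_integral T (\<lambda>t x. (b t x \<bullet> laplacian \<phi> x) * \<xi> t)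
         + st_integral T (\<lambda>t x. (g t x \<bullet> \<phi> x) * \<xi> t))"


section \<open>Extended Lebesgue integral\<close>

text \<open>The Bochner integral of a non-integrable function is 0 by convention, which would make
  an inequality \<open>0 \<le> integral\<close> hold vacuously. A sign condition on an integral is therefore
  stated for the integral in the extended reals, together with its existence (the integrals
  of the positive and negative parts are not both infinite).\<close>

definition ext_integral_exists :: "'a measure \<Rightarrow> ('a \<Rightarrow> real) \<Rightarrow> bool"
  where "ext_integral_exists M h \<longleftrightarrow> h \<in> borel_measurable M \<and>
           ((\<integral>\<^sup>+ x. ennreal (h x) \<partial>M) < \<infinity> \<or> (\<integral>\<^sup>+ x. ennreal (- h x) \<partial>M) < \<infinity>)"

definition ext_integral :: "'a measure \<Rightarrow> ('a \<Rightarrow> real) \<Rightarrow> ereal"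
  where "ext_integral M h =
           enn2ereal (\<integral>\<^sup>+ x. ennreal (h x) \<partial>M) - enn2ereal (\<integral>\<^sup>+ x. ennreal (- h x) \<partial>M)"

end

theory Submission
  imports Defs
begin

text \<open>Fix a time and test the momentum equation with a gradient \<open>\<phi> = \<nabla>\<psi>\<close> of a radial function. As \<open>v\<close> and
  \<open>f\<close> are divergence free and \<open>\<Delta>\<nabla>\<psi> = \<nabla>\<Delta>\<psi>\<close>, the time derivative, the viscous term and the force drop out,
  and what remains is \<open>\<integral> \<sigma> : D\<^sup>2\<psi> = 0\<close> for the stress \<open>\<sigma> = v \<otimes> v - b \<otimes> b + (p + \<bar>b\<bar>\<^sup>2/2) I\<close>. For the radial
  function with \<open>\<psi>' = W\<close>, where \<open>W(r) = \<integral>\<^sub>0\<^sup>r w\<close>, the Hessian has the eigenvalue \<open>w\<close> in the radial direction and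
  \<open>W/r\<close> in the others. The pressure then appears in \<open>\<sigma> : D\<^sup>2\<psi>\<close> exactly with the weight of the hypothesis, and
  since \<open>w \<le> W/r\<close> and \<open>N \<ge> 3\<close> the remaining terms are at least \<open>w (\<bar>v\<bar>\<^sup>2 + \<bar>b\<bar>\<^sup>2) / 2\<close>
  (\<open>inner_integrand_bound\<close>). So a nonnegative pressure integral forces \<open>v = b = 0\<close>.

  This \<open>\<psi>\<close> has to be cut off at infinity, without control of the pressure beyond its decay. For
  \<open>R < r < L\<close> the slope \<open>W(r)\<close> is replaced by a multiple of \<open>r (r\<^sup>-\<^sup>N - L\<^sup>-\<^sup>N)\<close>, which is continuous at \<open>r = R\<close> and
  vanishes at \<open>r = L\<close>. The part \<open>r\<^sup>1\<^sup>-\<^sup>N\<close> is the slope of the fundamental solution, so \<open>\<Delta>\<psi>\<close> is a constant of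
  order \<open>R\<^sup>N\<^sup>-\<^sup>1 L\<^sup>-\<^sup>N\<close> in the shell. The pressure of the shell enters only through \<open>L\<^sup>-\<^sup>N \<integral>\<^bsub>\<bar>x\<bar> < L\<^esub> \<bar>p\<bar>\<close>, which tends
  to 0 as \<open>L \<rightarrow> \<infinity>\<close> under either decay hypothesis; no representation of the pressure by singular integrals
  is involved. The velocity and the magnetic field of the shell contribute at most a multiple of
  \<open>\<integral>\<^bsub>\<bar>x\<bar> > R\<^esub> (\<bar>v\<bar>\<^sup>2 + \<bar>b\<bar>\<^sup>2) / (1 + \<bar>x\<bar>)\<close>, a tail of a convergent integral: in the case of
  \<open>L\<^sup>q\<close> bounds it converges by Young's inequality, because \<open>q < 2N/(N - 1)\<close> is the condition for the conjugate
  power of \<open>1/(1 + \<bar>x\<bar>)\<close> to be integrable. This is \<open>energy_inequality\<close>; letting \<open>L\<close> and then \<open>R\<close> tend to infinity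
  gives \<open>energy_vanishes\<close>.

  The test functions of the weak formulation are smooth, whereas \<open>w\<close> is only monotone. With
  \<open>s = \<bar>x\<bar>\<^sup>2/2\<close> and \<open>\<nabla>\<psi> = k(s) x\<close>, the identity is linear in \<open>\<kappa> = - k'\<close> and reads
  \<open>\<integral> k(s) tr \<sigma> = \<integral> \<kappa>(s) x \<sqdot> \<sigma>x\<close> with \<open>k\<close> the integral of \<open>\<kappa>\<close> over \<open>[s, \<infinity>)\<close>. It is proved for countably many
  smooth \<open>\<kappa>\<close>, at almost every time simultaneously (\<open>radial_momentum_identity\<close>), and then extended at a
  fixed time by dominated convergence: to indicators of the intervals of a grid, to step functions, to
  bounded \<open>\<kappa>\<close> with countably many discontinuities, and to the singularity \<open>1/s\<close> of the actual profile at
  the origin (\<open>balances_singular_profile\<close>).\<close>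

section \<open>Smooth cutoff functions on the real line\<close>

text \<open>Profiles of radial functions are differentiated as functions on the real line, to which \<open>C_diff\<close> does not
  apply.\<close>

fun C_real :: "nat \<Rightarrow> (real \<Rightarrow> real) \<Rightarrow> bool"
  where
    "C_real 0 f \<longleftrightarrow> continuous_on UNIV f"
  | "C_real (Suc k) f \<longleftrightarrow> (\<exists>f'. (\<forall>x. (f has_real_derivative f' x) (at x)) \<and> C_real k f')"

lemma C_real_SucI:
  "(\<And>x. (f has_real_derivative f' x) (at x)) \<Longrightarrow> C_real k f' \<Longrightarrow> C_real (Suc k) f"
  by auto

lemma C_real_SucD: "C_real (Suc k) f \<Longrightarrow> C_real k f"
proof (induction k arbitrary: f)
  case 0
  then show ?case
    by (auto intro!: continuous_at_imp_continuous_on intro: DERIV_isCont)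
next
  case (Suc k)
  then obtain f' where "\<forall>x. (f has_real_derivative f' x) (at x)" "C_real (Suc k) f'"
    by auto
  with Suc.IH[of f'] show ?case by auto
qed

lemma C_real_const: "C_real k (\<lambda>x. c)"
proof (induction k arbitrary: c)
  case (Suc k)
  show ?case
    by (rule C_real_SucI[where f' = "\<lambda>x. 0"]) (auto intro: Suc)
qed auto

lemma C_real_add: "C_real k f \<Longrightarrow> C_real k g \<Longrightarrow> C_real k (\<lambda>x. f x + g x)"
proof (induction k arbitrary: f g)
  case 0
  then show ?case by (auto intro: continuous_intros)
next
  case (Suc k)
  then obtain f' g' where "\<forall>x. (f has_real_derivative f' x) (at x)" "C_real k f'"
    "\<forall>x. (g has_real_derivative g' x) (at x)" "C_real k g'"
    by auto
  then show ?case
    by (intro C_real_SucI[where f' = "\<lambda>x. f' x + g' x"] Suc.IH) (auto intro: DERIV_add)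
qed

lemma C_real_mult: "C_real k f \<Longrightarrow> C_real k g \<Longrightarrow> C_real k (\<lambda>x. f x * g x)"
proof (induction k arbitrary: f g)
  case 0
  then show ?case by (auto intro: continuous_intros)
next
  case (Suc k)
  then obtain f' g' where *: "\<forall>x. (f has_real_derivative f' x) (at x)" "C_real k f'"
    "\<forall>x. (g has_real_derivative g' x) (at x)" "C_real k g'"
    by auto
  show ?case
  proof (rule C_real_SucI[where f' = "\<lambda>x. f' x * g x + f x * g' x"])
    show "((\<lambda>x. f x * g x) has_real_derivative f' x * g x + f x * g' x) (at x)" for x
      using * by (auto intro!: derivative_eq_intros)
    show "C_real k (\<lambda>x. f' x * g x + f x * g' x)"
      using * Suc.prems[THEN C_real_SucD] by (intro C_real_add Suc.IH)
  qed
qed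

lemma C_real_affine: "C_real k f \<Longrightarrow> C_real k (\<lambda>x. f (c * x + d))"
proof (induction k arbitrary: f)
  case 0
  then have f: "continuous_on UNIV f" by simp
  have "continuous_on UNIV (f \<circ> (\<lambda>x. c * x + d))"
    by (rule continuous_on_compose) (auto intro!: continuous_intros continuous_on_subset[OF f])
  then show ?case by (simp add: o_def)
next
  case (Suc k)
  then obtain f' where *: "\<forall>x. (f has_real_derivative f' x) (at x)" "C_real k f'"
    by auto
  show ?case
  proof (rule C_real_SucI[where f' = "\<lambda>x. f' (c * x + d) * c"])
    show "((\<lambda>x. f (c * x + d)) has_real_derivative f' (c * x + d) * c) (at x)" for x
      by (rule DERIV_chain2[where g = "\<lambda>x. c * x + d"])
         (use * in \<open>auto intro!: derivative_eq_intros\<close>)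
    show "C_real k (\<lambda>x. f' (c * x + d) * c)"
      using * by (intro C_real_mult[OF Suc.IH[of f'] C_real_const])
  qed
qed

text \<open>The functions \<open>x\<^sup>-\<^sup>m exp (- 1/x)\<close> on the positive half line. Their span is closed under differentiation,
  which is what makes \<open>exp (- 1/x)\<close>, extended by 0, infinitely differentiable.\<close>

definition flat_exp :: "nat \<Rightarrow> real \<Rightarrow> real"
  where "flat_exp m x = (if x > 0 then exp (- inverse x) * inverse x ^ m else 0)"

lemma flat_exp_tendsto_0: "(flat_exp m \<longlongrightarrow> 0) (at 0)"
proof -
  have "((\<lambda>x. inverse x ^ m / exp (inverse x)) \<longlongrightarrow> (0::real)) (at_right 0)"
    by (rule filterlim_compose[OF tendsto_power_div_exp_0 filterlim_inverse_at_top_right])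
  then have "(flat_exp m \<longlongrightarrow> 0) (at_right 0)"
  proof (rule Lim_transform_eventually)
    show "\<forall>\<^sub>F x in at_right 0. inverse x ^ m / exp (inverse x) = flat_exp m x"
      by (rule eventually_mono[OF eventually_at_right_less])
         (simp add: flat_exp_def exp_minus divide_inverse mult.commute)
  qed
  moreover have "(flat_exp m \<longlongrightarrow> 0) (at_left 0)"
    by (rule tendsto_eventually, rule eventually_mono[OF eventually_at_leftI[of "-1" 0 "\<lambda>x. x < 0"]])
       (auto simp: flat_exp_def)
  ultimately show ?thesis
    by (intro filterlim_split_at)
qed

lemma flat_exp_has_derivative:
  "(flat_exp m has_real_derivative flat_exp (m + 2) x - real m * flat_exp (m + 1) x) (at x)"
proof -
  consider "x > 0" | "x < 0" | "x = 0" by linarith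
  then show ?thesis
  proof cases
    case 1
    have "((\<lambda>x. exp (- inverse x) * inverse x ^ m) has_real_derivative
        flat_exp (m + 2) x - real m * flat_exp (m + 1) x) (at x)"
    proof (cases m)
      case 0
      have "((\<lambda>x. exp (- inverse x)) has_real_derivative
          exp (- inverse x) * - (- (inverse x ^ Suc (Suc 0)))) (at x)"
        using 1 by (intro DERIV_fun_exp DERIV_minus DERIV_inverse) simp
      with 0 1 show ?thesis by (simp add: flat_exp_def)
    next
      case (Suc j)
      have "((\<lambda>x. exp (- inverse x) * inverse x ^ Suc j) has_real_derivative
          exp (- inverse x) * - (- (inverse x ^ Suc (Suc 0))) * inverse x ^ Suc j +
          (1 + real j) * (- (inverse x ^ Suc (Suc 0)) * inverse x ^ j) * exp (- inverse x)) (at x)"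
        using 1 by (intro DERIV_mult DERIV_power_Suc DERIV_fun_exp DERIV_minus DERIV_inverse) simp_all
      with Suc 1 show ?thesis by (simp add: flat_exp_def algebra_simps)
    qed
    then show ?thesis
      by (rule has_field_derivative_transform_within_open[where S = "{0<..}"])
         (use 1 in \<open>auto simp: flat_exp_def\<close>)
  next
    case 2
    have "((\<lambda>x. 0) has_real_derivative flat_exp (m + 2) x - real m * flat_exp (m + 1) x) (at x)"
      using 2 by (auto simp: flat_exp_def)
    then show ?thesis
      by (rule has_field_derivative_transform_within_open[where S = "{..<0}"])
         (use 2 in \<open>auto simp: flat_exp_def\<close>)
  next
    case 3
    have "flat_exp m h / h = flat_exp (m + 1) h" for h
      by (auto simp: flat_exp_def divide_inverse mult_ac)
    then have "((\<lambda>h. flat_exp m h / h) \<longlongrightarrow> 0) (at 0)"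
      using flat_exp_tendsto_0[of "m + 1"] by simp
    with 3 show ?thesis
      by (simp add: DERIV_def flat_exp_def[of _ 0])
  qed
qed

lemma C_real_flat_exp: "C_real k (flat_exp m)"
proof (induction k arbitrary: m)
  case 0
  show ?case
    by (auto intro!: continuous_at_imp_continuous_on DERIV_isCont flat_exp_has_derivative)
next
  case (Suc k)
  have "C_real k (\<lambda>x. flat_exp (m + 2) x + (- real m) * flat_exp (m + 1) x)"
    by (intro C_real_add C_real_mult C_real_const Suc)
  then show ?case
    using flat_exp_has_derivative by (intro C_real_SucI) auto
qed

lemma C_real_antiderivative:
  assumes "continuous_on UNIV f"
  obtains F where "\<And>x. (F has_real_derivative f x) (at x)" "\<And>k. C_real k f \<Longrightarrow> C_real (Suc k) F"
    "F c = 0"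
proof -
  obtain G where G: "\<forall>x::real. - \<infinity> < ereal x \<longrightarrow> ereal x < \<infinity> \<longrightarrow> (G has_vector_derivative f x) (at x)"
    using einterval_antiderivative[of "- \<infinity>" "\<infinity>" f] assms
    by (auto simp: continuous_on_eq_continuous_at)
  define F where "F x = G x - G c" for x
  have "(F has_real_derivative f x) (at x)" for x
    unfolding F_def
    using G by (auto intro!: derivative_eq_intros simp: has_real_derivative_iff_has_vector_derivative)
  then show ?thesis
    by (intro that[of F]) (auto simp: F_def)
qed

text \<open>As \<open>n\<close> grows, \<open>exp (- 1 / (n (s - a)))\<close> increases to 1 for every \<open>s > a\<close>. The product is a smooth function
  that converges to the indicator of \<open>(a, b)\<close> while its support stays in \<open>[a, b]\<close>, so no mollification is
  required.\<close>

definition bump :: "nat \<Rightarrow> real \<Rightarrow> real \<Rightarrow> real \<Rightarrow> real"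
  where "bump n a b s = flat_exp 0 (real n * (s - a)) * flat_exp 0 (real n * (b - s))"

lemma C_real_bump: "C_real k (bump n a b)"
proof -
  have "C_real k (\<lambda>s. flat_exp 0 (real n * s + real n * (- a)) * flat_exp 0 (- real n * s + real n * b))"
    by (intro C_real_mult C_real_affine[OF C_real_flat_exp])
  then show ?thesis
    by (simp add: bump_def[abs_def] algebra_simps)
qed

lemma bump_nonneg: "0 \<le> bump n a b s" and bump_le_1: "bump n a b s \<le> 1"
proof -
  have *: "0 \<le> flat_exp 0 x" "flat_exp 0 x \<le> 1" for x
    by (auto simp: flat_exp_def)
  show "0 \<le> bump n a b s" "bump n a b s \<le> 1"
    unfolding bump_def using * by (auto intro!: mult_le_one)
qed

lemma bump_support: "s \<notin> {a<..<b} \<Longrightarrow> bump n a b s = 0"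
proof -
  assume "s \<notin> {a<..<b}"
  then consider "s \<le> a" | "b \<le> s" by fastforce
  then show ?thesis
    by cases (auto simp: bump_def flat_exp_def mult_pos_pos zero_less_mult_iff)
qed

lemma bump_tendsto: "(\<lambda>n. bump n a b s) \<longlonglongrightarrow> indicator {a<..<b} s"
proof (cases "s \<in> {a<..<b}")
  case True
  have *: "(\<lambda>n. flat_exp 0 (real n * c)) \<longlonglongrightarrow> 1" if "c > 0" for c :: real
  proof -
    have "(\<lambda>n. exp (- (inverse c * inverse (real n)))) \<longlonglongrightarrow> exp (- (inverse c * 0))"
      by (intro tendsto_intros lim_inverse_n)
    then have "(\<lambda>n. exp (- (inverse c * inverse (real n)))) \<longlonglongrightarrow> 1" by simp
    then show ?thesis
    proof (rule Lim_transform_eventually)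
      show "\<forall>\<^sub>F n in sequentially. exp (- (inverse c * inverse (real n))) = flat_exp 0 (real n * c)"
        by (rule eventually_mono[OF eventually_gt_at_top[of 0]])
           (use that in \<open>simp add: flat_exp_def mult.commute\<close>)
    qed
  qed
  have "(\<lambda>n. flat_exp 0 (real n * (s - a)) * flat_exp 0 (real n * (b - s))) \<longlonglongrightarrow> 1 * 1"
    using True by (intro tendsto_mult *) auto
  with True show ?thesis by (simp add: bump_def)
next
  case False
  then show ?thesis by (simp add: bump_support)
qed

section \<open>Radial test fields\<close>

lemma partial_eq:
  assumes "(\<phi> has_derivative D) (at x)"
  shows "partial i \<phi> x = D (axis i 1)"
  unfolding partial_def using frechet_derivative_at[OF assms] by simp

lemma C_diff_SucI:
  assumes "\<And>x. (\<phi> has_derivative D x) (at x)" and "\<And>i. C_diff k (\<lambda>x. D x (axis i 1))"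
  shows "C_diff (Suc k) \<phi>"
proof -
  have "\<phi> differentiable_on UNIV"
    using assms(1) by (auto simp: differentiable_on_def differentiable_def)
  moreover have "partial i \<phi> = (\<lambda>x. D x (axis i 1))" for i
    using partial_eq[OF assms(1)] by (auto simp: fun_eq_iff)
  ultimately show ?thesis
    using assms(2) by simp
qed

lemma C_diff_SucE:
  assumes "C_diff (Suc k) \<phi>"
  obtains D where "\<And>x. (\<phi> has_derivative D x) (at x)" "\<And>i. C_diff k (\<lambda>x. D x (axis i 1))"
proof
  show *: "(\<phi> has_derivative frechet_derivative \<phi> (at x)) (at x)" for x
    using assms by (simp add: differentiable_on_def frechet_derivative_works[symmetric])
  show "C_diff k (\<lambda>x. frechet_derivative \<phi> (at x) (axis i 1))" for i
    using assms by (simp add: partial_def[abs_def])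
qed

lemma C_diff_SucD: "C_diff (Suc k) \<phi> \<Longrightarrow> C_diff k \<phi>"
proof (induction k arbitrary: \<phi>)
  case 0
  then show ?case by (auto intro: differentiable_imp_continuous_on)
next
  case (Suc k)
  from Suc.prems have "\<phi> differentiable_on UNIV" "\<And>i. C_diff (Suc k) (partial i \<phi>)"
    by (metis C_diff.simps(2))+
  then show ?case using Suc.IH by simp
qed

lemma C_diff_const: "C_diff k (\<lambda>x. c)"
proof (induction k arbitrary: c)
  case (Suc k)
  show ?case
    by (rule C_diff_SucI[where D = "\<lambda>x h. 0"]) (auto intro: Suc)
qed auto

lemma C_diff_linear: "bounded_linear L \<Longrightarrow> C_diff k L"
proof (cases k)
  case 0
  moreover assume "bounded_linear L"
  ultimately show ?thesis by (auto intro: linear_continuous_on)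
next
  case (Suc j)
  assume "bounded_linear L"
  then have "(L has_derivative L) (at x)" for x
    by (rule bounded_linear_imp_has_derivative)
  then show ?thesis
    unfolding Suc by (rule C_diff_SucI) (rule C_diff_const)
qed

lemma C_diff_add: "C_diff k \<phi> \<Longrightarrow> C_diff k \<eta> \<Longrightarrow> C_diff k (\<lambda>x. \<phi> x + \<eta> x)"
proof (induction k arbitrary: \<phi> \<eta>)
  case 0
  then show ?case by (auto intro: continuous_intros)
next
  case (Suc k)
  obtain D where D: "\<And>x. (\<phi> has_derivative D x) (at x)" "\<And>i. C_diff k (\<lambda>x. D x (axis i 1))"
    by (rule C_diff_SucE[OF Suc.prems(1)]) (rule that)
  obtain E where E: "\<And>x. (\<eta> has_derivative E x) (at x)" "\<And>i. C_diff k (\<lambda>x. E x (axis i 1))"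
    by (rule C_diff_SucE[OF Suc.prems(2)]) (rule that)
  show ?case
    by (rule C_diff_SucI[where D = "\<lambda>x h. D x h + E x h"])
       (use D E Suc.IH in \<open>auto intro: has_derivative_add\<close>)
qed

lemma C_diff_scaleR:
  fixes \<phi> :: "real ^ 'n::finite \<Rightarrow> real" and \<eta> :: "real ^ 'n \<Rightarrow> 'b::real_normed_vector"
  shows "C_diff k \<phi> \<Longrightarrow> C_diff k \<eta> \<Longrightarrow> C_diff k (\<lambda>x. \<phi> x *\<^sub>R \<eta> x)"
proof (induction k arbitrary: \<phi> \<eta>)
  case 0
  then show ?case by (auto intro: continuous_intros)
next
  case (Suc k)
  obtain D where D: "\<And>x. (\<phi> has_derivative D x) (at x)" "\<And>i. C_diff k (\<lambda>x. D x (axis i 1))"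
    by (rule C_diff_SucE[OF Suc.prems(1)]) (rule that)
  obtain E where E: "\<And>x. (\<eta> has_derivative E x) (at x)" "\<And>i. C_diff k (\<lambda>x. E x (axis i 1))"
    by (rule C_diff_SucE[OF Suc.prems(2)]) (rule that)
  show ?case
  proof (rule C_diff_SucI[where D = "\<lambda>x h. \<phi> x *\<^sub>R E x h + D x h *\<^sub>R \<eta> x"])
    show "((\<lambda>x. \<phi> x *\<^sub>R \<eta> x) has_derivative (\<lambda>h. \<phi> x *\<^sub>R E x h + D x h *\<^sub>R \<eta> x)) (at x)" for x
      by (rule has_derivative_scaleR[OF D(1) E(1)])
    show "C_diff k (\<lambda>x. \<phi> x *\<^sub>R E x (axis i 1) + D x (axis i 1) *\<^sub>R \<eta> x)" for i
      using D E Suc.prems[THEN C_diff_SucD] by (intro C_diff_add Suc.IH)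
  qed
qed

lemma has_derivative_radial:
  assumes "(F has_real_derivative F') (at (x \<bullet> x / 2))"
  shows "((\<lambda>x. F (x \<bullet> x / 2)) has_derivative (\<lambda>h. F' * (x \<bullet> h))) (at x)"
proof -
  have "((\<lambda>x. x \<bullet> x / 2) has_derivative (\<lambda>h. x \<bullet> h)) (at x)"
    by (auto intro!: derivative_eq_intros simp: inner_commute)
  moreover have "(F has_derivative (\<lambda>h. F' * h)) (at (x \<bullet> x / 2))"
    using assms by (simp add: has_field_derivative_def)
  ultimately show ?thesis
    by (rule has_derivative_compose[where g = F, simplified])
qed

text \<open>Radial functions are written in the variable \<open>\<bar>x\<bar>\<^sup>2/2\<close>: they are then smooth at the origin too, and
  differentiation gives \<open>F' x\<^sub>i\<close>, again a product of a radial function and a coordinate.\<close>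

lemma C_diff_radial: "C_real k F \<Longrightarrow> C_diff k (\<lambda>x :: real ^ 'n::finite. F (x \<bullet> x / 2))"
proof (induction k arbitrary: F)
  case 0
  then have "continuous_on UNIV F" by simp
  then have "continuous_on UNIV (\<lambda>x :: real ^ 'n. F (x \<bullet> x / 2))"
    by (rule continuous_on_compose2) (auto intro!: continuous_intros)
  then show ?case by simp
next
  case (Suc k)
  then obtain F' where F': "\<forall>s. (F has_real_derivative F' s) (at s)" "C_real k F'"
    by auto
  show ?case
  proof (rule C_diff_SucI)
    show "((\<lambda>x. F (x \<bullet> x / 2)) has_derivative (\<lambda>h. F' (x \<bullet> x / 2) * (x \<bullet> h))) (at x)" for x
      using F' by (intro has_derivative_radial) auto
    show "C_diff k (\<lambda>x. F' (x \<bullet> x / 2) * (x \<bullet> axis i 1))" for i :: 'n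
      using C_diff_scaleR[OF Suc.IH[OF F'(2)] C_diff_linear[OF bounded_linear_inner_left[of "axis i 1"]]]
      by simp
  qed
qed

lemma grad_radial:
  assumes "(F has_real_derivative F') (at (x \<bullet> x / 2))"
  shows "grad (\<lambda>x. F (x \<bullet> x / 2)) x = F' *\<^sub>R x"
  using partial_eq[OF has_derivative_radial[OF assms]]
  by (simp add: grad_def vec_eq_iff inner_axis)

lemma has_derivative_radial_field:
  fixes x :: "real ^ 'n::finite"
  assumes "(k has_real_derivative k') (at (x \<bullet> x / 2))"
  shows "((\<lambda>x. k (x \<bullet> x / 2) *\<^sub>R x) has_derivative
           (\<lambda>h. k (x \<bullet> x / 2) *\<^sub>R h + (k' * (x \<bullet> h)) *\<^sub>R x)) (at x)"
  by (rule has_derivative_scaleR[OF has_derivative_radial[OF assms] has_derivative_ident])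

lemma partial_radial_field:
  fixes x :: "real ^ 'n::finite"
  assumes "(k has_real_derivative k') (at (x \<bullet> x / 2))"
  shows "partial i (\<lambda>x. k (x \<bullet> x / 2) *\<^sub>R x) x
           = k (x \<bullet> x / 2) *\<^sub>R axis i 1 + (k' * x $ i) *\<^sub>R x"
  using partial_eq[OF has_derivative_radial_field[OF assms]]
  by (simp add: inner_axis)

text \<open>The Jacobian of \<open>k(s) x\<close> is \<open>k I + k' x \<otimes> x\<close>.\<close>

lemma contract_nabla_radial_field:
  fixes x :: "real ^ 'n::finite"
  assumes "(k has_real_derivative k') (at (x \<bullet> x / 2))"
  shows "contract (tensor u u) (nabla (\<lambda>x. k (x \<bullet> x / 2) *\<^sub>R x) x)
           = k (x \<bullet> x / 2) * (norm u)\<^sup>2 + k' * (u \<bullet> x)\<^sup>2"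
proof -
  have "contract (tensor u u) (nabla (\<lambda>x. k (x \<bullet> x / 2) *\<^sub>R x) x)
    = (\<Sum>i\<in>UNIV. \<Sum>j\<in>UNIV. k (x \<bullet> x / 2) * (u $ i * u $ j * (if j = i then 1 else 0))
         + k' * ((u $ i * x $ i) * (u $ j * x $ j)))"
    by (simp add: contract_def tensor_def nabla_def partial_radial_field[OF assms] axis_def
        algebra_simps cong: if_cong)
  also have "\<dots> = k (x \<bullet> x / 2) * (\<Sum>i\<in>UNIV. u $ i * u $ i)
         + k' * ((\<Sum>i\<in>UNIV. u $ i * x $ i) * (\<Sum>j\<in>UNIV. u $ j * x $ j))"
    by (simp add: sum.distrib sum_distrib_left[symmetric] sum_product if_distrib[of "\<lambda>c. _ * c"] sum.delta cong: if_cong)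
  also have "\<dots> = k (x \<bullet> x / 2) * (norm u)\<^sup>2 + k' * (u \<bullet> x)\<^sup>2"
    unfolding power2_norm_eq_inner by (simp add: inner_vec_def power2_eq_square)
  finally show ?thesis .
qed

lemma divergence_radial_field:
  fixes x :: "real ^ 'n::finite"
  assumes "(k has_real_derivative k') (at (x \<bullet> x / 2))"
  shows "divergence (\<lambda>x. k (x \<bullet> x / 2) *\<^sub>R x) x
           = real CARD('n) * k (x \<bullet> x / 2) + k' * (norm x)\<^sup>2"
proof -
  have "divergence (\<lambda>x. k (x \<bullet> x / 2) *\<^sub>R x) x = (\<Sum>i\<in>(UNIV :: 'n set). k (x \<bullet> x / 2) + k' * (x $ i * x $ i))"
    by (simp add: divergence_def partial_radial_field[OF assms] axis_def mult.assoc)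
  also have "\<dots> = real CARD('n) * k (x \<bullet> x / 2) + k' * (\<Sum>i\<in>UNIV. x $ i * x $ i)"
    by (simp add: sum.distrib sum_distrib_left)
  also have "(\<Sum>i\<in>UNIV. x $ i * x $ i) = (norm x)\<^sup>2"
    by (simp add: power2_norm_eq_inner inner_vec_def)
  finally show ?thesis .
qed

text \<open>The Laplacian commutes with the gradient. Here it is computed directly that \<open>\<Delta>(k(s) x)\<close> is the gradient of
  \<open>div (k(s) x) = N k + 2 s k'\<close>, so that it is orthogonal to divergence free fields.\<close>

lemma laplacian_radial_field:
  fixes x :: "real ^ 'n::finite"
  assumes k: "\<And>s. (k has_real_derivative k' s) (at s)" and k': "\<And>s. (k' has_real_derivative k'' s) (at s)"
  shows "laplacian (\<lambda>x. k (x \<bullet> x / 2) *\<^sub>R x) x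
           = grad (\<lambda>x. real CARD('n) * k (x \<bullet> x / 2) + x \<bullet> x * k' (x \<bullet> x / 2)) x"
proof -
  let ?s = "x \<bullet> x / 2"
  have p: "partial i (\<lambda>x. k (x \<bullet> x / 2) *\<^sub>R x)
      = (\<lambda>x. k (x \<bullet> x / 2) *\<^sub>R axis i 1 + (x $ i) *\<^sub>R (k' (x \<bullet> x / 2) *\<^sub>R x))" for i :: 'n
    by (rule ext) (simp add: partial_radial_field[OF k] mult.commute)
  have "((\<lambda>x. k (x \<bullet> x / 2) *\<^sub>R axis i 1 + (x $ i) *\<^sub>R (k' (x \<bullet> x / 2) *\<^sub>R x)) has_derivative
      (\<lambda>h. (k' ?s * (x \<bullet> h)) *\<^sub>R axis i 1
         + ((x $ i) *\<^sub>R (k' ?s *\<^sub>R h + (k'' ?s * (x \<bullet> h)) *\<^sub>R x) + (h $ i) *\<^sub>R (k' ?s *\<^sub>R x)))) (at x)"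
    for i :: 'n
    by (intro has_derivative_add has_derivative_scaleR has_derivative_radial_field[OF k']
        bounded_linear.has_derivative[OF bounded_linear_scaleR_left] has_derivative_radial[OF k]
        bounded_linear_imp_has_derivative bounded_linear_vec_nth)
  from partial_eq[OF this] have "laplacian (\<lambda>x. k (x \<bullet> x / 2) *\<^sub>R x) x
      = (\<Sum>i\<in>UNIV. (2 * k' ?s) *\<^sub>R (x $ i *\<^sub>R axis i 1) + (k'' ?s * (x $ i * x $ i)) *\<^sub>R x + k' ?s *\<^sub>R x)"
    unfolding laplacian_def p
    by (intro sum.cong) (auto simp: vec_eq_iff inner_axis algebra_simps)
  also have "\<dots> = (2 * k' ?s) *\<^sub>R (\<Sum>i\<in>UNIV. x $ i *\<^sub>R axis i 1) + (k'' ?s * (x \<bullet> x)) *\<^sub>R x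
      + (real CARD('n) * k' ?s) *\<^sub>R x"
    by (simp add: sum.distrib scaleR_sum_right scaleR_sum_left sum_distrib_left inner_vec_def[of x x]
        sum_constant_scaleR mult.assoc del: sum_constant)
  also have "(\<Sum>i\<in>UNIV. x $ i *\<^sub>R axis i 1) = x"
    by (simp add: vec_eq_iff axis_def if_distrib[of "\<lambda>c. _ * c"] sum.delta cong: if_cong)
  also have "(2 * k' ?s) *\<^sub>R x + (k'' ?s * (x \<bullet> x)) *\<^sub>R x + (real CARD('n) * k' ?s) *\<^sub>R x
      = (real CARD('n) * k' ?s + (2 * k' ?s + 2 * ?s * k'' ?s)) *\<^sub>R x"
    by (simp add: algebra_simps)
  also have "\<dots> = grad (\<lambda>x. real CARD('n) * k (x \<bullet> x / 2) + (2 * (x \<bullet> x / 2)) * k' (x \<bullet> x / 2)) x"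
    by (rule grad_radial[symmetric]) (auto intro!: derivative_eq_intros k k')
  finally show ?thesis by simp
qed

section \<open>Fubini for Lebesgue measurable functions\<close>

lemma AE_lebesgue_sections:
  assumes "AE z in (lebesgue :: ('a::euclidean_space \<times> 'b::euclidean_space) measure). P z"
  shows "AE t in lebesgue. AE x in lebesgue. P (t, x)"
proof -
  have "AE z in lborel \<Otimes>\<^sub>M lborel. P z"
    using assms unfolding AE_completion_iff lborel_prod .
  from lborel_pair.AE_pair[OF this] show ?thesis
    unfolding AE_completion_iff .
qed

text \<open>Fubini's theorem is available for the product of Borel measures, whereas the fields are measurable for the
  completed measure on space-time. Sections of a Lebesgue measurable function need not be measurable; they are so
  for almost every \<open>t\<close>, because they then agree almost everywhere with those of a Borel function.\<close>

lemma borel_representative: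
  fixes G :: "'a::euclidean_space \<times> 'b::euclidean_space \<Rightarrow> real"
  assumes "G \<in> borel_measurable lebesgue"
  obtains G' where "G' \<in> borel_measurable (lborel \<Otimes>\<^sub>M lborel)" "AE z in lebesgue. G z = G' z"
    "AE t in lebesgue. AE x in lebesgue. G (t, x) = G' (t, x)"
proof -
  obtain G' where G': "G' \<in> borel_measurable lborel" "AE z in lborel. G z = G' z"
    using completion_ex_borel_measurable_real[OF assms] by auto
  then have "AE z in lebesgue. G z = G' z"
    unfolding AE_completion_iff by simp
  from AE_lebesgue_sections[OF this] this G' show ?thesis
    by (intro that[of G']) (simp_all add: lborel_prod)
qed

lemma borel_measurable_section:
  fixes G' :: "'a::euclidean_space \<times> 'b::euclidean_space \<Rightarrow> real"
  assumes "G' \<in> borel_measurable (lborel \<Otimes>\<^sub>M lborel)"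
  shows "(\<lambda>x. G' (t, x)) \<in> borel_measurable lborel"
proof -
  have "G' \<circ> Pair t \<in> borel_measurable lborel"
    by (rule measurable_comp[OF measurable_Pair1' assms]) simp
  then show ?thesis by (simp add: comp_def)
qed

lemma borel_measurable_lebesgue_lint:
  fixes G :: "'a::euclidean_space \<times> 'b::euclidean_space \<Rightarrow> real"
  assumes "G \<in> borel_measurable lebesgue"
  shows "(\<lambda>t. LINT x|lebesgue. G (t, x)) \<in> borel_measurable lebesgue"
proof -
  obtain G' where G': "G' \<in> borel_measurable (lborel \<Otimes>\<^sub>M lborel)"
      "AE t in lebesgue. AE x in lebesgue. G (t, x) = G' (t, x)"
    by (rule borel_representative[OF assms]) (rule that)
  note sec = borel_measurable_section[OF G'(1)]
  have "(\<lambda>t. LINT x|lborel. G' (t, x)) \<in> borel_measurable lebesgue"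
    using lborel.borel_measurable_lebesgue_integral[of "\<lambda>t x. G' (t, x)" lborel] G'(1)
    by (intro measurable_completion) simp
  moreover have "AE t in lebesgue. (LINT x|lborel. G' (t, x)) = (LINT x|lebesgue. G (t, x))"
    using G'(2)
  proof eventually_elim
    case (elim t)
    have "(\<lambda>x. G' (t, x)) \<in> borel_measurable lebesgue"
      using sec by (rule measurable_completion)
    moreover from this have "(\<lambda>x. G (t, x)) \<in> borel_measurable lebesgue"
      by (rule borel_measurable_AE) (use elim in eventually_elim, simp)
    ultimately have "(LINT x|lebesgue. G (t, x)) = (LINT x|lebesgue. G' (t, x))"
      using elim by (intro integral_cong_AE)
    also have "\<dots> = (LINT x|lborel. G' (t, x))"
      using sec by (rule integral_completion)
    finally show ?case by simp
  qed
  ultimately show ?thesis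
    by (rule borel_measurable_AE)
qed

lemma AE_lebesgue_product:
  fixes G :: "'a::euclidean_space \<times> 'b::euclidean_space \<Rightarrow> real"
  assumes "G \<in> borel_measurable lebesgue" "AE t in lebesgue. AE x in lebesgue. G (t, x) = 0"
  shows "AE z in lebesgue. G z = 0"
proof -
  obtain G' where G': "G' \<in> borel_measurable (lborel \<Otimes>\<^sub>M lborel)" "AE z in lebesgue. G z = G' z"
      "AE t in lebesgue. AE x in lebesgue. G (t, x) = G' (t, x)"
    by (rule borel_representative[OF assms(1)]) (rule that)
  have "AE t in lebesgue. AE x in lebesgue. G' (t, x) = 0"
    using assms(2) G'(3)
  proof eventually_elim
    case (elim t)
    then show ?case by eventually_elim simp
  qed
  then have "AE t in lborel. AE x in lborel. G' (t, x) = 0"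
    unfolding AE_completion_iff .
  then have "AE z in lborel \<Otimes>\<^sub>M lborel. G' z = 0"
    by (intro lborel_pair.AE_pair_measure borel_measurable_eq G'(1) borel_measurable_const)
  then have "AE z in lebesgue. G' z = 0"
    unfolding AE_completion_iff lborel_prod .
  with G'(2) show ?thesis by eventually_elim simp
qed

lemma AE_finite_nn_integral_section:
  fixes G :: "'a::euclidean_space \<times> 'b::euclidean_space \<Rightarrow> real"
  assumes "G \<in> borel_measurable lebesgue"
    and "(\<integral>\<^sup>+ t. (\<integral>\<^sup>+ x. ennreal (G (t, x)) \<partial>lebesgue) \<partial>lebesgue) < \<infinity>"
  shows "AE t in lebesgue. (\<integral>\<^sup>+ x. ennreal (G (t, x)) \<partial>lebesgue) < \<infinity>"
proof -
  obtain G' where G': "G' \<in> borel_measurable (lborel \<Otimes>\<^sub>M lborel)"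
      "AE t in lebesgue. AE x in lebesgue. G (t, x) = G' (t, x)"
    by (rule borel_representative[OF assms(1)]) (rule that)
  have eq: "AE t in lebesgue. (\<integral>\<^sup>+ x. ennreal (G (t, x)) \<partial>lebesgue) = (\<integral>\<^sup>+ x. ennreal (G' (t, x)) \<partial>lborel)"
    using G'(2)
  proof eventually_elim
    case (elim t)
    have "(\<integral>\<^sup>+ x. ennreal (G (t, x)) \<partial>lebesgue) = (\<integral>\<^sup>+ x. ennreal (G' (t, x)) \<partial>lebesgue)"
      using elim by (intro nn_integral_cong_AE) (auto elim: eventually_mono)
    then show ?case by (simp add: nn_integral_completion)
  qed
  have "(\<integral>\<^sup>+ t. (\<integral>\<^sup>+ x. ennreal (G' (t, x)) \<partial>lborel) \<partial>lborel) \<noteq> \<infinity>"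
    using nn_integral_cong_AE[OF eq] assms(2) by (simp add: nn_integral_completion less_top)
  moreover have "(\<lambda>t. \<integral>\<^sup>+ x. ennreal (G' (t, x)) \<partial>lborel) \<in> borel_measurable lborel"
    using G'(1) by measurable
  ultimately have "AE t in lborel. (\<integral>\<^sup>+ x. ennreal (G' (t, x)) \<partial>lborel) \<noteq> \<infinity>"
    by (intro nn_integral_PInf_AE)
  then have "AE t in lebesgue. (\<integral>\<^sup>+ x. ennreal (G' (t, x)) \<partial>lborel) \<noteq> \<infinity>"
    unfolding AE_completion_iff .
  with eq show ?thesis by eventually_elim (simp add: less_top)
qed

lemma AE_lebesgue_on_iff:
  "S \<in> sets lebesgue \<Longrightarrow> (AE x in lebesgue_on S. P x) \<longleftrightarrow> (AE x in lebesgue. x \<in> S \<longrightarrow> P x)"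
  by (simp add: AE_restrict_space_iff)

text \<open>The positive and the negative part of \<open>c\<close> are densities of two finite measures that agree on all half
  lines, hence are equal.\<close>

lemma eq_0_AE_if_interval_integrals_0:
  fixes c :: "real \<Rightarrow> real"
  assumes c: "integrable lebesgue c" and supp: "\<And>t. t \<notin> {0<..<T} \<Longrightarrow> c t = 0"
    and zero: "\<And>a b. 0 < a \<Longrightarrow> a < b \<Longrightarrow> b < T \<Longrightarrow> (LINT t|lebesgue. indicator {a<..<b} t * c t) = 0"
  shows "AE t in lebesgue. c t = 0"
proof -
  have [measurable]: "c \<in> borel_measurable lebesgue"
    using c by auto
  have half_line: "(LINT t|lebesgue. indicator {x<..} t * c t) = 0" for x :: real
  proof -
    \<comment> \<open>The half line is approached from inside \<open>(0, T)\<close>, where the hypothesis applies.\<close>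
    define I where "I n = {max x 0 + 1 / real (Suc n)<..<T - 1 / real (Suc n)}" for n
    have I0: "(LINT t|lebesgue. indicator (I n) t * c t) = 0" for n
    proof (cases "max x 0 + 1 / real (Suc n) < T - 1 / real (Suc n)")
      case True
      have "0 < 1 / real (Suc n)" by simp
      moreover from this have "0 < max x 0 + 1 / real (Suc n)"
        by (intro add_nonneg_pos) auto
      ultimately show ?thesis unfolding I_def using True by (intro zero) (auto simp del: of_nat_Suc)
    next
      case False
      then have "I n = {}" unfolding I_def by auto
      then show ?thesis by simp
    qed
    have "(\<lambda>n. LINT t|lebesgue. indicator (I n) t * c t) \<longlonglongrightarrow> (LINT t|lebesgue. indicator {x<..} t * c t)"
    proof (rule integral_dominated_convergence[where w = "\<lambda>t. norm (c t)"])
      show "(\<lambda>t. indicator {x<..} t * c t) \<in> borel_measurable lebesgue"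
        "(\<lambda>t. indicator (I n) t * c t) \<in> borel_measurable lebesgue" for n
        by (auto simp: I_def intro!: borel_measurable_times borel_measurable_indicator)
      show "integrable lebesgue (\<lambda>t. norm (c t))" using c by simp
      show "AE t in lebesgue. norm (indicator (I n) t * c t) \<le> norm (c t)" for n
        by (auto simp: indicator_def)
      show "AE t in lebesgue. (\<lambda>n. indicator (I n) t * c t) \<longlonglongrightarrow> indicator {x<..} t * c t"
      proof (rule AE_I2)
        fix t
        have lim: "(\<lambda>n. 1 / real (Suc n)) \<longlonglongrightarrow> 0"
          by (rule LIMSEQ_Suc[OF lim_1_over_n])
        consider "t \<notin> {0<..<T}" | "t \<in> {0<..<T}" "t \<le> x" | "t \<in> {0<..<T}" "t > x" by fastforce
        then show "(\<lambda>n. indicator (I n) t * c t) \<longlonglongrightarrow> indicator {x<..} t * c t"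
        proof cases
          case 1
          then show ?thesis by (simp add: supp)
        next
          case 2
          have "t \<notin> I n" for n
          proof
            assume "t \<in> I n"
            then have "max x 0 + 1 / real (Suc n) < t" by (simp add: I_def)
            moreover have "0 < 1 / real (Suc n)" by simp
            ultimately show False using \<open>t \<le> x\<close> by linarith
          qed
          with 2 show ?thesis by (simp add: indicator_def)
        next
          case 3
          then have "min (t - max x 0) (T - t) > 0" by auto
          from order_tendstoD(2)[OF lim this]
          have "\<forall>\<^sub>F n in sequentially. indicator (I n) t * c t = indicator {x<..} t * c t"
            by eventually_elim (use 3 in \<open>auto simp: I_def indicator_def\<close>)
          then show ?thesis by (rule tendsto_eventually)
        qed
      qed
    qed
    then show ?thesis
      unfolding I0 using LIMSEQ_unique tendsto_const by blast
  qed
  obtain c' where c'[measurable]: "c' \<in> borel_measurable lborel" and eq: "AE t in lborel. c t = c' t"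
    using completion_ex_borel_measurable_real[OF \<open>c \<in> borel_measurable lebesgue\<close>] by auto
  have eq': "AE t in lebesgue. c t = c' t"
    using eq unfolding AE_completion_iff .
  have "c' \<in> borel_measurable lebesgue"
    using c' by (rule measurable_completion)
  with c eq' have "integrable lebesgue c'"
    by (subst (asm) integrable_cong_AE) auto
  then have int: "integrable lborel c'"
    using c' by (simp add: integrable_completion)
  have "density lborel (\<lambda>t. ennreal (c' t)) = density lborel (\<lambda>t. ennreal (- c' t))"
  proof (rule measure_eqI_lessThan)
    fix x :: real
    have em: "emeasure (density lborel (\<lambda>t. ennreal (d t))) {x<..}
        = ennreal (LINT t|lborel. indicator {x<..} t * max 0 (d t))"
      if d: "integrable lborel d" for d :: "real \<Rightarrow> real"
    proof -
      have [measurable]: "d \<in> borel_measurable lborel" using d by auto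
      have "integrable lborel (\<lambda>t. indicator {x<..} t * max 0 (d t))"
        using integrable_mult_indicator[of "{x<..}" lborel "\<lambda>t. max 0 (d t)"] d by simp
      moreover have "emeasure (density lborel (\<lambda>t. ennreal (d t))) {x<..}
          = (\<integral>\<^sup>+ t. ennreal (indicator {x<..} t * max 0 (d t)) \<partial>lborel)"
        by (subst emeasure_density)
           (auto intro!: nn_integral_cong simp: indicator_def max_def ennreal_neg)
      ultimately show ?thesis
        by (subst (asm) nn_integral_eq_integral) (auto simp: indicator_def)
    qed
    have "(LINT t|lborel. indicator {x<..} t * max 0 (c' t)) - (LINT t|lborel. indicator {x<..} t * max 0 (- c' t))
        = (LINT t|lborel. indicator {x<..} t * max 0 (c' t) - indicator {x<..} t * max 0 (- c' t))"
      using int integrable_mult_indicator[of "{x<..}" lborel "\<lambda>t. max 0 (c' t)"]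
        integrable_mult_indicator[of "{x<..}" lborel "\<lambda>t. max 0 (- c' t)"]
      by (intro Bochner_Integration.integral_diff[symmetric]) auto
    also have "\<dots> = (LINT t|lborel. indicator {x<..} t * c' t)"
      by (intro Bochner_Integration.integral_cong) (auto simp: indicator_def)
    also have "\<dots> = (LINT t|lebesgue. indicator {x<..} t * c' t)"
      by (intro integral_completion[symmetric]) auto
    also have "\<dots> = (LINT t|lebesgue. indicator {x<..} t * c t)"
      using eq' \<open>c' \<in> borel_measurable lebesgue\<close>
      by (intro integral_cong_AE) (auto intro!: borel_measurable_times borel_measurable_indicator)
    finally have "(LINT t|lborel. indicator {x<..} t * max 0 (c' t))
        = (LINT t|lborel. indicator {x<..} t * max 0 (- c' t))"
      using half_line[of x] by simp
    with em[of c'] em[of "\<lambda>t. - c' t"] int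
    show "emeasure (density lborel (\<lambda>t. ennreal (c' t))) {x<..} = emeasure (density lborel (\<lambda>t. ennreal (- c' t))) {x<..}"
      "emeasure (density lborel (\<lambda>t. ennreal (c' t))) {x<..} < \<infinity>"
      by simp_all
  qed auto
  then have "AE t in lborel. ennreal (c' t) = ennreal (- c' t)"
    by (intro sigma_finite_measure.density_unique[OF sigma_finite_lborel]) auto
  then have "AE t in lborel. c' t = 0"
  proof eventually_elim
    case (elim t)
    then show ?case
      by (cases "c' t \<ge> 0") (auto simp: ennreal_neg dest: sym)
  qed
  with eq have "AE t in lborel. c t = 0"
    by eventually_elim simp
  then show ?thesis
    unfolding AE_completion_iff .
qed

section \<open>Localization in time\<close>

text \<open>Extension by 0 to all times, so that Fubini's theorem can be applied on the whole space.\<close>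

definition slab_ext :: "real \<Rightarrow> (real \<Rightarrow> 'a \<Rightarrow> 'b::zero) \<Rightarrow> real \<times> 'a \<Rightarrow> 'b"
  where "slab_ext T u z = (if fst z \<in> {0<..<T} then u (fst z) (snd z) else 0)"

text \<open>Measurability is only given on \<open>(0, T) \<times> K\<close> for compact \<open>K\<close>; the balls of integral radius exhaust the space.\<close>

lemma borel_measurable_slab_ext:
  assumes "in_LLloc s T q u"
  shows "slab_ext T u \<in> borel_measurable lebesgue"
proof (rule borel_measurable_LIMSEQ_metric)
  fix n :: nat
  have "(\<lambda>(t, x). u t x) \<in> borel_measurable (lebesgue_on ({0<..<T} \<times> cball 0 (real n)))"
    using assms by (simp add: in_LLloc_def in_LL_def)
  moreover have "{0<..<T} \<times> cball 0 (real n) \<in> sets lebesgue"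
    by (intro sets_completionI_sets) (auto intro!: borel_Times)
  ultimately show "(\<lambda>z. if z \<in> {0<..<T} \<times> cball 0 (real n) then (case z of (t, x) \<Rightarrow> u t x) else 0)
      \<in> borel_measurable lebesgue"
    by (rule borel_measurable_if_I)
next
  fix z :: "real \<times> 'a"
  have "\<forall>\<^sub>F n in sequentially. norm (snd z) < real n"
    using filterlim_real_sequentially by (simp add: filterlim_at_top_dense)
  then have "\<forall>\<^sub>F n in sequentially. (if z \<in> {0<..<T} \<times> cball 0 (real n) then (case z of (t, x) \<Rightarrow> u t x) else 0)
      = slab_ext T u z"
    by eventually_elim (auto simp: slab_ext_def split: prod.splits)
  then show "(\<lambda>n. if z \<in> {0<..<T} \<times> cball 0 (real n) then (case z of (t, x) \<Rightarrow> u t x) else 0)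
      \<longlonglongrightarrow> slab_ext T u z"
    by (rule tendsto_eventually)
qed

lemma AE_in_L_balls:
  assumes "in_LLloc s T q u"
  shows "AE t in lebesgue_on {0<..<T}. \<forall>n::nat. in_L q (cball 0 (real n)) (u t)"
  using assms by (auto simp: AE_all_countable in_LLloc_def in_LL_def)

lemma borel_measurable_if_in_L_balls:
  fixes u :: "'a::euclidean_space \<Rightarrow> 'b::euclidean_space"
  assumes "\<forall>n::nat. in_L q (cball 0 (real n)) u"
  shows "u \<in> borel_measurable lebesgue"
proof (rule borel_measurable_LIMSEQ_metric)
  show "(\<lambda>x. if x \<in> cball 0 (real n) then u x else 0) \<in> borel_measurable lebesgue" for n
    using assms by (intro borel_measurable_if_I) (auto simp: in_L_def)
  fix x :: 'a
  have "\<forall>\<^sub>F n in sequentially. norm x < real n"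
    using filterlim_real_sequentially by (simp add: filterlim_at_top_dense)
  then show "(\<lambda>n. if x \<in> cball 0 (real n) then u x else 0) \<longlonglongrightarrow> u x"
    by (intro tendsto_eventually) (erule eventually_mono, simp)
qed

lemma integrable_lebesgue_on_iff:
  fixes f :: "'a::euclidean_space \<Rightarrow> real"
  assumes "S \<in> sets lebesgue"
  shows "integrable (lebesgue_on S) f \<longleftrightarrow> integrable lebesgue (\<lambda>x. indicator S x * f x)"
  using assms by (simp add: integrable_restrict_space)

lemma integrable_ball_if_in_L_balls:
  assumes "\<forall>n::nat. in_L q (cball 0 (real n)) u"
  shows "integrable lebesgue (\<lambda>x. indicator (cball 0 R) x * norm (u x) powr q)"
proof (rule Bochner_Integration.integrable_bound)
  let ?n = "nat \<lceil>R\<rceil>"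
  show "integrable lebesgue (\<lambda>x. indicator (cball 0 (real ?n)) x * norm (u x) powr q)"
    using assms by (simp add: in_L_def flip: integrable_lebesgue_on_iff)
  show "(\<lambda>x. indicator (cball 0 R) x * norm (u x) powr q) \<in> borel_measurable lebesgue"
    using borel_measurable_if_in_L_balls[OF assms]
    by (auto intro!: borel_measurable_times borel_measurable_indicator)
  have "R \<le> real ?n" by linarith
  then show "AE x in lebesgue. norm (indicator (cball 0 R) x * norm (u x) powr q)
      \<le> norm (indicator (cball 0 (real ?n)) x * norm (u x) powr q)"
    by (intro AE_I2) (auto simp: indicator_def)
qed

text \<open>The terms of the weak formulation have compact support in space and are dominated there by \<open>\<bar>u\<bar>\<^sup>q\<close>, so their
  spatial integrals are integrable in time for \<open>u\<close> in \<open>L\<^sup>q(0,T; L\<^sup>q)\<close> on compact sets.\<close>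

lemma integrable_time_integral:
  fixes G :: "real \<Rightarrow> 'a::euclidean_space \<Rightarrow> real" and u :: "real \<Rightarrow> 'a \<Rightarrow> 'b::euclidean_space"
  assumes meas: "slab_ext T G \<in> borel_measurable lebesgue" and u: "in_LLloc q T q u" and "q > 0"
    and bound: "\<And>t x. \<bar>G t x\<bar> \<le> C * (indicator (cball 0 R) x * norm (u t x) powr q)"
  shows "integrable (lebesgue_on {0<..<T}) (\<lambda>t. LINT x|lebesgue. G t x)"
    and "AE t in lebesgue_on {0<..<T}. integrable lebesgue (G t)"
proof -
  let ?I = "\<lambda>t. LINT x|lebesgue_on (cball 0 R). norm (u t x) powr q"
  have K: "in_LL q T q (cball 0 R) u"
    using u by (simp add: in_LLloc_def)
  have "norm (L_norm q (cball 0 R) (u t)) powr q = ?I t" for t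
    using \<open>q > 0\<close> by (simp add: L_norm_def powr_powr)
  with K have int: "integrable (lebesgue_on {0<..<T}) ?I"
    by (simp add: in_LL_def in_L_def)
  have sections: "AE t in lebesgue_on {0<..<T}. G t \<in> borel_measurable lebesgue"
  proof -
    obtain G' where G': "G' \<in> borel_measurable (lborel \<Otimes>\<^sub>M lborel)"
        "AE t in lebesgue. AE x in lebesgue. slab_ext T G (t, x) = G' (t, x)"
      by (rule borel_representative[OF meas]) (rule that)
    have "AE t in lebesgue. t \<in> {0<..<T} \<longrightarrow> G t \<in> borel_measurable lebesgue"
      using G'(2)
    proof eventually_elim
      case (elim t)
      show ?case
      proof
        assume t: "t \<in> {0<..<T}"
        have "(\<lambda>x. G' (t, x)) \<in> borel_measurable lebesgue"
          using borel_measurable_section[OF G'(1)] by (rule measurable_completion)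
        then show "G t \<in> borel_measurable lebesgue"
          by (rule borel_measurable_AE) (rule eventually_mono[OF elim], use t in \<open>simp add: slab_ext_def\<close>)
      qed
    qed
    then show ?thesis by (subst AE_lebesgue_on_iff) auto
  qed
  have ball: "AE t in lebesgue_on {0<..<T}. integrable lebesgue (\<lambda>x. indicator (cball 0 R) x * norm (u t x) powr q)"
    using AE_in_L_balls[OF u] by eventually_elim (rule integrable_ball_if_in_L_balls)
  from sections ball show G: "AE t in lebesgue_on {0<..<T}. integrable lebesgue (G t)"
  proof eventually_elim
    case (elim t)
    show ?case
    proof (rule Bochner_Integration.integrable_bound)
      show "integrable lebesgue (\<lambda>x. C * (indicator (cball 0 R) x * norm (u t x) powr q))"
        using elim by simp
      show "AE x in lebesgue. norm (G t x) \<le> norm (C * (indicator (cball 0 R) x * norm (u t x) powr q))"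
        using bound[of t] by (auto intro: order_trans[OF _ abs_ge_self])
    qed (use elim in simp)
  qed
  show "integrable (lebesgue_on {0<..<T}) (\<lambda>t. LINT x|lebesgue. G t x)"
  proof (rule Bochner_Integration.integrable_bound)
    show "integrable (lebesgue_on {0<..<T}) (\<lambda>t. C * ?I t)"
      using int by simp
    have "(\<lambda>t. if t \<in> {0<..<T} then LINT x|lebesgue. G t x else 0) \<in> borel_measurable lebesgue"
    proof (rule iffD1[OF arg_cong[of _ _ "\<lambda>h. h \<in> borel_measurable lebesgue"], rotated])
      show "(\<lambda>t. LINT x|lebesgue. slab_ext T G (t, x)) \<in> borel_measurable lebesgue"
        by (rule borel_measurable_lebesgue_lint[OF meas])
    qed (auto simp: slab_ext_def fun_eq_iff)
    then show "(\<lambda>t. LINT x|lebesgue. G t x) \<in> borel_measurable (lebesgue_on {0<..<T})"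
      by (rule borel_measurable_if_D)
    show "AE t in lebesgue_on {0<..<T}. norm (LINT x|lebesgue. G t x) \<le> norm (C * ?I t)"
      using G ball
    proof eventually_elim
      case (elim t)
      have "norm (LINT x|lebesgue. G t x) \<le> (LINT x|lebesgue. norm (G t x))"
        by (rule integral_norm_bound)
      also have "\<dots> \<le> (LINT x|lebesgue. C * (indicator (cball 0 R) x * norm (u t x) powr q))"
        using elim bound by (intro integral_mono) auto
      also have "\<dots> = C * ?I t"
        by (simp add: integral_restrict_space)
      finally show ?case by simp
    qed
  qed
qed

text \<open>The fundamental lemma of the calculus of variations: the test functions \<open>bump n a b\<close> converge boundedly to the
  indicator of \<open>(a, b)\<close>, so the integral of \<open>c\<close> over every interval vanishes.\<close>

lemma AE_0_if_test_integrals_0: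
  fixes c :: "real \<Rightarrow> real"
  assumes c: "integrable (lebesgue_on {0<..<T}) c"
    and zero: "\<And>\<xi>. \<xi> C1_differentiable_on UNIV \<Longrightarrow> compact_support_in {0<..<T} \<xi> \<Longrightarrow>
                 bounded (range \<xi>) \<Longrightarrow> \<xi> \<in> borel_measurable borel \<Longrightarrow>
                 (LINT t|lebesgue_on {0<..<T}. c t * \<xi> t) = 0"
  shows "AE t in lebesgue_on {0<..<T}. c t = 0"
proof -
  let ?c = "\<lambda>t. indicator {0<..<T} t * c t"
  have int: "integrable lebesgue ?c"
    using c by (simp add: integrable_lebesgue_on_iff)
  then have c_meas: "?c \<in> borel_measurable lebesgue" by auto
  have "AE t in lebesgue. ?c t = 0"
  proof (rule eq_0_AE_if_interval_integrals_0[OF int])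
    show "t \<notin> {0<..<T} \<Longrightarrow> ?c t = 0" for t by simp
    fix a b :: real
    assume ab: "0 < a" "a < b" "b < T"
    have bump: "C_real k (bump n a b)" for k n by (rule C_real_bump)
    have meas: "bump n a b \<in> borel_measurable borel" for n
      using bump[of 0 n] by (auto intro: borel_measurable_continuous_onI)
    have "(LINT t|lebesgue. ?c t * bump n a b t) = 0" for n
    proof -
      obtain f' where f': "\<And>s. (bump n a b has_real_derivative f' s) (at s)" "continuous_on UNIV f'"
        using bump[of "Suc 0" n] by auto
      have "bump n a b C1_differentiable_on UNIV"
        unfolding C1_differentiable_on_def
        using f'(1)[unfolded has_real_derivative_iff_has_vector_derivative] f'(2)
        by (intro exI[of _ f'] conjI ballI)
      moreover have "compact_support_in {0<..<T} (bump n a b)"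
        unfolding compact_support_in_def using ab
        by (intro exI[of _ "{a..b}"] conjI allI impI bump_support) auto
      moreover have "bounded (range (bump n a b))"
        unfolding bounded_iff using bump_nonneg[of n a b] bump_le_1[of n a b]
        by (intro exI[of _ 1]) auto
      ultimately have "(LINT t|lebesgue_on {0<..<T}. c t * bump n a b t) = 0"
        using meas by (intro zero)
      then show ?thesis
        by (simp add: integral_restrict_space mult.assoc)
    qed
    moreover have "(\<lambda>n. LINT t|lebesgue. ?c t * bump n a b t)
        \<longlonglongrightarrow> (LINT t|lebesgue. ?c t * indicator {a<..<b} t)"
    proof (rule integral_dominated_convergence[where w = "\<lambda>t. norm (?c t)"])
      show "(\<lambda>t. ?c t * bump n a b t) \<in> borel_measurable lebesgue" for n
        using meas[of n] by (intro borel_measurable_times[OF c_meas] measurable_completion) auto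
      show "(\<lambda>t. ?c t * indicator {a<..<b} t) \<in> borel_measurable lebesgue"
        by (intro borel_measurable_times[OF c_meas] borel_measurable_indicator) auto
      show "integrable lebesgue (\<lambda>t. norm (?c t))"
        using int by (rule integrable_norm)
      show "AE t in lebesgue. norm (?c t * bump n a b t) \<le> norm (?c t)" for n
      proof (rule AE_I2)
        fix t
        have "\<bar>?c t\<bar> * \<bar>bump n a b t\<bar> \<le> \<bar>?c t\<bar>"
          using bump_nonneg[of n a b] bump_le_1[of n a b] by (intro mult_left_le) auto
        then show "norm (?c t * bump n a b t) \<le> norm (?c t)"
          by (simp only: real_norm_def abs_mult)
      qed
      show "AE t in lebesgue. (\<lambda>n. ?c t * bump n a b t) \<longlonglongrightarrow> ?c t * indicator {a<..<b} t"
        by (intro AE_I2 tendsto_mult tendsto_const bump_tendsto)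
    qed
    ultimately have "(\<lambda>n. 0) \<longlonglongrightarrow> (LINT t|lebesgue. ?c t * indicator {a<..<b} t)"
      by simp
    then have "(LINT t|lebesgue. ?c t * indicator {a<..<b} t) = 0"
      using LIMSEQ_unique[OF tendsto_const] by metis
    then show "(LINT t|lebesgue. indicator {a<..<b} t * ?c t) = 0"
      by (simp add: mult.commute)
  qed
  then have "AE t in lebesgue. t \<in> {0<..<T} \<longrightarrow> c t = 0"
    by (rule eventually_mono) (auto simp: indicator_def split: if_splits)
  then show ?thesis
    by (subst AE_lebesgue_on_iff) simp_all
qed


section \<open>The stress and its radial part\<close>

text \<open>If \<open>\<kappa>\<close> is minus the derivative of a function that vanishes for large arguments, then \<open>tail \<kappa>\<close> is that
  function.\<close>

definition tail :: "(real \<Rightarrow> real) \<Rightarrow> real \<Rightarrow> real"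
  where "tail \<kappa> s = (LINT \<sigma>|lborel. indicator {s..} \<sigma> * \<kappa> \<sigma>)"

lemma tail_eq_0: "(\<And>\<sigma>. \<sigma> \<ge> B \<Longrightarrow> \<kappa> \<sigma> = 0) \<Longrightarrow> s \<ge> B \<Longrightarrow> tail \<kappa> s = 0"
proof -
  assume *: "\<And>\<sigma>. \<sigma> \<ge> B \<Longrightarrow> \<kappa> \<sigma> = 0" "s \<ge> B"
  then have "(\<lambda>\<sigma>. indicator {s..} \<sigma> * \<kappa> \<sigma>) = (\<lambda>\<sigma>. 0)"
    by (auto simp: indicator_def fun_eq_iff)
  then show ?thesis by (simp add: tail_def)
qed

lemma tail_has_derivative:
  assumes cont: "continuous_on UNIV \<kappa>" and supp: "\<And>\<sigma>. \<sigma> \<ge> B \<Longrightarrow> \<kappa> \<sigma> = 0"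
  shows "(tail \<kappa> has_real_derivative - \<kappa> s) (at s)"
proof -
  obtain F where F: "\<And>s. (F has_real_derivative \<kappa> s) (at s)" "F B = 0"
    by (rule C_real_antiderivative[OF cont, of B]) (rule that)
  have "tail \<kappa> s = - F s" for s
  proof (cases "s \<le> B")
    case True
    have "tail \<kappa> s = (LINT \<sigma>|lborel. \<kappa> \<sigma> * indicator {s..B} \<sigma>)"
      unfolding tail_def
      by (intro Bochner_Integration.integral_cong) (auto simp: indicator_def supp)
    also have "\<dots> = F B - F s"
      using True F(1) cont by (intro integral_FTC_Icc_real) (auto simp: continuous_on_eq_continuous_at)
    finally show ?thesis using F(2) by simp
  next
    case False
    have "F s = F B"
    proof (rule DERIV_isconst_end[of B s F])
      show "continuous_on {B..s} F"
        by (rule DERIV_continuous_on) (rule has_field_derivative_at_within[OF F(1)])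
      show "(F has_real_derivative 0) (at x)" if "B < x" for x
        using F(1)[of x] supp[of x] that by simp
    qed (use False in auto)
    moreover have "tail \<kappa> s = 0"
      using False supp by (intro tail_eq_0) auto
    ultimately show ?thesis using F(2) by simp
  qed
  then have "tail \<kappa> = (\<lambda>s. - F s)" by auto
  then show ?thesis
    using DERIV_minus[OF F(1)] by simp
qed

lemma C_real_tail:
  assumes "\<And>k. C_real k \<kappa>" and "\<And>\<sigma>. \<sigma> \<ge> B \<Longrightarrow> \<kappa> \<sigma> = 0"
  shows "C_real k (tail \<kappa>)"
proof -
  have "continuous_on UNIV \<kappa>"
    using assms(1)[of 0] by simp
  moreover have "C_real k (\<lambda>s. (-1) * \<kappa> s)"
    by (intro C_real_mult C_real_const assms(1))
  ultimately have "C_real (Suc k) (tail \<kappa>)"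
    using tail_has_derivative[of \<kappa> B] assms(2)
    by (intro C_real_SucI[where f' = "\<lambda>s. - \<kappa> s"]) auto
  then show ?thesis by (rule C_real_SucD)
qed

text \<open>With \<open>\<sigma> = v \<otimes> v - b \<otimes> b + (p + \<bar>b\<bar>\<^sup>2/2) I\<close>, the function below is the trace of \<open>\<sigma>\<close>, and \<open>stress_radial\<close> is
  the quadratic form \<open>x \<sqdot> \<sigma>x\<close>. A radial field sees nothing else of the stress:
  \<open>\<sigma> : \<nabla>(k(s) x) = k tr \<sigma> + k' x \<sqdot> \<sigma>x\<close>.\<close>

definition stress_trace :: "(real ^ 'n::finite \<Rightarrow> real ^ 'n) \<Rightarrow> (real ^ 'n \<Rightarrow> real ^ 'n) \<Rightarrow> (real ^ 'n \<Rightarrow> real) \<Rightarrow> real ^ 'n \<Rightarrow> real"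
  where "stress_trace v b p x =
    (norm (v x))\<^sup>2 - (norm (b x))\<^sup>2 + real CARD('n) * (p x + (norm (b x))\<^sup>2 / 2)"

definition stress_radial :: "(real ^ 'n::finite \<Rightarrow> real ^ 'n) \<Rightarrow> (real ^ 'n \<Rightarrow> real ^ 'n) \<Rightarrow> (real ^ 'n \<Rightarrow> real) \<Rightarrow> real ^ 'n \<Rightarrow> real"
  where "stress_radial v b p x =
    (v x \<bullet> x)\<^sup>2 - (b x \<bullet> x)\<^sup>2 + (norm x)\<^sup>2 * (p x + (norm (b x))\<^sup>2 / 2)"

text \<open>The bound that makes all integrands of the tested equation integrable: \<open>\<bar>x\<bar>\<^sup>2 k'\<close> is the size of the second part
  of the Jacobian \<open>k I + k' x \<otimes> x\<close>.\<close>

lemma radial_cutoff_bound: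
  fixes k k' :: "real \<Rightarrow> real"
  assumes "continuous_on UNIV k" "continuous_on UNIV k'" and "\<And>s. s \<ge> B \<Longrightarrow> k s = 0 \<and> k' s = 0" and "B > 0"
  obtains C where "C \<ge> 0" "\<And>x :: real ^ 'n::finite. \<bar>k (x \<bullet> x / 2)\<bar> + \<bar>k' (x \<bullet> x / 2)\<bar> * (norm x)\<^sup>2
      \<le> C * indicator (cball 0 (sqrt (2 * B))) x"
proof -
  define m where "m s = \<bar>k s\<bar> + \<bar>k' s\<bar> * (2 * s)" for s
  have "continuous_on {0..B} m"
    unfolding m_def using assms by (intro continuous_intros) (auto intro: continuous_on_subset)
  then have "bounded (m ` {0..B})"
    by (intro compact_imp_bounded compact_continuous_image) auto
  then obtain C where "\<forall>y \<in> m ` {0..B}. norm y \<le> C"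
    unfolding bounded_iff by blast
  then have C: "norm (m s) \<le> C" if "s \<in> {0..B}" for s
    using that by blast
  show ?thesis
  proof
    have "norm (m B) \<le> C" using C[of B] \<open>B > 0\<close> by auto
    then show "C \<ge> 0" using norm_ge_zero order_trans by blast
    fix x :: "real ^ 'n"
    have sq: "(norm x)\<^sup>2 = 2 * (x \<bullet> x / 2)" by (simp add: power2_norm_eq_inner)
    have "norm x \<le> sqrt (2 * B)" if "x \<bullet> x / 2 \<le> B"
      using that by (auto simp: sq intro!: real_le_rsqrt)
    moreover have "m (x \<bullet> x / 2) \<le> C" if "x \<bullet> x / 2 \<le> B"
      using C[of "x \<bullet> x / 2"] that by auto
    moreover have "m (x \<bullet> x / 2) = 0" if "\<not> x \<bullet> x / 2 \<le> B"
      using assms(3)[of "x \<bullet> x / 2"] that by (simp add: m_def)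
    ultimately show "\<bar>k (x \<bullet> x / 2)\<bar> + \<bar>k' (x \<bullet> x / 2)\<bar> * (norm x)\<^sup>2
        \<le> C * indicator (cball 0 (sqrt (2 * B))) x"
      unfolding sq m_def[symmetric] using \<open>C \<ge> 0\<close>
      by (cases "x \<bullet> x / 2 \<le> B") (auto simp: indicator_def)
  qed
qed

definition loc_integrable :: "('a::euclidean_space \<Rightarrow> real) \<Rightarrow> bool"
  where "loc_integrable f \<longleftrightarrow> (\<forall>R. integrable lebesgue (\<lambda>x. indicator (cball 0 R) x * f x))"

lemma loc_integrable_cmult: "loc_integrable f \<Longrightarrow> loc_integrable (\<lambda>x. c * f x)"
  by (simp add: loc_integrable_def mult.left_commute[of _ c])

lemma loc_integrable_add: "loc_integrable f \<Longrightarrow> loc_integrable g \<Longrightarrow> loc_integrable (\<lambda>x. f x + g x)"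
  by (simp add: loc_integrable_def distrib_left)

lemma loc_integrable_diff: "loc_integrable f \<Longrightarrow> loc_integrable g \<Longrightarrow> loc_integrable (\<lambda>x. f x - g x)"
  by (simp add: loc_integrable_def right_diff_distrib)

lemma borel_measurable_loc_integrable:
  assumes "loc_integrable f"
  shows "f \<in> borel_measurable lebesgue"
proof (rule borel_measurable_LIMSEQ_metric)
  show "(\<lambda>x. indicator (cball 0 (real n)) x * f x) \<in> borel_measurable lebesgue" for n
    using assms by (auto simp: loc_integrable_def)
  fix x :: 'a
  have "\<forall>\<^sub>F n in sequentially. norm x < real n"
    using filterlim_real_sequentially by (simp add: filterlim_at_top_dense)
  then show "(\<lambda>n. indicator (cball 0 (real n)) x * f x) \<longlonglongrightarrow> f x"
    by (intro tendsto_eventually) (erule eventually_mono, simp)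
qed

lemma loc_integrable_bound:
  assumes f: "loc_integrable f" and g: "g \<in> borel_measurable lebesgue"
    and bound: "\<And>R x. norm x \<le> R \<Longrightarrow> \<bar>g x\<bar> \<le> C R * \<bar>f x\<bar>"
  shows "loc_integrable g"
  unfolding loc_integrable_def
proof
  fix R
  show "integrable lebesgue (\<lambda>x. indicator (cball 0 R) x * g x)"
  proof (rule Bochner_Integration.integrable_bound)
    show "integrable lebesgue (\<lambda>x. C R * (indicator (cball 0 R) x * f x))"
      using f by (simp add: loc_integrable_def)
    show "(\<lambda>x. indicator (cball 0 R) x * g x) \<in> borel_measurable lebesgue"
      using g by (intro borel_measurable_times borel_measurable_indicator) auto
    have "\<bar>g x\<bar> \<le> \<bar>C R\<bar> * \<bar>f x\<bar>" if "norm x \<le> R" for x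
      using bound[OF that] by (rule order_trans) (intro mult_right_mono, auto)
    then show "AE x in lebesgue. norm (indicator (cball 0 R) x * g x) \<le> norm (C R * (indicator (cball 0 R) x * f x))"
      by (intro AE_I2) (auto simp: indicator_def abs_mult)
  qed
qed

lemma integrable_cutoff_mult:
  assumes f: "loc_integrable f" and h: "h \<in> borel_measurable lebesgue"
    and bound: "\<And>x. \<bar>h x\<bar> \<le> C * indicator (cball 0 R) x"
  shows "integrable lebesgue (\<lambda>x. h x * f x)"
proof (rule Bochner_Integration.integrable_bound)
  show "integrable lebesgue (\<lambda>x. C * (indicator (cball 0 R) x * f x))"
    using f by (simp add: loc_integrable_def)
  show "(\<lambda>x. h x * f x) \<in> borel_measurable lebesgue"
    using h borel_measurable_loc_integrable[OF f] by (rule borel_measurable_times)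
  show "AE x in lebesgue. norm (h x * f x) \<le> norm (C * (indicator (cball 0 R) x * f x))"
  proof (rule AE_I2)
    fix x
    have "\<bar>h x\<bar> * \<bar>f x\<bar> \<le> \<bar>C * indicator (cball 0 R) x\<bar> * \<bar>f x\<bar>"
      using bound[of x] by (intro mult_right_mono) auto
    then show "norm (h x * f x) \<le> norm (C * (indicator (cball 0 R) x * f x))"
      by (simp add: abs_mult mult.assoc)
  qed
qed

lemma loc_integrable_power2:
  "\<forall>n::nat. in_L 2 (cball 0 (real n)) u \<Longrightarrow> loc_integrable (\<lambda>x. (norm (u x))\<^sup>2)"
  using integrable_ball_if_in_L_balls[of 2 u] by (simp add: loc_integrable_def)

lemma loc_integrable_norm:
  "\<forall>n::nat. in_L 1 (cball 0 (real n)) u \<Longrightarrow> loc_integrable (\<lambda>x. norm (u x))"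
  using integrable_ball_if_in_L_balls[of 1 u] by (simp add: loc_integrable_def)

text \<open>The regularity that a weak solution has at almost every time.\<close>

definition MHD_state :: "(real ^ 'n::finite \<Rightarrow> real ^ 'n) \<Rightarrow> (real ^ 'n \<Rightarrow> real ^ 'n) \<Rightarrow> (real ^ 'n \<Rightarrow> real) \<Rightarrow> bool"
  where "MHD_state v b p \<longleftrightarrow> v \<in> borel_measurable lebesgue \<and> b \<in> borel_measurable lebesgue \<and>
    loc_integrable (\<lambda>x. (norm (v x))\<^sup>2) \<and> loc_integrable (\<lambda>x. (norm (b x))\<^sup>2) \<and> loc_integrable p"

lemma borel_measurable_lebesgueI:
  "h \<in> borel_measurable borel \<Longrightarrow> h \<in> borel_measurable (lebesgue :: 'a::euclidean_space measure)"
  by (rule measurable_completion) simp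

lemma loc_integrable_inner_sq:
  fixes u :: "'a::euclidean_space \<Rightarrow> 'a"
  assumes "loc_integrable (\<lambda>x. (norm (u x))\<^sup>2)" "u \<in> borel_measurable lebesgue"
  shows "loc_integrable (\<lambda>x. (u x \<bullet> x)\<^sup>2)"
proof (rule loc_integrable_bound[OF assms(1), where C = "\<lambda>R. R\<^sup>2"])
  show "(\<lambda>x. (u x \<bullet> x)\<^sup>2) \<in> borel_measurable lebesgue"
    by (intro borel_measurable_power borel_measurable_inner assms(2) borel_measurable_lebesgueI) simp
  fix R and x :: 'a
  assume "norm x \<le> R"
  then have "\<bar>u x \<bullet> x\<bar> \<le> norm (u x) * R"
    by (intro order_trans[OF Cauchy_Schwarz_ineq2] mult_left_mono) auto
  then have "\<bar>u x \<bullet> x\<bar>\<^sup>2 \<le> (norm (u x) * R)\<^sup>2"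
    by (rule power_mono) simp
  then show "\<bar>(u x \<bullet> x)\<^sup>2\<bar> \<le> R\<^sup>2 * \<bar>(norm (u x))\<^sup>2\<bar>"
    by (simp add: power_mult_distrib mult.commute)
qed

lemma loc_integrable_norm_sq_mult:
  assumes "loc_integrable f"
  shows "loc_integrable (\<lambda>x. (norm x)\<^sup>2 * f x)"
proof (rule loc_integrable_bound[OF assms, where C = "\<lambda>R. R\<^sup>2"])
  show "(\<lambda>x. (norm x)\<^sup>2 * f x) \<in> borel_measurable lebesgue"
    by (intro borel_measurable_times borel_measurable_lebesgueI borel_measurable_loc_integrable[OF assms]) auto
  show "\<bar>(norm x)\<^sup>2 * f x\<bar> \<le> R\<^sup>2 * \<bar>f x\<bar>" if "norm x \<le> R" for R and x :: 'a
    using that by (auto simp: abs_mult intro!: mult_right_mono power_mono)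
qed

lemma loc_integrable_stress:
  assumes "MHD_state v b p"
  shows "loc_integrable (stress_trace v b p)" "loc_integrable (stress_radial v b p)"
proof -
  have q: "loc_integrable (\<lambda>x. p x + (norm (b x))\<^sup>2 / 2)"
    using loc_integrable_add[of p "\<lambda>x. (1 / 2) * (norm (b x))\<^sup>2"] assms
      loc_integrable_cmult[of "\<lambda>x. (norm (b x))\<^sup>2" "1 / 2"]
    by (simp add: MHD_state_def)
  show "loc_integrable (stress_trace v b p)"
    unfolding stress_trace_def[abs_def] using assms
    by (intro loc_integrable_add loc_integrable_diff loc_integrable_cmult q) (auto simp: MHD_state_def)
  show "loc_integrable (stress_radial v b p)"
    unfolding stress_radial_def[abs_def] using assms
    by (intro loc_integrable_add loc_integrable_diff loc_integrable_inner_sq loc_integrable_norm_sq_mult q)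
       (auto simp: MHD_state_def)
qed

lemma AE_MHD_state:
  assumes "MHD_weak_solution \<mu> \<nu> T f g v b p"
  shows "AE t in lebesgue_on {0<..<T}. MHD_state (v t) (b t) (p t)"
proof -
  have "in_LLloc 2 T 2 v" "in_LLloc 2 T 2 b" "in_LLloc 1 T 1 p"
    using assms by (simp_all add: MHD_weak_solution_def in_LLloc_sigma_def)
  from this[THEN AE_in_L_balls] show ?thesis
  proof eventually_elim
    case (elim t)
    note meas = elim[THEN borel_measurable_if_in_L_balls]
    have "loc_integrable (p t)"
      by (rule loc_integrable_bound[OF loc_integrable_norm[OF elim(3)] meas(3), where C = "\<lambda>_. 1"]) simp
    with elim meas show ?case
      by (simp add: MHD_state_def loc_integrable_power2)
  qed
qed

lemma st_integral_div_free:
  assumes "AE t in lebesgue_on {0<..<T}. div_free (u t)" "\<And>k. C_diff k \<psi>" "compact_support_in UNIV \<psi>"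
  shows "st_integral T (\<lambda>t x. (u t x \<bullet> grad \<psi> x) * \<eta> t) = 0"
  unfolding st_integral_def
proof (rule integral_eq_zero_AE)
  show "AE t in lebesgue_on {0<..<T}. (LINT x|lebesgue. (u t x \<bullet> grad \<psi> x) * \<eta> t) = 0"
    using assms(1) by eventually_elim (simp add: div_free_def assms(2,3))
qed

section \<open>The radial momentum identity\<close>

lemma C_real_linear: "C_real k (\<lambda>s. c * s)"
proof (cases k)
  case 0
  then show ?thesis by (auto intro: continuous_intros)
next
  case (Suc j)
  show ?thesis
    unfolding Suc
    by (rule C_real_SucI[where f' = "\<lambda>s. c"])
       (auto intro!: derivative_eq_intros C_real_const)
qed

lemma integrable_mult_bounded_range:
  fixes c \<xi> :: "real \<Rightarrow> real"
  assumes c: "integrable (lebesgue_on S) c" and "bounded (range \<xi>)" and \<xi>: "\<xi> \<in> borel_measurable borel"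
  shows "integrable (lebesgue_on S) (\<lambda>t. c t * \<xi> t)"
proof -
  obtain B where B: "\<And>t. norm (\<xi> t) \<le> B"
    using assms(2) by (auto simp: bounded_iff)
  show ?thesis
  proof (rule Bochner_Integration.integrable_bound)
    show "integrable (lebesgue_on S) (\<lambda>t. B * c t)" using c by simp
    show "(\<lambda>t. c t * \<xi> t) \<in> borel_measurable (lebesgue_on S)"
      using c by (intro borel_measurable_times borel_measurable_integrable
          measurable_restrict_space1[OF borel_measurable_lebesgueI[OF \<xi>]])
    show "AE t in lebesgue_on S. norm (c t * \<xi> t) \<le> norm (B * c t)"
    proof (rule AE_I2)
      fix t
      have "\<bar>\<xi> t\<bar> * \<bar>c t\<bar> \<le> \<bar>B\<bar> * \<bar>c t\<bar>"
        using B[of t] by (intro mult_right_mono) auto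
      then show "norm (c t * \<xi> t) \<le> norm (B * c t)"
        by (simp add: abs_mult mult.commute)
    qed
  qed
qed

text \<open>The momentum equation tested with \<open>\<xi>(t) k(s) x\<close>, where \<open>k = tail \<kappa>\<close>. The terms with the time derivative, the
  force and the viscosity vanish, because \<open>k(s) x\<close> and its Laplacian are gradients of smooth functions with
  compact support; the rest is localized in time.\<close>

lemma radial_momentum_identity:
  fixes v b f g :: "real \<Rightarrow> real ^ 'n::finite \<Rightarrow> real ^ 'n"
  assumes f: "in_LLloc_sigma 1 T 1 f" and sol: "MHD_weak_solution \<mu> \<nu> T f g v b p"
    and \<kappa>: "\<And>k. C_real k \<kappa>" "\<And>\<sigma>. \<sigma> \<ge> B \<Longrightarrow> \<kappa> \<sigma> = 0" and "B > 0"
  shows "AE t in lebesgue_on {0<..<T}.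
    (LINT x|lebesgue. tail \<kappa> (x \<bullet> x / 2) * stress_trace (v t) (b t) (p t) x) =
    (LINT x|lebesgue. \<kappa> (x \<bullet> x / 2) * stress_radial (v t) (b t) (p t) x)"
proof -
  let ?N = "real CARD('n)" and ?R = "sqrt (2 * B)"
  define k where "k = tail \<kappa>"
  have vbp: "in_LLloc 2 T 2 v" "in_LLloc 2 T 2 b" "in_LLloc 1 T 1 p"
    and div: "AE t in lebesgue_on {0<..<T}. div_free (v t)" "AE t in lebesgue_on {0<..<T}. div_free (f t)"
    using sol f by (simp_all add: MHD_weak_solution_def in_LLloc_sigma_def)
  have cont_\<kappa>: "continuous_on UNIV \<kappa>"
    using \<kappa>(1)[of 0] by simp
  have k: "(k has_real_derivative - \<kappa> s) (at s)" "C_real j k" for s j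
    using tail_has_derivative[OF cont_\<kappa> \<kappa>(2)] C_real_tail[OF \<kappa>] by (simp_all add: k_def)
  have k0: "k s = 0" if "s \<ge> B" for s
    using tail_eq_0[of B \<kappa> s] \<kappa>(2) that by (simp add: k_def)
  have cont: "continuous_on UNIV k" "continuous_on UNIV \<kappa>"
    using k(2)[of 0] cont_\<kappa> by auto
  obtain C where C: "C \<ge> 0" "\<And>x :: real ^ 'n. \<bar>k (x \<bullet> x / 2)\<bar> + \<bar>\<kappa> (x \<bullet> x / 2)\<bar> * (norm x)\<^sup>2 \<le> C * indicator (cball 0 ?R) x"
    by (rule radial_cutoff_bound[OF cont, of B]) (use k0 \<kappa>(2) \<open>B > 0\<close> that in auto)
  obtain \<kappa>' where \<kappa>': "\<And>s. (\<kappa> has_real_derivative \<kappa>' s) (at s)"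
    using \<kappa>(1)[of "Suc 0"] by auto

  define \<phi> where "\<phi> x = k (x \<bullet> x / 2) *\<^sub>R x" for x :: "real ^ 'n"
  have outside: "x \<bullet> x / 2 \<ge> B" if "x \<notin> cball 0 ?R" for x :: "real ^ 'n"
  proof -
    have "?R < norm x" using that by simp
    then have "?R\<^sup>2 \<le> (norm x)\<^sup>2"
      using \<open>B > 0\<close> by (intro power_mono) auto
    then show ?thesis using \<open>B > 0\<close> by (simp add: power2_norm_eq_inner)
  qed
  have support: "compact_support_in UNIV h" if "\<And>x. x \<bullet> x / 2 \<ge> B \<Longrightarrow> h x = 0"
    for h :: "real ^ 'n \<Rightarrow> 'b::zero"
    unfolding compact_support_in_def using that outside by (intro exI[of _ "cball 0 ?R"]) auto
  have \<phi>: "C_diff 2 \<phi>" "compact_support_in UNIV \<phi>"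
    unfolding \<phi>_def[abs_def]
    by (intro C_diff_scaleR C_diff_radial k C_diff_linear bounded_linear_ident) (auto intro!: support simp: k0)

  obtain F where F: "\<And>s. (F has_real_derivative k s) (at s)" "\<And>j. C_real j k \<Longrightarrow> C_real (Suc j) F" "F B = 0"
    by (rule C_real_antiderivative[OF cont(1), of B]) (rule that)
  have F0: "F s = 0" if "s \<ge> B" for s
  proof (cases "s = B")
    case False
    have "F s = F B"
    proof (rule DERIV_isconst_end[of B s F])
      show "continuous_on {B..s} F"
        by (rule DERIV_continuous_on) (rule has_field_derivative_at_within[OF F(1)])
      show "(F has_real_derivative 0) (at x)" if "B < x" for x
        using F(1)[of x] k0[of x] that by simp
    qed (use False that in auto)
    with F(3) show ?thesis by simp
  qed (simp add: F(3))
  have grad_F: "\<phi> x = grad (\<lambda>x. F (x \<bullet> x / 2)) x" for x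
    unfolding \<phi>_def by (rule grad_radial[OF F(1), symmetric])
  have lap: "laplacian \<phi> x = grad (\<lambda>x. ?N * k (x \<bullet> x / 2) + x \<bullet> x * - \<kappa> (x \<bullet> x / 2)) x" for x
    unfolding \<phi>_def[abs_def] by (rule laplacian_radial_field[OF k(1) DERIV_minus[OF \<kappa>']])
  have smooth_F: "C_diff j (\<lambda>x :: real ^ 'n. F (x \<bullet> x / 2))" for j
    by (rule C_diff_radial, rule C_real_SucD, rule F(2), rule k(2))
  have smooth_lap: "C_diff j (\<lambda>x :: real ^ 'n. ?N * k (x \<bullet> x / 2) + x \<bullet> x * - \<kappa> (x \<bullet> x / 2))" for j
  proof -
    have "C_real j (\<lambda>s. ?N * k s + (2 * s) * ((-1) * \<kappa> s))"
      by (intro C_real_add C_real_mult C_real_const k \<kappa> C_real_linear)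
    from C_diff_radial[OF this] show ?thesis by simp
  qed
  \<comment> \<open>Each of these terms pairs a divergence free field with a gradient.\<close>
  have zero: "st_integral T (\<lambda>t x. (v t x \<bullet> \<phi> x) * \<eta> t) = 0" "st_integral T (\<lambda>t x. (f t x \<bullet> \<phi> x) * \<eta> t) = 0"
    "st_integral T (\<lambda>t x. (v t x \<bullet> laplacian \<phi> x) * \<eta> t) = 0" for \<eta>
    unfolding grad_F lap
    by (intro st_integral_div_free[OF div(1)] st_integral_div_free[OF div(2)] smooth_F smooth_lap support;
        simp add: F0 k0 \<kappa>(2))+

  \<comment> \<open>\<open>G u\<close> is the contraction of \<open>u \<otimes> u\<close> with the Jacobian of the test field, \<open>D\<close> its divergence.\<close>
  define G where "G u t x = k (x \<bullet> x / 2) * (norm (u t x))\<^sup>2 + - \<kappa> (x \<bullet> x / 2) * (u t x \<bullet> x)\<^sup>2"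
    for u :: "real \<Rightarrow> real ^ 'n \<Rightarrow> real ^ 'n" and t x
  define D where "D x = ?N * k (x \<bullet> x / 2) + - \<kappa> (x \<bullet> x / 2) * (norm x)\<^sup>2" for x :: "real ^ 'n"
  have contract: "contract (tensor u u) (nabla \<phi> x)
      = k (x \<bullet> x / 2) * (norm u)\<^sup>2 + - \<kappa> (x \<bullet> x / 2) * (u \<bullet> x)\<^sup>2" for u x
    unfolding \<phi>_def[abs_def] by (rule contract_nabla_radial_field[OF k(1)])
  have diverg: "divergence \<phi> x = D x" for x
    unfolding \<phi>_def[abs_def] D_def by (rule divergence_radial_field[OF k(1)])

  have radial_meas: "(\<lambda>z :: real \<times> (real ^ 'n). h (snd z \<bullet> snd z / 2)) \<in> borel_measurable lebesgue"
    if "continuous_on UNIV h" for h :: "real \<Rightarrow> real"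
    by (intro borel_measurable_lebesgueI borel_measurable_continuous_onI continuous_on_compose2[OF that]
        continuous_intros) auto
  have snd_meas: "snd \<in> borel_measurable (lebesgue :: (real \<times> (real ^ 'n)) measure)"
    by (intro borel_measurable_lebesgueI borel_measurable_continuous_onI continuous_intros)
  have D_bound: "\<bar>D x\<bar> \<le> (?N * C) * indicator (cball 0 ?R) x" for x
  proof -
    have "\<bar>D x\<bar> \<le> ?N * \<bar>k (x \<bullet> x / 2)\<bar> + 1 * (\<bar>\<kappa> (x \<bullet> x / 2)\<bar> * (norm x)\<^sup>2)"
      unfolding D_def by (rule order_trans[OF abs_triangle_ineq]) (simp add: abs_mult)
    also have "\<dots> \<le> ?N * \<bar>k (x \<bullet> x / 2)\<bar> + ?N * (\<bar>\<kappa> (x \<bullet> x / 2)\<bar> * (norm x)\<^sup>2)"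
      by (intro add_left_mono mult_right_mono) (auto simp: Suc_leI)
    also have "\<dots> \<le> ?N * (C * indicator (cball 0 ?R) x)"
      unfolding distrib_left[symmetric] by (intro mult_left_mono C) simp
    finally show ?thesis by (simp add: mult.assoc)
  qed
  have G_bound: "\<bar>G u t x\<bar> \<le> C * (indicator (cball 0 ?R) x * norm (u t x) powr 2)" for u t x
  proof -
    have "\<bar>G u t x\<bar> \<le> \<bar>k (x \<bullet> x / 2)\<bar> * (norm (u t x))\<^sup>2 + \<bar>\<kappa> (x \<bullet> x / 2)\<bar> * (u t x \<bullet> x)\<^sup>2"
      unfolding G_def by (rule order_trans[OF abs_triangle_ineq]) (simp add: abs_mult)
    also have "(u t x \<bullet> x)\<^sup>2 \<le> (norm (u t x) * norm x)\<^sup>2"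
      using power_mono[OF Cauchy_Schwarz_ineq2[of "u t x" x], of 2] by simp
    then have "\<bar>k (x \<bullet> x / 2)\<bar> * (norm (u t x))\<^sup>2 + \<bar>\<kappa> (x \<bullet> x / 2)\<bar> * (u t x \<bullet> x)\<^sup>2
        \<le> \<bar>k (x \<bullet> x / 2)\<bar> * (norm (u t x))\<^sup>2 + \<bar>\<kappa> (x \<bullet> x / 2)\<bar> * (norm (u t x) * norm x)\<^sup>2"
      by (intro add_left_mono mult_left_mono) auto
    also have "\<dots> = (\<bar>k (x \<bullet> x / 2)\<bar> + \<bar>\<kappa> (x \<bullet> x / 2)\<bar> * (norm x)\<^sup>2) * (norm (u t x))\<^sup>2"
      by (simp add: algebra_simps power_mult_distrib)
    also have "\<dots> \<le> C * indicator (cball 0 ?R) x * (norm (u t x))\<^sup>2"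
      by (intro mult_right_mono C) simp
    finally show ?thesis by (simp add: mult.assoc)
  qed
  have G_meas: "slab_ext T (G u) \<in> borel_measurable lebesgue" if u: "in_LLloc 2 T 2 u" for u
  proof -
    have "(\<lambda>z. k (snd z \<bullet> snd z / 2) * (norm (slab_ext T u z))\<^sup>2
        + (- \<kappa> (snd z \<bullet> snd z / 2)) * (slab_ext T u z \<bullet> snd z)\<^sup>2) \<in> borel_measurable lebesgue"
      using borel_measurable_slab_ext[OF u]
      by (intro borel_measurable_add borel_measurable_times borel_measurable_power borel_measurable_norm
          borel_measurable_inner borel_measurable_uminus radial_meas cont snd_meas) auto
    also have "(\<lambda>z. k (snd z \<bullet> snd z / 2) * (norm (slab_ext T u z))\<^sup>2
        + (- \<kappa> (snd z \<bullet> snd z / 2)) * (slab_ext T u z \<bullet> snd z)\<^sup>2) = slab_ext T (G u)"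
      by (auto simp: slab_ext_def G_def fun_eq_iff)
    finally show ?thesis .
  qed
  have norm_meas: "(\<lambda>z. norm (snd z)) \<in> borel_measurable (lebesgue :: (real \<times> (real ^ 'n)) measure)"
    by (intro borel_measurable_lebesgueI borel_measurable_continuous_onI continuous_intros)
  have D_meas: "(\<lambda>z. D (snd z)) \<in> borel_measurable (lebesgue :: (real \<times> (real ^ 'n)) measure)"
    unfolding D_def
    by (intro borel_measurable_add borel_measurable_times borel_measurable_power norm_meas
          borel_measurable_uminus radial_meas cont borel_measurable_const)
  note G_int = integrable_time_integral[OF G_meas _ _ G_bound]
  note Gv = G_int[OF vbp(1) vbp(1)] note Gb = G_int[OF vbp(2) vbp(2)]
  have P_meas: "slab_ext T (\<lambda>t x. p t x * D x) \<in> borel_measurable lebesgue"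
  proof -
    have "(\<lambda>z. slab_ext T p z * D (snd z)) \<in> borel_measurable lebesgue"
      using borel_measurable_slab_ext[OF vbp(3)] D_meas by (rule borel_measurable_times)
    also have "(\<lambda>z. slab_ext T p z * D (snd z)) = slab_ext T (\<lambda>t x. p t x * D x)"
      by (auto simp: slab_ext_def fun_eq_iff)
    finally show ?thesis .
  qed
  have B_meas: "slab_ext T (\<lambda>t x. (norm (b t x))\<^sup>2 * D x) \<in> borel_measurable lebesgue"
  proof -
    have "(\<lambda>z. (norm (slab_ext T b z))\<^sup>2 * D (snd z)) \<in> borel_measurable lebesgue"
      using borel_measurable_slab_ext[OF vbp(2)] D_meas
      by (intro borel_measurable_times borel_measurable_power measurable_compose[OF _ borel_measurable_norm])
    also have "(\<lambda>z. (norm (slab_ext T b z))\<^sup>2 * D (snd z)) = slab_ext T (\<lambda>t x. (norm (b t x))\<^sup>2 * D x)"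
      by (auto simp: slab_ext_def fun_eq_iff)
    finally show ?thesis .
  qed
  have P: "integrable (lebesgue_on {0<..<T}) (\<lambda>t. LINT x|lebesgue. p t x * D x)"
    "AE t in lebesgue_on {0<..<T}. integrable lebesgue (\<lambda>x. p t x * D x)"
  proof -
    have "\<bar>p t x * D x\<bar> \<le> (?N * C) * (indicator (cball 0 ?R) x * norm (p t x) powr 1)" for t x
      using mult_left_mono[OF D_bound[of x], of "\<bar>p t x\<bar>"] by (simp add: abs_mult mult_ac)
    from integrable_time_integral[OF P_meas vbp(3) _ this]
    show "integrable (lebesgue_on {0<..<T}) (\<lambda>t. LINT x|lebesgue. p t x * D x)"
      "AE t in lebesgue_on {0<..<T}. integrable lebesgue (\<lambda>x. p t x * D x)" by simp_all
  qed
  have Q: "integrable (lebesgue_on {0<..<T}) (\<lambda>t. LINT x|lebesgue. (norm (b t x))\<^sup>2 * D x)"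
    "AE t in lebesgue_on {0<..<T}. integrable lebesgue (\<lambda>x. (norm (b t x))\<^sup>2 * D x)"
  proof -
    have "\<bar>(norm (b t x))\<^sup>2 * D x\<bar> \<le> (?N * C) * (indicator (cball 0 ?R) x * norm (b t x) powr 2)" for t x
      using mult_left_mono[OF D_bound[of x], of "(norm (b t x))\<^sup>2"] by (simp add: abs_mult mult_ac)
    from integrable_time_integral[OF B_meas vbp(2) _ this]
    show "integrable (lebesgue_on {0<..<T}) (\<lambda>t. LINT x|lebesgue. (norm (b t x))\<^sup>2 * D x)"
      "AE t in lebesgue_on {0<..<T}. integrable lebesgue (\<lambda>x. (norm (b t x))\<^sup>2 * D x)" by simp_all
  qed

  define c where "c t = (LINT x|lebesgue. G v t x) - (LINT x|lebesgue. G b t x)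
      + (LINT x|lebesgue. p t x * D x) + 1 / 2 * (LINT x|lebesgue. (norm (b t x))\<^sup>2 * D x)" for t
  have c_zero: "AE t in lebesgue_on {0<..<T}. c t = 0"
  proof (rule AE_0_if_test_integrals_0)
    show "integrable (lebesgue_on {0<..<T}) c"
      unfolding c_def using Gv(1) Gb(1) P(1) Q(1) by simp
    fix \<xi> :: "real \<Rightarrow> real"
    assume \<xi>: "\<xi> C1_differentiable_on UNIV" "compact_support_in {0<..<T} \<xi>"
      "bounded (range \<xi>)" "\<xi> \<in> borel_measurable borel"
    have momentum: "- st_integral T (\<lambda>t x. (v t x \<bullet> \<phi> x) * deriv \<xi> t)
         - st_integral T (\<lambda>t x. contract (tensor (v t x) (v t x)) (nabla \<phi> x) * \<xi> t)
       = - st_integral T (\<lambda>t x. contract (tensor (b t x) (b t x)) (nabla \<phi> x) * \<xi> t)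
         + st_integral T (\<lambda>t x. p t x * divergence \<phi> x * \<xi> t)
         + 1 / 2 * st_integral T (\<lambda>t x. (norm (b t x))\<^sup>2 * divergence \<phi> x * \<xi> t)
         + \<nu> * st_integral T (\<lambda>t x. (v t x \<bullet> laplacian \<phi> x) * \<xi> t)
         + st_integral T (\<lambda>t x. (f t x \<bullet> \<phi> x) * \<xi> t)"
      using sol \<xi> \<phi> unfolding MHD_weak_solution_def by blast
    have pull: "st_integral T (\<lambda>t x. H t x * \<xi> t)
        = (LINT t|lebesgue_on {0<..<T}. (LINT x|lebesgue. H t x) * \<xi> t)"
      for H :: "real \<Rightarrow> real ^ 'n \<Rightarrow> real"
      by (simp add: st_integral_def)
    note int = integrable_mult_bounded_range[OF _ \<xi>(3,4)]
    have "(LINT t|lebesgue_on {0<..<T}. (LINT x|lebesgue. G v t x) * \<xi> t)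
        - (LINT t|lebesgue_on {0<..<T}. (LINT x|lebesgue. G b t x) * \<xi> t)
        + (LINT t|lebesgue_on {0<..<T}. (LINT x|lebesgue. p t x * D x) * \<xi> t)
        + 1 / 2 * (LINT t|lebesgue_on {0<..<T}. (LINT x|lebesgue. (norm (b t x))\<^sup>2 * D x) * \<xi> t) = 0"
      using momentum unfolding zero pull diverg contract G_def[symmetric] by simp
    also have "(LINT t|lebesgue_on {0<..<T}. (LINT x|lebesgue. G v t x) * \<xi> t)
        - (LINT t|lebesgue_on {0<..<T}. (LINT x|lebesgue. G b t x) * \<xi> t)
        + (LINT t|lebesgue_on {0<..<T}. (LINT x|lebesgue. p t x * D x) * \<xi> t)
        + 1 / 2 * (LINT t|lebesgue_on {0<..<T}. (LINT x|lebesgue. (norm (b t x))\<^sup>2 * D x) * \<xi> t)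
        = (LINT t|lebesgue_on {0<..<T}. (LINT x|lebesgue. G v t x) * \<xi> t
            - (LINT x|lebesgue. G b t x) * \<xi> t + (LINT x|lebesgue. p t x * D x) * \<xi> t
            + 1 / 2 * ((LINT x|lebesgue. (norm (b t x))\<^sup>2 * D x) * \<xi> t))"
      using int[OF Gv(1)] int[OF Gb(1)] int[OF P(1)] int[OF Q(1)] by simp
    also have "\<dots> = (LINT t|lebesgue_on {0<..<T}. c t * \<xi> t)"
      unfolding c_def by (simp add: algebra_simps)
    finally show "(LINT t|lebesgue_on {0<..<T}. c t * \<xi> t) = 0" .
  qed
  have AE_G: "AE t in lebesgue_on {0<..<T}. integrable lebesgue (G v t)"
    "AE t in lebesgue_on {0<..<T}. integrable lebesgue (G b t)"
    using Gv(2) Gb(2) by simp_all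
  show ?thesis
    using c_zero AE_G P(2) Q(2) AE_MHD_state[OF sol]
  proof eventually_elim
    case (elim t)
    note loc = loc_integrable_stress[OF elim(6)]
    have radial_meas': "(\<lambda>x :: real ^ 'n. h (x \<bullet> x / 2)) \<in> borel_measurable lebesgue"
      if "continuous_on UNIV h" for h :: "real \<Rightarrow> real"
      by (intro borel_measurable_lebesgueI borel_measurable_continuous_onI continuous_on_compose2[OF that]
          continuous_intros) auto
    have int_k: "integrable lebesgue (\<lambda>x. k (x \<bullet> x / 2) * stress_trace (v t) (b t) (p t) x)"
    proof (rule integrable_cutoff_mult[OF loc(1) radial_meas'[OF cont(1)]])
      show "\<bar>k (x \<bullet> x / 2)\<bar> \<le> C * indicator (cball 0 ?R) x" for x :: "real ^ 'n"
        by (rule order_trans[OF _ C(2)]) simp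
    qed
    have int_\<kappa>: "integrable lebesgue (\<lambda>x. \<kappa> (x \<bullet> x / 2) * stress_radial (v t) (b t) (p t) x)"
    proof -
      have "bounded (\<kappa> ` {0..B})"
        by (intro compact_imp_bounded compact_continuous_image continuous_on_subset[OF cont(2)]) auto
      then obtain C' where "\<forall>y \<in> \<kappa> ` {0..B}. norm y \<le> C'"
        unfolding bounded_iff by blast
      then have C': "norm (\<kappa> s) \<le> C'" if "s \<in> {0..B}" for s
        using that by blast
      show ?thesis
      proof (rule integrable_cutoff_mult[OF loc(2) radial_meas'[OF cont(2)]])
        show "\<bar>\<kappa> (x \<bullet> x / 2)\<bar> \<le> C' * indicator (cball 0 ?R) x" for x :: "real ^ 'n"
        proof (cases "x \<in> cball 0 ?R")
          case True
          then have "(norm x)\<^sup>2 \<le> ?R\<^sup>2" by (intro power_mono) auto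
          then have "x \<bullet> x / 2 \<le> B" using \<open>B > 0\<close> by (simp add: power2_norm_eq_inner)
          with True C'[of "x \<bullet> x / 2"] show ?thesis by simp
        next
          case False
          with outside[OF False] show ?thesis by (simp add: \<kappa>(2))
        qed
      qed
    qed
    have "0 = c t" using elim(1) by simp
    also have "c t = (LINT x|lebesgue. G v t x - G b t x + p t x * D x + 1 / 2 * ((norm (b t x))\<^sup>2 * D x))"
      unfolding c_def using elim by simp
    also have "\<dots> = (LINT x|lebesgue. k (x \<bullet> x / 2) * stress_trace (v t) (b t) (p t) x
        - \<kappa> (x \<bullet> x / 2) * stress_radial (v t) (b t) (p t) x)"
      by (intro Bochner_Integration.integral_cong)
         (auto simp: G_def D_def stress_trace_def stress_radial_def algebra_simps)
    also have "\<dots> = (LINT x|lebesgue. k (x \<bullet> x / 2) * stress_trace (v t) (b t) (p t) x)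
        - (LINT x|lebesgue. \<kappa> (x \<bullet> x / 2) * stress_radial (v t) (b t) (p t) x)"
      using int_k int_\<kappa> by simp
    finally show ?case by (simp add: k_def)
  qed
qed

section \<open>Extension to irregular radial profiles\<close>

text \<open>Spheres are null sets, so countably many exceptional radii can be ignored.\<close>

lemma AE_half_norm_sq_notin_countable:
  assumes "countable D"
  shows "AE x :: real ^ 'n::finite in lebesgue. x \<bullet> x / 2 \<notin> D"
proof (rule AE_I')
  have "negligible {x :: real ^ 'n. x \<bullet> x / 2 = d}" for d
  proof (rule negligible_subset[OF negligible_sphere[of 0 "sqrt (2 * d)"]])
    show "{x :: real ^ 'n. x \<bullet> x / 2 = d} \<subseteq> sphere 0 (sqrt (2 * d))"
      by (auto simp: norm_eq_sqrt_inner)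
  qed
  then show "(\<Union>d\<in>D. {x :: real ^ 'n. x \<bullet> x / 2 = d}) \<in> null_sets lebesgue"
    using assms by (intro null_sets_UN') (auto simp: negligible_iff_null_sets)
qed auto

lemma borel_measurable_radial:
  "h \<in> borel_measurable borel \<Longrightarrow> (\<lambda>x :: real ^ 'n::finite. h (x \<bullet> x / 2)) \<in> borel_measurable lebesgue"
  by (rule borel_measurable_lebesgueI, rule measurable_compose[where g = h and N = borel]) simp_all

lemma borel_measurable_tail:
  assumes [measurable]: "\<kappa> \<in> borel_measurable borel"
  shows "tail \<kappa> \<in> borel_measurable borel"
proof -
  have "(\<lambda>(s, \<sigma>). if s \<le> \<sigma> then \<kappa> \<sigma> else 0) \<in> borel_measurable (borel \<Otimes>\<^sub>M lborel)"
    by measurable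
  then have "(\<lambda>s. LINT \<sigma>|lborel. (if s \<le> \<sigma> then \<kappa> \<sigma> else 0)) \<in> borel_measurable borel"
    by (rule lborel.borel_measurable_lebesgue_integral)
  also have "(\<lambda>s. LINT \<sigma>|lborel. (if s \<le> \<sigma> then \<kappa> \<sigma> else 0)) = tail \<kappa>"
    unfolding tail_def
    by (intro ext Bochner_Integration.integral_cong) (auto simp: indicator_def)
  finally show ?thesis .
qed

text \<open>Bounds are only required on \<open>[0, \<infinity>)\<close>, the range of \<open>s = \<bar>x\<bar>\<^sup>2/2\<close>.\<close>

definition cutoff_profile :: "real \<Rightarrow> real \<Rightarrow> (real \<Rightarrow> real) \<Rightarrow> bool"
  where "cutoff_profile C S \<kappa> \<longleftrightarrow> \<kappa> \<in> borel_measurable borel \<and> (\<forall>\<sigma>\<ge>0. \<bar>\<kappa> \<sigma>\<bar> \<le> C * indicator {..S} \<sigma>)"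

lemma cutoff_profile_bound:
  assumes "cutoff_profile C S \<kappa>" "s \<ge> 0"
  shows "\<bar>indicator {s..} \<sigma> * \<kappa> \<sigma>\<bar> \<le> C * indicator {0..S} \<sigma>"
proof (cases "\<sigma> \<ge> s")
  case True
  with assms have "\<bar>\<kappa> \<sigma>\<bar> \<le> C * indicator {..S} \<sigma>"
    unfolding cutoff_profile_def by auto
  with True \<open>s \<ge> 0\<close> show ?thesis by (simp add: indicator_def)
next
  case False
  have "\<bar>\<kappa> 0\<bar> \<le> C * indicator {..S} 0"
    using assms by (simp add: cutoff_profile_def)
  then have "0 \<le> C * indicator {..S} (0 :: real)"
    by (rule order_trans[OF abs_ge_zero])
  with False show ?thesis by (auto simp: indicator_def split: if_splits)
qed

lemma cutoff_profile_integrable: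
  assumes "cutoff_profile C S \<kappa>" "s \<ge> 0"
  shows "integrable lborel (\<lambda>\<sigma>. indicator {s..} \<sigma> * \<kappa> \<sigma>)"
proof (rule Bochner_Integration.integrable_bound)
  show "integrable lborel (\<lambda>\<sigma>. C * indicator {0..S} \<sigma>)"
    by (intro integrable_mult_right) (simp add: integrable_indicator_iff emeasure_lborel_Icc_eq)
  show "(\<lambda>\<sigma>. indicator {s..} \<sigma> * \<kappa> \<sigma>) \<in> borel_measurable lborel"
    using assms by (auto simp: cutoff_profile_def)
  show "AE \<sigma> in lborel. norm (indicator {s..} \<sigma> * \<kappa> \<sigma>) \<le> norm (C * indicator {0..S} \<sigma>)"
    unfolding real_norm_def
    by (intro AE_I2 order_trans[OF cutoff_profile_bound[OF assms] abs_ge_self])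
qed

lemma cutoff_profile_tail_bound:
  assumes \<kappa>: "cutoff_profile C S \<kappa>" and "s \<ge> 0" "S \<ge> 0" "C \<ge> 0"
  shows "\<bar>tail \<kappa> s\<bar> \<le> C * S * indicator {..S} s"
proof (cases "s \<le> S")
  case True
  have "norm (tail \<kappa> s) \<le> (LINT \<sigma>|lborel. norm (indicator {s..} \<sigma> * \<kappa> \<sigma>))"
    unfolding tail_def by (rule integral_norm_bound)
  also have "\<dots> \<le> (LINT \<sigma>|lborel. C * indicator {0..S} \<sigma>)"
  proof (rule integral_mono)
    show "integrable lborel (\<lambda>\<sigma>. norm (indicator {s..} \<sigma> * \<kappa> \<sigma>))"
      using cutoff_profile_integrable[OF assms(1,2)] by (rule integrable_norm)
    show "integrable lborel (\<lambda>\<sigma>. C * indicator {0..S} \<sigma> :: real)"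
      by (intro integrable_mult_right) (simp add: integrable_indicator_iff emeasure_lborel_Icc_eq)
    show "norm (indicator {s..} \<sigma> * \<kappa> \<sigma>) \<le> C * indicator {0..S} \<sigma>" for \<sigma>
      using cutoff_profile_bound[OF assms(1,2)] by simp
  qed
  also have "\<dots> = C * S"
    using \<open>S \<ge> 0\<close> by simp
  finally show ?thesis using True by simp
next
  case False
  have "tail \<kappa> s = 0"
  proof (rule tail_eq_0)
    show "\<kappa> \<sigma> = 0" if "\<sigma> \<ge> s" for \<sigma>
      using cutoff_profile_bound[OF assms(1,2), of \<sigma>] that False by simp
  qed simp
  with False show ?thesis by simp
qed

lemma radial_indicator_le:
  fixes x :: "real ^ 'n::finite"
  shows "indicator {..S} (x \<bullet> x / 2) \<le> (indicator (cball 0 (sqrt (2 * S))) x :: real)"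
  by (auto simp: indicator_def norm_eq_sqrt_inner)

lemma cutoff_profile_radial_integrable:
  fixes \<alpha> :: "real ^ 'n::finite \<Rightarrow> real"
  assumes \<kappa>: "cutoff_profile C S \<kappa>" and "S \<ge> 0" "C \<ge> 0" and "loc_integrable \<alpha>"
  shows "integrable lebesgue (\<lambda>x. tail \<kappa> (x \<bullet> x / 2) * \<alpha> x)"
    "integrable lebesgue (\<lambda>x. \<kappa> (x \<bullet> x / 2) * \<alpha> x)"
proof -
  have [measurable]: "\<kappa> \<in> borel_measurable borel"
    using \<kappa> by (simp add: cutoff_profile_def)
  have "\<bar>tail \<kappa> (x \<bullet> x / 2)\<bar> \<le> C * S * indicator (cball 0 (sqrt (2 * S))) x" for x :: "real ^ 'n"
    using assms
    by (intro order_trans[OF cutoff_profile_tail_bound[OF \<kappa>]] mult_left_mono radial_indicator_le) auto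
  then show "integrable lebesgue (\<lambda>x. tail \<kappa> (x \<bullet> x / 2) * \<alpha> x)"
    by (intro integrable_cutoff_mult[OF assms(4)] borel_measurable_radial borel_measurable_tail) auto
  have "\<bar>\<kappa> (x \<bullet> x / 2)\<bar> \<le> C * indicator {..S} (x \<bullet> x / 2)" for x :: "real ^ 'n"
    using \<kappa> by (simp add: cutoff_profile_def)
  then have "\<bar>\<kappa> (x \<bullet> x / 2)\<bar> \<le> C * indicator (cball 0 (sqrt (2 * S))) x" for x :: "real ^ 'n"
    by (rule order_trans) (intro mult_left_mono radial_indicator_le \<open>C \<ge> 0\<close>)
  then show "integrable lebesgue (\<lambda>x. \<kappa> (x \<bullet> x / 2) * \<alpha> x)"
    by (intro integrable_cutoff_mult[OF assms(4)] borel_measurable_radial) auto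
qed

text \<open>The radial identity for a fixed \<open>\<kappa>\<close>, as a property that makes sense for irregular \<open>\<kappa>\<close>. It is linear in
  \<open>\<kappa>\<close> and stable under bounded convergence.\<close>

definition balances :: "(real ^ 'n::finite \<Rightarrow> real) \<Rightarrow> (real ^ 'n \<Rightarrow> real) \<Rightarrow> (real \<Rightarrow> real) \<Rightarrow> bool"
  where "balances \<alpha> \<beta> \<kappa> \<longleftrightarrow>
    (LINT x|lebesgue. tail \<kappa> (x \<bullet> x / 2) * \<alpha> x) = (LINT x|lebesgue. \<kappa> (x \<bullet> x / 2) * \<beta> x)"

lemma tail_tendsto:
  assumes \<kappa>n: "\<And>n. cutoff_profile C S (\<kappa>n n)" and \<kappa>[measurable]: "\<kappa> \<in> borel_measurable borel"
    and "s \<ge> 0" and D: "countable D" and lim: "\<And>\<sigma>. \<sigma> \<ge> 0 \<Longrightarrow> \<sigma> \<notin> D \<Longrightarrow> (\<lambda>n. \<kappa>n n \<sigma>) \<longlonglongrightarrow> \<kappa> \<sigma>"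
  shows "(\<lambda>n. tail (\<kappa>n n) s) \<longlonglongrightarrow> tail \<kappa> s"
  unfolding tail_def
proof (rule integral_dominated_convergence[where w = "\<lambda>\<sigma>. C * indicator {0..S} \<sigma>"])
  show "integrable lborel (\<lambda>\<sigma>. C * indicator {0..S} \<sigma> :: real)"
    by (intro integrable_mult_right) (simp add: integrable_indicator_iff emeasure_lborel_Icc_eq)
  show "(\<lambda>\<sigma>. indicator {s..} \<sigma> * \<kappa> \<sigma>) \<in> borel_measurable lborel"
    by measurable
  show "(\<lambda>\<sigma>. indicator {s..} \<sigma> * \<kappa>n n \<sigma>) \<in> borel_measurable lborel" for n
    using cutoff_profile_integrable[OF \<kappa>n \<open>s \<ge> 0\<close>] by (rule borel_measurable_integrable)
  show "AE \<sigma> in lborel. norm (indicator {s..} \<sigma> * \<kappa>n n \<sigma>) \<le> C * indicator {0..S} \<sigma>" for n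
    using cutoff_profile_bound[OF \<kappa>n \<open>s \<ge> 0\<close>] by simp
  have "AE \<sigma> in lborel. \<sigma> \<notin> D"
    using countable_imp_null_set_lborel[OF D] by (rule AE_not_in)
  then show "AE \<sigma> in lborel. (\<lambda>n. indicator {s..} \<sigma> * \<kappa>n n \<sigma>) \<longlonglongrightarrow> indicator {s..} \<sigma> * \<kappa> \<sigma>"
    by (rule eventually_mono) (use lim \<open>s \<ge> 0\<close> in \<open>auto simp: indicator_def\<close>)
qed

text \<open>Convergence may fail at countably many points: they are null in the integral that defines the tail, and the
  corresponding spheres are null in space.\<close>

lemma balances_limit:
  fixes \<alpha> \<beta> :: "real ^ 'n::finite \<Rightarrow> real"
  assumes \<alpha>: "loc_integrable \<alpha>" and \<beta>: "loc_integrable \<beta>"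
    and bal: "\<And>n. balances \<alpha> \<beta> (\<kappa>n n)"
    and \<kappa>n: "\<And>n. cutoff_profile C S (\<kappa>n n)" and \<kappa>: "\<kappa> \<in> borel_measurable borel"
    and CS: "C \<ge> 0" "S \<ge> 0"
    and D: "countable D" and lim: "\<And>\<sigma>. \<sigma> \<ge> 0 \<Longrightarrow> \<sigma> \<notin> D \<Longrightarrow> (\<lambda>n. \<kappa>n n \<sigma>) \<longlonglongrightarrow> \<kappa> \<sigma>"
  shows "balances \<alpha> \<beta> \<kappa>"
proof -
  let ?I = "\<lambda>x :: real ^ 'n. indicator (cball 0 (sqrt (2 * S))) x :: real"
  note meas = borel_measurable_loc_integrable[OF \<alpha>] borel_measurable_loc_integrable[OF \<beta>]
  have "(\<lambda>n. LINT x|lebesgue. tail (\<kappa>n n) (x \<bullet> x / 2) * \<alpha> x)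
      \<longlonglongrightarrow> (LINT x|lebesgue. tail \<kappa> (x \<bullet> x / 2) * \<alpha> x)"
  proof (rule integral_dominated_convergence[where w = "\<lambda>x. C * S * norm (?I x * \<alpha> x)"])
    show "integrable lebesgue (\<lambda>x. C * S * norm (?I x * \<alpha> x))"
      using \<alpha> unfolding loc_integrable_def by (intro integrable_mult_right integrable_norm) auto
    show "(\<lambda>x. tail \<kappa> (x \<bullet> x / 2) * \<alpha> x) \<in> borel_measurable lebesgue"
      by (intro borel_measurable_times meas borel_measurable_radial borel_measurable_tail \<kappa>)
    show "(\<lambda>x. tail (\<kappa>n n) (x \<bullet> x / 2) * \<alpha> x) \<in> borel_measurable lebesgue" for n
      using cutoff_profile_radial_integrable(1)[OF \<kappa>n CS(2,1) \<alpha>] by auto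
    show "AE x in lebesgue. (\<lambda>n. tail (\<kappa>n n) (x \<bullet> x / 2) * \<alpha> x) \<longlonglongrightarrow> tail \<kappa> (x \<bullet> x / 2) * \<alpha> x"
      using tail_tendsto[OF \<kappa>n \<kappa> _ D lim] by (intro AE_I2 tendsto_mult tendsto_const) auto
    show "AE x in lebesgue. norm (tail (\<kappa>n n) (x \<bullet> x / 2) * \<alpha> x) \<le> C * S * norm (?I x * \<alpha> x)" for n
    proof (rule AE_I2)
      fix x :: "real ^ 'n"
      have "\<bar>tail (\<kappa>n n) (x \<bullet> x / 2)\<bar> \<le> C * S * ?I x"
        using CS by (intro order_trans[OF cutoff_profile_tail_bound[OF \<kappa>n]] mult_left_mono radial_indicator_le) auto
      from mult_right_mono[OF this, of "\<bar>\<alpha> x\<bar>"]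
      show "norm (tail (\<kappa>n n) (x \<bullet> x / 2) * \<alpha> x) \<le> C * S * norm (?I x * \<alpha> x)"
        by (simp add: abs_mult mult.assoc)
    qed
  qed
  moreover have "(\<lambda>n. LINT x|lebesgue. \<kappa>n n (x \<bullet> x / 2) * \<beta> x) \<longlonglongrightarrow> (LINT x|lebesgue. \<kappa> (x \<bullet> x / 2) * \<beta> x)"
  proof (rule integral_dominated_convergence[where w = "\<lambda>x. C * norm (?I x * \<beta> x)"])
    show "integrable lebesgue (\<lambda>x. C * norm (?I x * \<beta> x))"
      using \<beta> unfolding loc_integrable_def by (intro integrable_mult_right integrable_norm) auto
    show "(\<lambda>x. \<kappa> (x \<bullet> x / 2) * \<beta> x) \<in> borel_measurable lebesgue"
      by (intro borel_measurable_times meas borel_measurable_radial \<kappa>)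
    show "(\<lambda>x. \<kappa>n n (x \<bullet> x / 2) * \<beta> x) \<in> borel_measurable lebesgue" for n
      using cutoff_profile_radial_integrable(2)[OF \<kappa>n CS(2,1) \<beta>] by auto
    show "AE x in lebesgue. (\<lambda>n. \<kappa>n n (x \<bullet> x / 2) * \<beta> x) \<longlonglongrightarrow> \<kappa> (x \<bullet> x / 2) * \<beta> x"
      using AE_half_norm_sq_notin_countable[OF D]
      by (rule eventually_mono) (intro tendsto_mult tendsto_const lim, auto)
    show "AE x in lebesgue. norm (\<kappa>n n (x \<bullet> x / 2) * \<beta> x) \<le> C * norm (?I x * \<beta> x)" for n
    proof (rule AE_I2)
      fix x :: "real ^ 'n"
      have "\<bar>\<kappa>n n (x \<bullet> x / 2)\<bar> \<le> C * indicator {..S} (x \<bullet> x / 2)"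
        using \<kappa>n[of n] by (simp add: cutoff_profile_def)
      also have "\<dots> \<le> C * ?I x"
        by (intro mult_left_mono radial_indicator_le CS)
      finally have "\<bar>\<kappa>n n (x \<bullet> x / 2)\<bar> \<le> C * ?I x" .
      from mult_right_mono[OF this, of "\<bar>\<beta> x\<bar>"]
      show "norm (\<kappa>n n (x \<bullet> x / 2) * \<beta> x) \<le> C * norm (?I x * \<beta> x)"
        by (simp add: abs_mult mult.assoc)
    qed
  qed
  moreover have "(LINT x|lebesgue. tail (\<kappa>n n) (x \<bullet> x / 2) * \<alpha> x) = (LINT x|lebesgue. \<kappa>n n (x \<bullet> x / 2) * \<beta> x)" for n
    using bal by (simp add: balances_def)
  ultimately show ?thesis
    unfolding balances_def using LIMSEQ_unique by auto
qed

lemma balances_add_scaled: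
  assumes \<alpha>: "loc_integrable \<alpha>" and \<beta>: "loc_integrable \<beta>"
    and \<kappa>: "cutoff_profile C S \<kappa>" "balances \<alpha> \<beta> \<kappa>" and \<eta>: "cutoff_profile C' S' \<eta>" "balances \<alpha> \<beta> \<eta>"
    and nonneg: "C \<ge> 0" "S \<ge> 0" "C' \<ge> 0" "S' \<ge> 0"
  shows "balances \<alpha> \<beta> (\<lambda>\<sigma>. \<kappa> \<sigma> + c * \<eta> \<sigma>)"
proof -
  have tail: "tail (\<lambda>\<sigma>. \<kappa> \<sigma> + c * \<eta> \<sigma>) (x \<bullet> x / 2) = tail \<kappa> (x \<bullet> x / 2) + c * tail \<eta> (x \<bullet> x / 2)" for x :: "real ^ 'a"
    unfolding tail_def
    using cutoff_profile_integrable[OF \<kappa>(1), of "x \<bullet> x / 2"] cutoff_profile_integrable[OF \<eta>(1), of "x \<bullet> x / 2"]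
    by (simp add: algebra_simps)
  note int = cutoff_profile_radial_integrable[OF \<kappa>(1) nonneg(2,1)]
    cutoff_profile_radial_integrable[OF \<eta>(1) nonneg(4,3)]
  show ?thesis
    using \<kappa>(2) \<eta>(2) int[OF \<alpha>] int[OF \<beta>] unfolding balances_def tail
    by (simp add: distrib_right mult.assoc)
qed

lemma balances_step:
  fixes a b c :: "nat \<Rightarrow> real"
  assumes \<alpha>: "loc_integrable \<alpha>" and \<beta>: "loc_integrable \<beta>"
    and grid: "\<And>j. balances \<alpha> \<beta> (indicator {a j<..<b j})" and ab: "\<And>j. 0 \<le> a j \<and> a j \<le> b j"
  shows "balances \<alpha> \<beta> (\<lambda>\<sigma>. \<Sum>j<M. c j * indicator {a j<..<b j} \<sigma>)"
    and "\<exists>C S. C \<ge> 0 \<and> S \<ge> 0 \<and> cutoff_profile C S (\<lambda>\<sigma>. \<Sum>j<M. c j * indicator {a j<..<b j} \<sigma>)"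
proof (induction M)
  case 0
  {
    case 1
    then show ?case by (simp add: balances_def tail_def)
  next
    case 2
    then show ?case by (intro exI[of _ 0]) (simp add: cutoff_profile_def)
  }
next
  case (Suc M)
  from Suc(2) obtain C S where CS: "C \<ge> 0" "S \<ge> 0"
    "cutoff_profile C S (\<lambda>\<sigma>. \<Sum>j<M. c j * indicator {a j<..<b j} \<sigma>)" by auto
  {
    case 1
    have ind: "cutoff_profile 1 (b M) (indicator {a M<..<b M})"
      by (auto simp: cutoff_profile_def indicator_def)
    show ?case
      using balances_add_scaled[OF \<alpha> \<beta> CS(3) Suc(1) ind grid CS(1,2), of "c M"] ab[of M] by simp
  next
    case 2
    have bound: "\<bar>\<Sum>j<Suc M. c j * indicator {a j<..<b j} \<sigma>\<bar> \<le> (C + \<bar>c M\<bar>) * indicator {..max S (b M)} \<sigma>"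
      if "\<sigma> \<ge> 0" for \<sigma>
    proof -
      have "\<bar>\<Sum>j<Suc M. c j * indicator {a j<..<b j} \<sigma>\<bar>
          \<le> C * indicator {..S} \<sigma> + \<bar>c M\<bar> * indicator {a M<..<b M} \<sigma>"
      proof -
        have "\<bar>\<Sum>j<M. c j * indicator {a j<..<b j} \<sigma>\<bar> \<le> C * indicator {..S} \<sigma>"
          using CS(3) that by (simp add: cutoff_profile_def)
        moreover have "\<bar>c M * indicator {a M<..<b M} \<sigma>\<bar> = \<bar>c M\<bar> * indicator {a M<..<b M} \<sigma>"
          by (simp add: abs_mult)
        ultimately show ?thesis
          unfolding sum.lessThan_Suc by linarith
      qed
      also have "\<dots> \<le> (C + \<bar>c M\<bar>) * indicator {..max S (b M)} \<sigma>"
        using CS(1) by (auto simp: indicator_def)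
      finally show ?thesis .
    qed
    then show ?case
    proof (intro exI conjI)
      show "cutoff_profile (C + \<bar>c M\<bar>) (max S (b M)) (\<lambda>\<sigma>. \<Sum>j<Suc M. c j * indicator {a j<..<b j} \<sigma>)"
        unfolding cutoff_profile_def using bound by (intro conjI allI impI borel_measurable_sum) auto
    qed (use CS in auto)
  }
qed

lemma balances_indicator:
  assumes "loc_integrable \<alpha>" "loc_integrable \<beta>"
    and bump: "\<And>n. balances \<alpha> \<beta> (bump n a b)" and "0 \<le> a" "a \<le> b"
  shows "balances \<alpha> \<beta> (indicator {a<..<b})"
proof (rule balances_limit[OF assms(1,2) bump])
  show "cutoff_profile 1 b (bump n a b)" for n
    unfolding cutoff_profile_def
  proof (intro conjI allI impI)
    show "bump n a b \<in> borel_measurable borel"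
      using C_real_bump[of 0 n a b] by (auto intro: borel_measurable_continuous_onI)
    show "\<bar>bump n a b \<sigma>\<bar> \<le> 1 * indicator {..b} \<sigma>" for \<sigma>
      using bump_nonneg[of n a b \<sigma>] bump_le_1[of n a b \<sigma>] bump_support[of \<sigma> a b n]
      by (cases "\<sigma> < b") auto
  qed
  show "(\<lambda>n. bump n a b \<sigma>) \<longlonglongrightarrow> indicator {a<..<b} \<sigma>" for \<sigma>
    by (rule bump_tendsto)
qed (use assms in auto)

text \<open>A bounded function is approximated by the step functions that take, on each cell of the grid of width \<open>1/m\<close>,
  its value at the left end point. They converge at every point of continuity off the grid.\<close>

lemma balances_cutoff_profile:
  assumes \<alpha>: "loc_integrable \<alpha>" and \<beta>: "loc_integrable \<beta>"
    and grid: "\<And>j m :: nat. balances \<alpha> \<beta> (indicator {real j / real (Suc m)<..<real (Suc j) / real (Suc m)})"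
    and \<kappa>: "cutoff_profile C S \<kappa>" and CS: "C \<ge> 0" "S \<ge> 0"
    and D: "countable D" and cont: "\<And>\<sigma>. \<sigma> > 0 \<Longrightarrow> \<sigma> \<notin> D \<Longrightarrow> isCont \<kappa> \<sigma>"
  shows "balances \<alpha> \<beta> \<kappa>"
proof -
  define S' where "S' = Suc (nat \<lceil>S\<rceil>)"
  have S': "S < real S'"
    unfolding S'_def by linarith
  define I where "I m j = {real j / real (Suc m)<..<real (Suc j) / real (Suc m)}" for m j :: nat
  \<comment> \<open>At a given point at most one summand is nonzero, the one of index \<open>idx\<close>.\<close>
  define \<kappa>s where "\<kappa>s m \<sigma> = (\<Sum>j<S' * Suc m. \<kappa> (real j / real (Suc m)) * indicator (I m j) \<sigma>)" for m \<sigma>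
  define idx where "idx m \<sigma> = nat \<lfloor>\<sigma> * real (Suc m)\<rfloor>" for m \<sigma>
  have idx_eq: "j = idx m \<sigma>" if "\<sigma> \<in> I m j" for j m \<sigma>
  proof -
    have "real j < \<sigma> * real (Suc m)" "\<sigma> * real (Suc m) < real j + 1"
      using that by (auto simp: I_def field_simps)
    then have "\<lfloor>\<sigma> * real (Suc m)\<rfloor> = int j"
      by (intro floor_unique) auto
    then show ?thesis by (simp add: idx_def)
  qed
  have \<kappa>s_eq: "\<kappa>s m \<sigma> = (if idx m \<sigma> < S' * Suc m then \<kappa> (real (idx m \<sigma>) / real (Suc m)) * indicator (I m (idx m \<sigma>)) \<sigma> else 0)" for m \<sigma>
  proof -
    have "\<kappa>s m \<sigma> = (\<Sum>j<S' * Suc m. if j = idx m \<sigma> then \<kappa> (real j / real (Suc m)) * indicator (I m j) \<sigma> else 0)"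
      unfolding \<kappa>s_def by (intro sum.cong refl) (auto simp: indicator_def dest: idx_eq)
    then show ?thesis by (simp add: sum.delta)
  qed
  have idx_less: "idx m \<sigma> < S' * Suc m \<longleftrightarrow> \<sigma> < real S'" if "\<sigma> \<ge> 0" for m \<sigma>
  proof -
    have "idx m \<sigma> < S' * Suc m \<longleftrightarrow> \<lfloor>\<sigma> * real (Suc m)\<rfloor> < int (S' * Suc m)"
      unfolding idx_def using that by (subst nat_less_iff) auto
    also have "\<dots> \<longleftrightarrow> \<sigma> * real (Suc m) < real S' * real (Suc m)"
      by (subst floor_less_iff) (simp only: of_nat_mult of_int_mult of_int_of_nat_eq)
    also have "\<dots> \<longleftrightarrow> \<sigma> < real S'"
      by (rule mult_less_cancel_right_pos) simp
    finally show ?thesis .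
  qed
  show ?thesis
  proof (rule balances_limit[OF \<alpha> \<beta>])
    show "balances \<alpha> \<beta> (\<kappa>s m)" for m
      unfolding \<kappa>s_def[abs_def] I_def
      by (rule balances_step(1)[OF \<alpha> \<beta> grid]) (auto intro: divide_right_mono)
    show "cutoff_profile C (real S') (\<kappa>s m)" for m
      unfolding cutoff_profile_def
    proof (intro conjI allI impI)
      show "\<kappa>s m \<in> borel_measurable borel"
        unfolding \<kappa>s_def[abs_def] I_def by measurable
      fix \<sigma> :: real
      assume \<sigma>: "\<sigma> \<ge> 0"
      show "\<bar>\<kappa>s m \<sigma>\<bar> \<le> C * indicator {..real S'} \<sigma>"
      proof (cases "\<sigma> < real S'")
        case True
        have "\<bar>\<kappa> (real (idx m \<sigma>) / real (Suc m))\<bar> \<le> C * indicator {..S} (real (idx m \<sigma>) / real (Suc m))"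
          using \<kappa> by (simp add: cutoff_profile_def)
        also have "\<dots> \<le> C" using CS by (auto simp: indicator_def)
        finally show ?thesis
          using True CS unfolding \<kappa>s_eq by (auto simp: indicator_def)
      next
        case False
        with \<sigma> CS show ?thesis unfolding \<kappa>s_eq idx_less[OF \<sigma>] by (auto simp: indicator_def)
      qed
    qed
    show "\<kappa> \<in> borel_measurable borel"
      using \<kappa> by (simp add: cutoff_profile_def)
    show "countable (D \<union> \<rat>)"
      using D countable_rat by simp
    fix \<sigma> :: real
    assume \<sigma>: "\<sigma> \<ge> 0" "\<sigma> \<notin> D \<union> \<rat>"
    then have pos: "\<sigma> > 0" and "\<sigma> \<notin> D" by (auto simp: less_le)
    have in_I: "\<sigma> \<in> I m (idx m \<sigma>)" for m
    proof -
      have fl: "real (idx m \<sigma>) = of_int \<lfloor>\<sigma> * real (Suc m)\<rfloor>"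
        unfolding idx_def using \<sigma>(1) by simp
      have "real (idx m \<sigma>) \<noteq> \<sigma> * real (Suc m)"
      proof
        assume "real (idx m \<sigma>) = \<sigma> * real (Suc m)"
        then have "\<sigma> = real (idx m \<sigma>) / real (Suc m)" by (simp add: field_simps)
        also have "\<dots> \<in> \<rat>" by simp
        finally show False using \<sigma>(2) by simp
      qed
      then have "real (idx m \<sigma>) < \<sigma> * real (Suc m)" "\<sigma> * real (Suc m) < real (idx m \<sigma>) + 1"
        unfolding fl using of_int_floor_le[of "\<sigma> * real (Suc m)"] by linarith+
      then show ?thesis by (simp add: I_def field_simps)
    qed
    show "(\<lambda>m. \<kappa>s m \<sigma>) \<longlonglongrightarrow> \<kappa> \<sigma>"
    proof (cases "\<sigma> < real S'")
      case True
      have "(\<lambda>m. real (idx m \<sigma>) / real (Suc m)) \<longlonglongrightarrow> \<sigma>"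
      proof (rule real_tendsto_sandwich)
        show "\<forall>\<^sub>F m in sequentially. \<sigma> - 1 / real (Suc m) \<le> real (idx m \<sigma>) / real (Suc m)"
        proof (intro always_eventually allI)
          fix m
          have "\<sigma> < real (Suc (idx m \<sigma>)) / real (Suc m)"
            using in_I[of m] by (simp add: I_def)
          also have "\<dots> = real (idx m \<sigma>) / real (Suc m) + 1 / real (Suc m)"
            unfolding of_nat_Suc[of "idx m \<sigma>"] by (simp add: add_divide_distrib)
          finally show "\<sigma> - 1 / real (Suc m) \<le> real (idx m \<sigma>) / real (Suc m)" by linarith
        qed
        show "\<forall>\<^sub>F m in sequentially. real (idx m \<sigma>) / real (Suc m) \<le> \<sigma>"
          using in_I by (intro always_eventually) (auto simp: I_def less_imp_le)
        have "(\<lambda>m. \<sigma> - 1 / real (Suc m)) \<longlonglongrightarrow> \<sigma> - 0"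
          by (intro tendsto_diff tendsto_const LIMSEQ_Suc[OF lim_1_over_n])
        then show "(\<lambda>m. \<sigma> - 1 / real (Suc m)) \<longlonglongrightarrow> \<sigma>" by simp
      qed simp
      from isCont_tendsto_compose[OF cont[OF pos \<open>\<sigma> \<notin> D\<close>] this]
      show ?thesis
        using True in_I unfolding \<kappa>s_eq idx_less[OF \<sigma>(1)] by simp
    next
      case False
      have "\<bar>\<kappa> \<sigma>\<bar> \<le> C * indicator {..S} \<sigma>"
        using \<kappa> \<sigma> by (simp add: cutoff_profile_def)
      with False S' have "\<kappa> \<sigma> = 0" by simp
      with False show ?thesis unfolding \<kappa>s_eq idx_less[OF \<sigma>(1)] by simp
    qed
  qed (use CS in auto)
qed

text \<open>Near the origin \<open>\<kappa>(s) = O(1/s)\<close> is enough, since \<open>x \<sqdot> \<sigma>x\<close> vanishes there like \<open>\<bar>x\<bar>\<^sup>2 = 2 s\<close> times a locally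
  integrable function. The proof truncates \<open>\<kappa>\<close> to \<open>[\<delta>, \<infinity>)\<close>; the corresponding tail is that of \<open>\<kappa>\<close>, made
  constant on \<open>[0, \<delta>]\<close>.\<close>

lemma balances_singular_profile:
  fixes \<alpha> \<beta> \<gamma> :: "real ^ 'n::finite \<Rightarrow> real"
  assumes \<alpha>: "loc_integrable \<alpha>" and \<beta>: "loc_integrable \<beta>" and \<gamma>: "loc_integrable \<gamma>"
    and \<beta>\<gamma>: "\<And>x. \<bar>\<beta> x\<bar> \<le> (norm x)\<^sup>2 * \<gamma> x"
    and grid: "\<And>j m :: nat. balances \<alpha> \<beta> (indicator {real j / real (Suc m)<..<real (Suc j) / real (Suc m)})"
    and \<kappa>[measurable]: "\<kappa> \<in> borel_measurable borel"
    and bound: "\<And>\<sigma>. \<sigma> > 0 \<Longrightarrow> \<bar>\<kappa> \<sigma>\<bar> \<le> C / \<sigma> * indicator {..S} \<sigma>"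
    and tail_bound: "\<And>s. s > 0 \<Longrightarrow> \<bar>tail \<kappa> s\<bar> \<le> C'" and CS: "C \<ge> 0" "S \<ge> 0"
    and D: "countable D" and cont: "\<And>\<sigma>. \<sigma> > 0 \<Longrightarrow> \<sigma> \<notin> D \<Longrightarrow> isCont \<kappa> \<sigma>"
  shows "balances \<alpha> \<beta> \<kappa>"
proof -
  define \<delta> where "\<delta> n = 1 / real (Suc n)" for n
  have \<delta>_pos: "\<delta> n > 0" for n by (simp add: \<delta>_def)
  have \<delta>_lim: "\<delta> \<longlonglongrightarrow> 0"
    unfolding \<delta>_def[abs_def] by (rule LIMSEQ_Suc[OF lim_1_over_n])
  define \<kappa>s where "\<kappa>s n \<sigma> = indicator {\<delta> n..} \<sigma> * \<kappa> \<sigma>" for n \<sigma>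
  have \<kappa>s_meas: "\<kappa>s n \<in> borel_measurable borel" for n
    unfolding \<kappa>s_def[abs_def] by measurable
  have prof: "cutoff_profile (C / \<delta> n) S (\<kappa>s n)" for n
    unfolding cutoff_profile_def
  proof (intro conjI allI impI \<kappa>s_meas)
    fix \<sigma> :: real
    show "\<bar>\<kappa>s n \<sigma>\<bar> \<le> C / \<delta> n * indicator {..S} \<sigma>"
    proof (cases "\<sigma> \<ge> \<delta> n")
      case True
      then have "\<sigma> > 0" using \<delta>_pos[of n] by linarith
      have "\<bar>\<kappa> \<sigma>\<bar> \<le> C / \<sigma> * indicator {..S} \<sigma>" by (rule bound) fact
      also have "\<dots> \<le> C / \<delta> n * indicator {..S} \<sigma>"
        using True \<delta>_pos[of n] CS(1) \<open>\<sigma> > 0\<close> by (intro mult_right_mono divide_left_mono) auto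
      finally show ?thesis using True by (simp add: \<kappa>s_def)
    next
      case False
      then show ?thesis using CS(1) \<delta>_pos[of n] by (simp add: \<kappa>s_def)
    qed
  qed
  have bal: "balances \<alpha> \<beta> (\<kappa>s n)" for n
  proof (rule balances_cutoff_profile[OF \<alpha> \<beta> grid prof])
    show "C / \<delta> n \<ge> 0" using CS(1) \<delta>_pos[of n] by simp
    show "countable (insert (\<delta> n) D)" using D by simp
    fix \<sigma> assume \<sigma>: "\<sigma> > 0" "\<sigma> \<notin> insert (\<delta> n) D"
    show "isCont (\<kappa>s n) \<sigma>"
    proof (cases "\<sigma> < \<delta> n")
      case True
      have "\<forall>\<^sub>F y in nhds \<sigma>. y < \<delta> n"
        using True by (intro eventually_nhds_in_open[of "{..<\<delta> n}", simplified]) auto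
      then have "\<forall>\<^sub>F y in nhds \<sigma>. \<kappa>s n y = 0"
        by (rule eventually_mono) (simp add: \<kappa>s_def)
      then show ?thesis
        by (subst isCont_cong) auto
    next
      case False
      have "\<forall>\<^sub>F y in nhds \<sigma>. y > \<delta> n"
        using False \<sigma> by (intro eventually_nhds_in_open[of "{\<delta> n<..}", simplified]) auto
      then have "\<forall>\<^sub>F y in nhds \<sigma>. \<kappa>s n y = \<kappa> y"
        by (rule eventually_mono) (simp add: \<kappa>s_def)
      then show ?thesis
        using cont[of \<sigma>] \<sigma> by (subst isCont_cong) auto
    qed
  qed (rule CS(2))
  have tail_s: "tail (\<kappa>s n) s = tail \<kappa> (max s (\<delta> n))" for n s
    unfolding tail_def \<kappa>s_def
    by (intro Bochner_Integration.integral_cong) (auto simp: indicator_def)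
  have tail_0: "tail \<kappa> s = 0" if "s > S" for s
  proof (rule tail_eq_0)
    show "\<kappa> \<sigma> = 0" if "\<sigma> \<ge> s" for \<sigma>
      using bound[of \<sigma>] that \<open>s > S\<close> CS(2) by simp
  qed simp
  have C': "C' \<ge> 0"
    using tail_bound[of 1] by (simp add: order_trans[OF abs_ge_zero])
  let ?I = "\<lambda>x :: real ^ 'n. indicator (cball 0 (sqrt (2 * S))) x :: real"
  note meas = borel_measurable_loc_integrable[OF \<alpha>] borel_measurable_loc_integrable[OF \<beta>]
  have pos: "AE x :: real ^ 'n in lebesgue. x \<bullet> x / 2 > 0"
    by (rule eventually_mono[OF AE_half_norm_sq_notin_countable[of "{0}"]]) auto
  have ev: "\<forall>\<^sub>F n in sequentially. \<delta> n < s" if "s > 0" for s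
    using order_tendstoD(2)[OF \<delta>_lim that] .
  have "(\<lambda>n. LINT x|lebesgue. tail (\<kappa>s n) (x \<bullet> x / 2) * \<alpha> x)
      \<longlonglongrightarrow> (LINT x|lebesgue. tail \<kappa> (x \<bullet> x / 2) * \<alpha> x)"
  proof (rule integral_dominated_convergence[where w = "\<lambda>x. C' * norm (?I x * \<alpha> x)"])
    show "integrable lebesgue (\<lambda>x. C' * norm (?I x * \<alpha> x))"
      using \<alpha> unfolding loc_integrable_def by (intro integrable_mult_right integrable_norm) auto
    show "(\<lambda>x. tail \<kappa> (x \<bullet> x / 2) * \<alpha> x) \<in> borel_measurable lebesgue"
      "(\<lambda>x. tail (\<kappa>s n) (x \<bullet> x / 2) * \<alpha> x) \<in> borel_measurable lebesgue" for n
      by (intro borel_measurable_times meas borel_measurable_radial borel_measurable_tail \<kappa> \<kappa>s_meas)+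
    show "AE x in lebesgue. (\<lambda>n. tail (\<kappa>s n) (x \<bullet> x / 2) * \<alpha> x) \<longlonglongrightarrow> tail \<kappa> (x \<bullet> x / 2) * \<alpha> x"
      using pos
    proof eventually_elim
      case (elim x)
      from ev[OF this] have "\<forall>\<^sub>F n in sequentially. tail (\<kappa>s n) (x \<bullet> x / 2) * \<alpha> x = tail \<kappa> (x \<bullet> x / 2) * \<alpha> x"
        by eventually_elim (simp add: tail_s max_def)
      then show ?case by (rule tendsto_eventually)
    qed
    show "AE x in lebesgue. norm (tail (\<kappa>s n) (x \<bullet> x / 2) * \<alpha> x) \<le> C' * norm (?I x * \<alpha> x)" for n
    proof (rule AE_I2)
      fix x :: "real ^ 'n"
      have "\<bar>tail (\<kappa>s n) (x \<bullet> x / 2)\<bar> \<le> C' * indicator {..S} (x \<bullet> x / 2)"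
        using tail_bound[of "max (x \<bullet> x / 2) (\<delta> n)"] tail_0[of "max (x \<bullet> x / 2) (\<delta> n)"] \<delta>_pos[of n]
        by (cases "x \<bullet> x / 2 \<le> S") (auto simp: tail_s less_max_iff_disj)
      also have "\<dots> \<le> C' * ?I x"
        by (intro mult_left_mono radial_indicator_le C')
      finally have "\<bar>tail (\<kappa>s n) (x \<bullet> x / 2)\<bar> \<le> C' * ?I x" .
      from mult_right_mono[OF this, of "\<bar>\<alpha> x\<bar>"]
      show "norm (tail (\<kappa>s n) (x \<bullet> x / 2) * \<alpha> x) \<le> C' * norm (?I x * \<alpha> x)"
        by (simp add: abs_mult mult.assoc)
    qed
  qed
  moreover have "(\<lambda>n. LINT x|lebesgue. \<kappa>s n (x \<bullet> x / 2) * \<beta> x) \<longlonglongrightarrow> (LINT x|lebesgue. \<kappa> (x \<bullet> x / 2) * \<beta> x)"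
  proof (rule integral_dominated_convergence[where w = "\<lambda>x. 2 * C * norm (?I x * \<gamma> x)"])
    show "integrable lebesgue (\<lambda>x. 2 * C * norm (?I x * \<gamma> x))"
      using \<gamma> unfolding loc_integrable_def by (intro integrable_mult_right integrable_norm) auto
    show "(\<lambda>x. \<kappa> (x \<bullet> x / 2) * \<beta> x) \<in> borel_measurable lebesgue"
      "(\<lambda>x. \<kappa>s n (x \<bullet> x / 2) * \<beta> x) \<in> borel_measurable lebesgue" for n
      by (intro borel_measurable_times meas borel_measurable_radial \<kappa> \<kappa>s_meas)+
    show "AE x in lebesgue. (\<lambda>n. \<kappa>s n (x \<bullet> x / 2) * \<beta> x) \<longlonglongrightarrow> \<kappa> (x \<bullet> x / 2) * \<beta> x"
      using pos
    proof eventually_elim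
      case (elim x)
      from ev[OF this] have "\<forall>\<^sub>F n in sequentially. \<kappa>s n (x \<bullet> x / 2) * \<beta> x = \<kappa> (x \<bullet> x / 2) * \<beta> x"
        by eventually_elim (simp add: \<kappa>s_def)
      then show ?case by (rule tendsto_eventually)
    qed
    show "AE x in lebesgue. norm (\<kappa>s n (x \<bullet> x / 2) * \<beta> x) \<le> 2 * C * norm (?I x * \<gamma> x)" for n
      using pos
    proof eventually_elim
      case (elim x)
      let ?s = "x \<bullet> x / 2"
      have sq: "(norm x)\<^sup>2 = 2 * ?s" by (simp add: power2_norm_eq_inner)
      have "\<bar>\<kappa>s n ?s\<bar> \<le> \<bar>\<kappa> ?s\<bar>" by (simp add: \<kappa>s_def indicator_def)
      also have "\<dots> \<le> C / ?s * indicator {..S} ?s" by (rule bound) fact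
      also have "\<dots> \<le> C / ?s * ?I x"
        using elim CS(1) by (intro mult_left_mono radial_indicator_le) auto
      finally have "\<bar>\<kappa>s n ?s\<bar> * \<bar>\<beta> x\<bar> \<le> (C / ?s * ?I x) * (2 * ?s * \<bar>\<gamma> x\<bar>)"
        using elim CS(1) \<beta>\<gamma>[of x] unfolding sq
        by (intro mult_mono) (auto intro!: order_trans[OF \<beta>\<gamma>[of x]] mult_left_mono simp: sq)
      also have "\<dots> = 2 * C * (?I x * \<bar>\<gamma> x\<bar>)"
        using elim by (simp add: field_simps)
      finally show ?case by (simp add: abs_mult mult.assoc)
    qed
  qed
  moreover have "(LINT x|lebesgue. tail (\<kappa>s n) (x \<bullet> x / 2) * \<alpha> x) = (LINT x|lebesgue. \<kappa>s n (x \<bullet> x / 2) * \<beta> x)" for n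
    using bal by (simp add: balances_def)
  ultimately show ?thesis
    unfolding balances_def using LIMSEQ_unique by auto
qed

section \<open>The integral of a monotone weight\<close>

text \<open>Let \<open>\<Phi>\<close> be an antiderivative of \<open>F\<close>. The integral of the difference quotient of \<open>F\<close> is a difference of two
  difference quotients of \<open>\<Phi>\<close>, which converge to \<open>F b\<close> and \<open>F a\<close>. Under the integral, the quotients of \<open>F\<close> are
  bounded by the Lipschitz constant and converge almost everywhere to \<open>f\<close>.\<close>

lemma FTC_lipschitz_countable:
  fixes F f :: "real \<Rightarrow> real"
  assumes lip: "\<And>x y. \<bar>F x - F y\<bar> \<le> B * \<bar>x - y\<bar>" and f[measurable]: "f \<in> borel_measurable borel"
    and D: "countable D" and der: "\<And>x. a < x \<Longrightarrow> x < b \<Longrightarrow> x \<notin> D \<Longrightarrow> (F has_real_derivative f x) (at x)"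
    and "a \<le> b"
  shows "(LINT x|lborel. indicator {a..b} x * f x) = F b - F a"
proof -
  have "continuous_on UNIV F"
  proof (rule continuous_at_imp_continuous_on, rule ballI)
    fix x
    have "((\<lambda>y. B * \<bar>y - x\<bar>) \<longlongrightarrow> B * \<bar>x - x\<bar>) (at x)"
      by (intro tendsto_intros)
    then have "((\<lambda>y. B * \<bar>y - x\<bar>) \<longlongrightarrow> 0) (at x)" by simp
    then have "((\<lambda>y. F y - F x) \<longlongrightarrow> 0) (at x)"
      by (rule Lim_null_comparison[rotated]) (simp add: lip)
    then show "isCont F x"
      unfolding isCont_def by (simp add: LIM_zero_iff)
  qed
  then obtain \<Phi> where \<Phi>: "\<And>x. (\<Phi> has_real_derivative F x) (at x)"
    and cont: "\<And>x. isCont F x"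
    by (metis C_real_antiderivative continuous_on_eq_continuous_at open_UNIV UNIV_I)
  \<comment> \<open>\<open>q n\<close> is the difference quotient of \<open>F\<close> with step \<open>h n\<close>.\<close>
  define h where "h n = 1 / real (Suc n)" for n
  have h: "h n > 0" for n by (simp add: h_def)
  have h_lim: "filterlim h (at 0) sequentially"
  proof (rule filterlim_atI)
    show "h \<longlonglongrightarrow> 0"
      unfolding h_def by (rule LIMSEQ_Suc[OF lim_1_over_n])
    show "\<forall>\<^sub>F n in sequentially. h n \<noteq> 0"
      using h by (intro always_eventually allI) (simp add: less_imp_neq[symmetric] less_imp_not_eq2)
  qed
  define q where "q n x = (F (x + h n) - F x) / h n" for n x
  have q_int: "(LINT x|lborel. indicator {a..b} x * q n x) = (\<Phi> (b + h n) - \<Phi> b) / h n - (\<Phi> (a + h n) - \<Phi> a) / h n" for n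
  proof -
    have "(LINT x|lborel. q n x * indicator {a..b} x)
        = (\<Phi> (b + h n) - \<Phi> b) / h n - (\<Phi> (a + h n) - \<Phi> a) / h n"
    proof (rule integral_FTC_Icc_real[OF \<open>a \<le> b\<close>])
      show "((\<lambda>x. (\<Phi> (x + h n) - \<Phi> x) / h n) has_real_derivative q n x) (at x)" for x
        unfolding q_def
        by (intro DERIV_cdivide DERIV_diff \<Phi> DERIV_shift[THEN iffD1, OF \<Phi>])
      have "isCont (\<lambda>x. F (x + h n)) x" for x
        by (rule isCont_o2[OF _ cont]) (intro continuous_intros)
      then show "isCont (q n) x" for x
        unfolding q_def[abs_def] using h[of n] cont by (intro continuous_divide continuous_diff continuous_const) auto
    qed
    then show ?thesis by (simp add: mult.commute)
  qed
  have "(\<lambda>n. LINT x|lborel. indicator {a..b} x * q n x) \<longlonglongrightarrow> F b - F a"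
    unfolding q_int
    by (intro tendsto_diff filterlim_compose[OF \<Phi>[unfolded DERIV_def] h_lim])
  moreover have "(\<lambda>n. LINT x|lborel. indicator {a..b} x * q n x) \<longlonglongrightarrow> (LINT x|lborel. indicator {a..b} x * f x)"
  proof (rule integral_dominated_convergence[where w = "\<lambda>x. B * indicator {a..b} x"])
    show "integrable lborel (\<lambda>x. B * indicator {a..b} x :: real)"
      by (intro integrable_mult_right) (simp add: integrable_indicator_iff emeasure_lborel_Icc_eq)
    have [measurable]: "F \<in> borel_measurable borel"
      by (intro borel_measurable_continuous_onI \<open>continuous_on UNIV F\<close>)
    show "(\<lambda>x. indicator {a..b} x * f x) \<in> borel_measurable lborel"
      "(\<lambda>x. indicator {a..b} x * q n x) \<in> borel_measurable lborel" for n
      unfolding q_def by measurable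
    have "\<bar>q n x\<bar> \<le> B" for n x
      using lip[of "x + h n" x] h[of n] by (simp add: q_def abs_divide divide_le_eq)
    then show "AE x in lborel. norm (indicator {a..b} x * q n x) \<le> B * indicator {a..b} x" for n
      by (intro AE_I2) (auto simp: indicator_def)
    have "AE x in lborel. x \<notin> insert a (insert b D)"
      using D by (intro AE_not_in countable_imp_null_set_lborel) auto
    then show "AE x in lborel. (\<lambda>n. indicator {a..b} x * q n x) \<longlonglongrightarrow> indicator {a..b} x * f x"
    proof eventually_elim
      case (elim x)
      show ?case
      proof (cases "x \<in> {a..b}")
        case True
        with elim have "(F has_real_derivative f x) (at x)" by (intro der) auto
        from filterlim_compose[OF this[unfolded DERIV_def] h_lim]
        show ?thesis by (intro tendsto_mult tendsto_const) (simp add: q_def)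
      qed simp
    qed
  qed
  ultimately show ?thesis
    using LIMSEQ_unique by blast
qed

definition cumul :: "(real \<Rightarrow> real) \<Rightarrow> real \<Rightarrow> real"
  where "cumul w r = (LINT s|lebesgue_on {0..r}. w s)"

context
  fixes w :: "real \<Rightarrow> real"
  assumes w_anti: "antimono w" and w_pos: "\<And>r. w r > 0"
begin

lemma weight_borel: "w \<in> borel_measurable borel"
proof -
  have "mono (\<lambda>r. - w r)"
    using w_anti by (auto simp: monotone_def)
  from borel_measurable_uminus[OF borel_measurable_mono[OF this]] show ?thesis by simp
qed

lemma weight_integrable: "integrable (lebesgue_on {a..b}) w"
proof -
  have "integrable lebesgue (\<lambda>x. indicator {a..b} x * w x)"
  proof (rule Bochner_Integration.integrable_bound)
    show "integrable lebesgue (\<lambda>x. w a * indicator {a..b} x :: real)"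
      by (intro integrable_mult_right) (simp add: integrable_indicator_iff emeasure_lborel_Icc_eq)
    show "(\<lambda>x. indicator {a..b} x * w x) \<in> borel_measurable lebesgue"
      by (intro borel_measurable_times borel_measurable_indicator borel_measurable_lebesgueI weight_borel) auto
    show "AE x in lebesgue. norm (indicator {a..b} x * w x) \<le> norm (w a * indicator {a..b} x)"
      using w_pos antimonoD[OF w_anti] by (intro AE_I2) (auto simp: indicator_def abs_of_pos)
  qed
  then show ?thesis by (simp add: integrable_lebesgue_on_iff)
qed

lemma weight_integrable_on: "w integrable_on {a..b}"
  by (rule integrable_on_lebesgue_on[OF weight_integrable]) simp

lemma cumul_eq_integral: "cumul w r = integral {0..r} w"
  unfolding cumul_def by (rule lebesgue_integral_eq_integral[OF weight_integrable]) simp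

lemma cumul_diff_bounds:
  assumes "0 \<le> r" "r \<le> r'"
  shows "(r' - r) * w r' \<le> cumul w r' - cumul w r" "cumul w r' - cumul w r \<le> (r' - r) * w r"
proof -
  have *: "cumul w r' - cumul w r = integral {r..r'} w"
    unfolding cumul_eq_integral
    using Henstock_Kurzweil_Integration.integral_combine[OF assms weight_integrable_on] by simp
  have "integral {r..r'} (\<lambda>_. w r') \<le> integral {r..r'} w"
    by (intro integral_le weight_integrable_on) (auto intro: antimonoD[OF w_anti])
  then show "(r' - r) * w r' \<le> cumul w r' - cumul w r"
    using assms by (simp add: *)
  have "integral {r..r'} w \<le> integral {r..r'} (\<lambda>_. w r)"
    by (intro integral_le weight_integrable_on) (auto intro: antimonoD[OF w_anti])
  then show "cumul w r' - cumul w r \<le> (r' - r) * w r"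
    using assms by (simp add: *)
qed

lemma cumul_0: "cumul w 0 = 0"
  by (simp add: cumul_eq_integral)

lemma cumul_bounds:
  assumes "r \<ge> 0"
  shows "r * w r \<le> cumul w r" "cumul w r \<le> r * w 0"
  using cumul_diff_bounds[of 0 r] assms by (simp_all add: cumul_0)

lemma cumul_nonneg: "cumul w r \<ge> 0"
  unfolding cumul_def using w_pos by (intro integral_nonneg_AE) (auto simp: less_imp_le)

lemma cumul_mono: "0 \<le> r \<Longrightarrow> r \<le> r' \<Longrightarrow> cumul w r \<le> cumul w r'"
  using cumul_diff_bounds(1)[of r r'] w_pos[of r'] by (smt (verit) mult_nonneg_nonneg)

lemma cumul_borel: "cumul w \<in> borel_measurable borel"
proof (rule borel_measurable_mono, rule monoI)
  fix r r' :: real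
  assume "r \<le> r'"
  show "cumul w r \<le> cumul w r'"
  proof (cases "r \<ge> 0")
    case False
    then have "cumul w r = 0" by (simp add: cumul_eq_integral)
    then show ?thesis using cumul_nonneg by simp
  qed (use \<open>r \<le> r'\<close> cumul_mono in simp)
qed

lemma cumul_continuous: "r > 0 \<Longrightarrow> isCont (cumul w) r"
proof -
  assume "r > 0"
  have "continuous_on {0..r + 1} (cumul w)"
    unfolding cumul_eq_integral[abs_def]
    by (rule indefinite_integral_continuous_1[OF weight_integrable_on])
  then have "continuous_on {0<..<r + 1} (cumul w)"
    by (rule continuous_on_subset) auto
  then show ?thesis
    using \<open>r > 0\<close> by (simp add: continuous_on_eq_continuous_at)
qed

lemma cumul_has_derivative:
  assumes "r > 0" "isCont w r"
  shows "(cumul w has_real_derivative w r) (at r)"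
proof -
  have "((\<lambda>u. integral {0..u} w) has_vector_derivative w r) (at r within {0..r + 1} - {})"
    using assms by (intro integral_has_vector_derivative_continuous_at weight_integrable_on)
      (auto intro: continuous_at_imp_continuous_at_within)
  then have "((\<lambda>u. integral {0..u} w) has_vector_derivative w r) (at r within {0<..<r + 1})"
    by (rule has_vector_derivative_within_subset) auto
  then have "((\<lambda>u. integral {0..u} w) has_vector_derivative w r) (at r)"
    using assms(1) by (subst (asm) at_within_open) auto
  then show ?thesis
    by (simp add: cumul_eq_integral[abs_def] has_real_derivative_iff_has_vector_derivative)
qed

lemma weight_discontinuities: "countable {r. \<not> isCont w r}"
proof -
  have "mono (\<lambda>r. - w r)"
    using w_anti by (auto simp: monotone_def)
  from mono_ctble_discont[OF this] show ?thesis
  proof (rule countable_subset[rotated], intro subsetI CollectI)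
    fix r
    assume "r \<in> {r. \<not> isCont w r}"
    then show "\<not> isCont (\<lambda>r. - w r) r"
      using continuous_minus[of "at r" "\<lambda>r. - w r"] by auto
  qed
qed

end

section \<open>The truncated profile\<close>

text \<open>The factor for which the two branches of the profile below agree at \<open>r = R\<close>.\<close>

definition outer_coeff :: "(real \<Rightarrow> real) \<Rightarrow> nat \<Rightarrow> real \<Rightarrow> real \<Rightarrow> real"
  where "outer_coeff w N R L = (cumul w R / R) / (1 / R ^ N - 1 / L ^ N)"

text \<open>The function \<open>\<psi>'(r)/r\<close> for the test function \<open>\<psi>\<close>: with slope \<open>W(r)\<close> up to \<open>R\<close>, and with constant Laplacian
  between \<open>R\<close> and \<open>L\<close>.\<close>

definition profile :: "(real \<Rightarrow> real) \<Rightarrow> nat \<Rightarrow> real \<Rightarrow> real \<Rightarrow> real \<Rightarrow> real"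
  where "profile w N R L r =
    (if r < R then cumul w r / r
     else if r < L then outer_coeff w N R L * (1 / r ^ N - 1 / L ^ N) else 0)"

text \<open>Minus the derivative of the profile with respect to \<open>r\<^sup>2/2\<close>, that is, minus its \<open>r\<close>-derivative divided by \<open>r\<close>.
  On the negative axis only measurability matters.\<close>

definition profile_slope :: "(real \<Rightarrow> real) \<Rightarrow> nat \<Rightarrow> real \<Rightarrow> real \<Rightarrow> real \<Rightarrow> real"
  where "profile_slope w N R L r =
    (if r \<le> 0 then 0
     else if r < R then (cumul w r / r - w r) / r\<^sup>2
     else if r < L then outer_coeff w N R L * (real N / r ^ (N + 2)) else 0)"

context
  fixes w :: "real \<Rightarrow> real" and N :: nat and R L :: real
  assumes w_anti: "antimono w" and w_pos: "\<And>r. w r > 0" and N: "N > 0" and RL: "0 < R" "R < L"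
begin

lemma outer_coeff_nonneg: "outer_coeff w N R L \<ge> 0"
proof -
  have "1 / L ^ N \<le> 1 / R ^ N"
    using RL by (intro divide_left_mono power_mono) auto
  then show ?thesis
    using RL cumul_nonneg[OF w_anti w_pos, of R] by (simp add: outer_coeff_def)
qed

lemma outer_coeff_matching: "outer_coeff w N R L * (1 / R ^ N - 1 / L ^ N) = cumul w R / R"
proof -
  have "R ^ N < L ^ N"
    using RL N by (intro power_strict_mono) auto
  then have "1 / L ^ N < 1 / R ^ N"
    using RL by (intro divide_strict_left_mono) auto
  then have "1 / R ^ N - 1 / L ^ N \<noteq> 0" by linarith
  moreover have "a / d * d = a" if "d \<noteq> 0" for a d :: real
    using that by simp
  ultimately show ?thesis
    unfolding outer_coeff_def by blast
qed

lemma profile_slope_borel: "profile_slope w N R L \<in> borel_measurable borel"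
proof -
  note [measurable] = weight_borel[OF w_anti w_pos] cumul_borel[OF w_anti w_pos]
  show ?thesis unfolding profile_slope_def[abs_def] by measurable
qed

lemma profile_slope_bound:
  assumes "\<sigma> > 0"
  shows "\<bar>profile_slope w N R L (sqrt (2 * \<sigma>))\<bar>
    \<le> (w 0 + outer_coeff w N R L * real N / R ^ N) / \<sigma> * indicator {..L\<^sup>2 / 2} \<sigma>"
proof -
  define r where "r = sqrt (2 * \<sigma>)"
  have r: "r > 0" "r\<^sup>2 = 2 * \<sigma>" using assms by (simp_all add: r_def)
  let ?c = "outer_coeff w N R L"
  have c: "?c \<ge> 0" by (rule outer_coeff_nonneg)
  note w0 = w_pos[of 0]
  have cR: "?c * real N / R ^ N \<ge> 0" using c RL by simp
  consider "r < R" | "R \<le> r" "r < L" | "L \<le> r" by linarith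
  then have "\<bar>profile_slope w N R L r\<bar>
    \<le> (w 0 + ?c * real N / R ^ N) / \<sigma> * indicator {..L\<^sup>2 / 2} \<sigma>"
  proof cases
    case 1
    have "0 \<le> cumul w r / r - w r" "cumul w r / r - w r \<le> w 0"
      using cumul_bounds[OF w_anti w_pos, of r] r w_pos[of r] by (simp_all add: field_simps) (smt (verit) mult_pos_pos)
    moreover have "r\<^sup>2 \<le> L\<^sup>2" using 1 r RL by (intro power_mono) auto
    moreover have "w 0 / (2 * \<sigma>) \<le> (w 0 + ?c * real N / R ^ N) / \<sigma>"
      using assms w0 cR by (intro frac_le) auto
    moreover have "(cumul w r / r - w r) / (2 * \<sigma>) \<le> w 0 / (2 * \<sigma>)"
      using calculation(2) assms by (intro divide_right_mono) auto
    ultimately show ?thesis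
      using 1 r assms by (simp add: profile_slope_def abs_divide)
  next
    case 2
    have "r\<^sup>2 \<le> L\<^sup>2" using 2 r RL by (intro power_mono) auto
    have "?c * (real N / r ^ (N + 2)) = (?c * real N / r ^ N) / (2 * \<sigma>)"
      unfolding r(2)[symmetric] by (simp add: power_add power2_eq_square)
    also have "\<dots> \<le> (?c * real N / R ^ N) / (2 * \<sigma>)"
      using 2 RL c assms by (intro divide_right_mono divide_left_mono power_mono) auto
    also have "\<dots> \<le> (w 0 + ?c * real N / R ^ N) / \<sigma>"
      using assms w0 cR by (intro frac_le) auto
    finally have "?c * (real N / r ^ (N + 2)) \<le> (w 0 + ?c * real N / R ^ N) / \<sigma>" .
    moreover have "0 \<le> ?c * (real N / r ^ (N + 2))" using c r by simp
    ultimately show ?thesis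
      using 2 r RL \<open>r\<^sup>2 \<le> L\<^sup>2\<close> by (simp add: profile_slope_def)
  next
    case 3
    then show ?thesis
      using r RL assms w0 cR by (simp add: profile_slope_def)
  qed
  then show ?thesis by (simp add: r_def)
qed

lemma profile_bounds:
  assumes "r > 0"
  shows "0 \<le> profile w N R L r" "profile w N R L r \<le> w 0"
proof -
  let ?c = "outer_coeff w N R L"
  have c: "?c \<ge> 0" by (rule outer_coeff_nonneg)
  have le: "cumul w s / s \<le> w 0" if "s > 0" for s
    using cumul_bounds(2)[OF w_anti w_pos, of s] that by (simp add: field_simps)
  have "0 \<le> profile w N R L r \<and> profile w N R L r \<le> w 0"
  proof (cases "r < R \<or> r \<ge> L")
    case True
    then show ?thesis
      using le[OF assms] cumul_nonneg[OF w_anti w_pos, of r] assms w_pos[of 0] RL by (auto simp: profile_def)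
  next
    case False
    then have "1 / L ^ N \<le> 1 / r ^ N" "1 / r ^ N \<le> 1 / R ^ N"
      using RL by (auto intro!: divide_left_mono power_mono)
    then have "0 \<le> ?c * (1 / r ^ N - 1 / L ^ N)" "?c * (1 / r ^ N - 1 / L ^ N) \<le> ?c * (1 / R ^ N - 1 / L ^ N)"
      using c by (auto intro!: mult_left_mono)
    then show ?thesis
      using False le[OF RL(1)] by (auto simp: profile_def outer_coeff_matching)
  qed
  then show "0 \<le> profile w N R L r" "profile w N R L r \<le> w 0" by auto
qed

lemma sqrt_chain:
  assumes "s > 0" and "(h has_real_derivative d * sqrt (2 * s)) (at (sqrt (2 * s)))"
  shows "((\<lambda>s. h (sqrt (2 * s))) has_real_derivative d) (at s)"
proof -
  have "((\<lambda>s. sqrt (2 * s)) has_real_derivative inverse (sqrt (2 * s)) / 2 * 2) (at s)"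
    using assms(1) by (intro DERIV_chain2[OF DERIV_real_sqrt]) (auto intro!: derivative_eq_intros)
  from DERIV_chain2[OF assms(2) this] show ?thesis
    using assms(1) by (simp add: mult.assoc)
qed

lemma inner_slope:
  assumes "r > 0" "isCont w r"
  shows "((\<lambda>r. cumul w r / r) has_real_derivative - ((cumul w r / r - w r) / r\<^sup>2) * r) (at r)"
proof -
  have "((\<lambda>r. cumul w r / r) has_real_derivative (w r * r - cumul w r * 1) / (r * r)) (at r)"
    using assms by (intro DERIV_divide cumul_has_derivative[OF w_anti w_pos] DERIV_ident) auto
  also have "(w r * r - cumul w r * 1) / (r * r) = - ((cumul w r / r - w r) / r\<^sup>2) * r"
    using assms by (simp add: field_simps power2_eq_square)
  finally show ?thesis .
qed

text \<open>A monotone \<open>w\<close> may have dense jumps, so \<open>W(r)/r\<close> need not be differentiable on any interval. Being Lipschitz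
  away from the origin, it is still recovered from its derivative.\<close>

lemma inner_lipschitz:
  assumes "0 < s0" "s0 \<le> s" "s \<le> s'"
  shows "\<bar>cumul w (sqrt (2 * s)) / sqrt (2 * s) - cumul w (sqrt (2 * s')) / sqrt (2 * s')\<bar> \<le> w 0 / s0 * (s' - s)"
proof -
  define r r' where "r = sqrt (2 * s)" and "r' = sqrt (2 * s')"
  have r: "0 < r" "r \<le> r'" "r\<^sup>2 = 2 * s" "r'\<^sup>2 = 2 * s'"
    using assms by (simp_all add: r_def r'_def)
  have d: "0 \<le> cumul w r' - cumul w r" "cumul w r' - cumul w r \<le> (r' - r) * w 0"
  proof -
    have "(r' - r) * w r' \<ge> 0" "(r' - r) * w r \<le> (r' - r) * w 0"
      using r w_pos[of r'] antimonoD[OF w_anti, of 0 r] by (auto intro!: mult_left_mono)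
    then show "0 \<le> cumul w r' - cumul w r" "cumul w r' - cumul w r \<le> (r' - r) * w 0"
      using cumul_diff_bounds[OF w_anti w_pos, of r r'] r by linarith+
  qed
  have b: "0 \<le> cumul w r" "cumul w r \<le> r * w 0"
    using cumul_nonneg[OF w_anti w_pos] cumul_bounds(2)[OF w_anti w_pos, of r] r by auto
  have eq: "cumul w r / r - cumul w r' / r' = (cumul w r * (r' - r) - (cumul w r' - cumul w r) * r) / (r * r')"
    using r by (simp add: field_simps)
  have "cumul w r * (r' - r) \<le> (r * w 0) * (r' - r)" "(cumul w r' - cumul w r) * r \<le> ((r' - r) * w 0) * r"
    "0 \<le> cumul w r * (r' - r)" "0 \<le> (cumul w r' - cumul w r) * r"
    using b d r by (auto intro!: mult_right_mono)
  then have "\<bar>cumul w r * (r' - r) - (cumul w r' - cumul w r) * r\<bar> \<le> w 0 * (r' - r) * r"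
    by (simp add: abs_le_iff algebra_simps)
  moreover have pos: "r * r' > 0" using r by simp
  ultimately have "\<bar>cumul w r * (r' - r) - (cumul w r' - cumul w r) * r\<bar> / (r * r') \<le> w 0 * (r' - r) * r / (r * r')"
    by (intro divide_right_mono) auto
  then have "\<bar>cumul w r / r - cumul w r' / r'\<bar> \<le> w 0 * (r' - r) * r / (r * r')"
    unfolding eq abs_divide using pos by (simp only: abs_of_pos)
  also have "\<dots> = w 0 * ((r' - r) / r')"
    using r by (simp add: field_simps)
  also have "(r' - r) / r' \<le> (s' - s) / s0"
  proof -
    have "(r' - r) / r' = (r' - r) * (r' + r) / (r' * (r' + r))"
      using r by simp
    also have "(r' - r) * (r' + r) = 2 * (s' - s)"
      using r by (simp add: algebra_simps power2_eq_square)
    also have "2 * (s' - s) / (r' * (r' + r)) \<le> 2 * (s' - s) / (2 * s0)"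
    proof (intro divide_left_mono mult_pos_pos)
      have "2 * s0 \<le> r' * r'" using r assms by (simp add: power2_eq_square)
      also have "\<dots> \<le> r' * (r' + r)" using r by (intro mult_left_mono) auto
      finally show "2 * s0 \<le> r' * (r' + r)" .
    qed (use r assms in auto)
    also have "2 * (s' - s) / (2 * s0) = (s' - s) / s0"
      by (rule mult_divide_mult_cancel_left) simp
    finally show ?thesis .
  qed
  then have "w 0 * ((r' - r) / r') \<le> w 0 * ((s' - s) / s0)"
    using w_pos[of 0] by (intro mult_left_mono) auto
  finally show ?thesis by (simp add: r_def r'_def)
qed

abbreviation "half_sq_slope \<equiv> \<lambda>\<sigma>. profile_slope w N R L (sqrt (2 * \<sigma>))"

lemma half_sq_slope_borel: "half_sq_slope \<in> borel_measurable borel"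
  using profile_slope_borel by measurable

lemma tail_profile_outer:
  assumes s: "R\<^sup>2 / 2 \<le> s"
  shows "tail half_sq_slope s = (if s < L\<^sup>2 / 2 then outer_coeff w N R L * (1 / sqrt (2 * s) ^ N - 1 / L ^ N) else 0)"
proof (cases "s < L\<^sup>2 / 2")
  case False
  have "half_sq_slope \<sigma> = 0" if "\<sigma> \<ge> L\<^sup>2 / 2" for \<sigma>
  proof -
    have "L \<le> sqrt (2 * \<sigma>)" using that by (intro real_le_rsqrt) simp
    then show ?thesis using RL by (simp add: profile_slope_def)
  qed
  with False show ?thesis
    by (simp add: tail_eq_0[of "L\<^sup>2 / 2"])
next
  case True
  let ?c = "outer_coeff w N R L" and ?S = "L\<^sup>2 / 2"
  have s0: "s > 0" using s RL by (smt (verit) zero_less_power divide_pos_pos)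
  define g where "g \<sigma> = ?c * (real N / sqrt (2 * \<sigma>) ^ (N + 2))" for \<sigma>
  have sL: "sqrt (2 * ?S) = L" using RL by simp
  have "tail half_sq_slope s = (LINT \<sigma>|lborel. g \<sigma> * indicator {s..?S} \<sigma>)"
    unfolding tail_def
  proof (rule integral_cong_AE)
    have [measurable]: "half_sq_slope \<in> borel_measurable borel" by (rule half_sq_slope_borel)
    show "(\<lambda>\<sigma>. indicator {s..} \<sigma> * half_sq_slope \<sigma>) \<in> borel_measurable lborel"
      "(\<lambda>\<sigma>. g \<sigma> * indicator {s..?S} \<sigma>) \<in> borel_measurable lborel"
      unfolding g_def by measurable
    have "AE \<sigma> in lborel. \<sigma> \<notin> {?S}"
      by (intro AE_not_in countable_imp_null_set_lborel) simp
    then show "AE \<sigma> in lborel. indicator {s..} \<sigma> * half_sq_slope \<sigma> = g \<sigma> * indicator {s..?S} \<sigma>"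
    proof eventually_elim
      case (elim \<sigma>)
      show ?case
      proof (cases "\<sigma> \<ge> s")
        case True
        have "R \<le> sqrt (2 * \<sigma>)" using True s by (intro real_le_rsqrt) simp
        moreover have "sqrt (2 * \<sigma>) < L \<longleftrightarrow> \<sigma> < ?S"
          using real_sqrt_less_iff[of "2 * \<sigma>" "2 * ?S"] sL by (simp add: mult.commute)
        ultimately show ?thesis
          using True elim RL s0 by (auto simp: profile_slope_def g_def indicator_def)
      qed simp
    qed
  qed
  also have "\<dots> = - (?c * (1 / sqrt (2 * ?S) ^ N - 1 / L ^ N)) - - (?c * (1 / sqrt (2 * s) ^ N - 1 / L ^ N))"
  proof (rule integral_FTC_Icc_real)
    fix \<sigma> assume \<sigma>: "s \<le> \<sigma>" "\<sigma> \<le> ?S"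
    then have pos: "sqrt (2 * \<sigma>) > 0" using s0 by simp
    show "((\<lambda>\<sigma>. - (?c * (1 / sqrt (2 * \<sigma>) ^ N - 1 / L ^ N))) has_real_derivative g \<sigma>) (at \<sigma>)"
    proof (rule sqrt_chain)
      show "\<sigma> > 0" using \<sigma> s0 by simp
      define r where "r = sqrt (2 * \<sigma>)"
      obtain M where M: "N = Suc M" using N by (cases N) auto
      have "((\<lambda>r. - (?c * (1 / r ^ N - 1 / L ^ N))) has_real_derivative
          - (?c * ((0 * r ^ N - 1 * (real N * r ^ M)) / (r ^ N * r ^ N) - 0))) (at r)"
        using pos unfolding M r_def[symmetric]
        by (intro DERIV_minus DERIV_cmult DERIV_diff DERIV_divide DERIV_const)
           (use DERIV_pow[of "Suc M" r] in auto)
      also have "- (?c * ((0 * r ^ N - 1 * (real N * r ^ M)) / (r ^ N * r ^ N) - 0)) = g \<sigma> * r"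
        using pos unfolding g_def r_def[symmetric] M by (simp add: field_simps)
      finally show "((\<lambda>r. - (?c * (1 / r ^ N - 1 / L ^ N))) has_real_derivative g \<sigma> * sqrt (2 * \<sigma>)) (at (sqrt (2 * \<sigma>)))"
        by (simp add: r_def)
    qed
    show "isCont g \<sigma>"
      unfolding g_def[abs_def] using pos by (intro continuous_intros) auto
  qed (use True in simp)
  also have "\<dots> = ?c * (1 / sqrt (2 * s) ^ N - 1 / L ^ N)"
    unfolding sL by simp
  finally show ?thesis using True by simp
qed

lemma cutoff_profile_half_sq_slope:
  assumes "s0 > 0"
  shows "cutoff_profile ((w 0 + outer_coeff w N R L * real N / R ^ N) / s0) (L\<^sup>2 / 2) (\<lambda>\<sigma>. indicator {s0..} \<sigma> * half_sq_slope \<sigma>)"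
  unfolding cutoff_profile_def
proof (intro conjI allI impI)
  have [measurable]: "half_sq_slope \<in> borel_measurable borel" by (rule half_sq_slope_borel)
  show "(\<lambda>\<sigma>. indicator {s0..} \<sigma> * half_sq_slope \<sigma>) \<in> borel_measurable borel"
    by measurable
  let ?C = "w 0 + outer_coeff w N R L * real N / R ^ N"
  have C: "?C \<ge> 0"
    using w_pos[of 0] outer_coeff_nonneg RL by (simp add: less_imp_le)
  fix \<sigma> :: real
  show "\<bar>indicator {s0..} \<sigma> * half_sq_slope \<sigma>\<bar> \<le> ?C / s0 * indicator {..L\<^sup>2 / 2} \<sigma>"
  proof (cases "\<sigma> \<ge> s0")
    case True
    then have "\<bar>half_sq_slope \<sigma>\<bar> \<le> ?C / \<sigma> * indicator {..L\<^sup>2 / 2} \<sigma>"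
      using assms by (intro profile_slope_bound) simp
    also have "\<dots> \<le> ?C / s0 * indicator {..L\<^sup>2 / 2} \<sigma>"
      using True assms C by (intro mult_right_mono divide_left_mono) auto
    finally show ?thesis using True by simp
  next
    case False
    then show ?thesis using C assms by simp
  qed
qed

text \<open>Up to \<open>R\<close> the fundamental theorem of calculus has countably many exceptional points, the jumps of \<open>w\<close>; beyond \<open>R\<close>
  the profile is smooth. The choice of the factor in \<open>outer_coeff\<close> lets the two parts fit together.\<close>

lemma tail_profile:
  assumes "s > 0"
  shows "tail half_sq_slope s = profile w N R L (sqrt (2 * s))"
proof (cases "s < R\<^sup>2 / 2")
  case False
  have "R \<le> sqrt (2 * s)" using False by (intro real_le_rsqrt) simp
  moreover have "sqrt (2 * s) < L \<longleftrightarrow> s < L\<^sup>2 / 2"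
    using real_sqrt_less_iff[of "2 * s" "L\<^sup>2"] RL by (simp add: mult.commute)
  ultimately show ?thesis
    using False tail_profile_outer[of s] by (simp add: profile_def)
next
  case True
  let ?S = "R\<^sup>2 / 2" and ?D = "(\<lambda>r. r\<^sup>2 / 2) ` {r. \<not> isCont w r}"
  define V where "V \<sigma> = cumul w (sqrt (2 * \<sigma>)) / sqrt (2 * \<sigma>)" for \<sigma>
  define F where "F \<sigma> = - V (max \<sigma> s)" for \<sigma>
  have sR: "sqrt (2 * ?S) = R" using RL by simp
  have [measurable]: "half_sq_slope \<in> borel_measurable borel" by (rule half_sq_slope_borel)
  have FTC: "(LINT \<sigma>|lborel. indicator {s..?S} \<sigma> * half_sq_slope \<sigma>) = F ?S - F s"
  proof (rule FTC_lipschitz_countable[where B = "w 0 / s" and D = ?D])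
    show "\<bar>F x - F y\<bar> \<le> w 0 / s * \<bar>x - y\<bar>" for x y
    proof -
      have *: "\<bar>V x - V y\<bar> \<le> w 0 / s * (y - x)" if "s \<le> x" "x \<le> y" for x y
        unfolding V_def using inner_lipschitz[OF assms that] .
      have **: "\<bar>V y - V x\<bar> \<le> w 0 / s * \<bar>x - y\<bar>" if "s \<le> x" "s \<le> y" for x y
        using *[of x y] *[of y x] that by (cases "x \<le> y") (simp_all add: abs_minus_commute)
      have "\<bar>F x - F y\<bar> \<le> w 0 / s * \<bar>max x s - max y s\<bar>"
        using **[of "max x s" "max y s"] by (simp add: F_def)
      also have "\<dots> \<le> w 0 / s * \<bar>x - y\<bar>"
        using w_pos[of 0] assms by (intro mult_left_mono) auto
      finally show ?thesis .
    qed
    show "countable ?D"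
      using weight_discontinuities[OF w_anti w_pos] by simp
    fix \<sigma> assume \<sigma>: "s < \<sigma>" "\<sigma> < ?S" "\<sigma> \<notin> ?D"
    have "isCont w (sqrt (2 * \<sigma>))"
    proof (rule ccontr)
      assume "\<not> isCont w (sqrt (2 * \<sigma>))"
      then have "(sqrt (2 * \<sigma>))\<^sup>2 / 2 \<in> ?D" by blast
      with \<sigma> assms show False by simp
    qed
    moreover have "sqrt (2 * \<sigma>) > 0" using \<sigma> assms by simp
    moreover have "sqrt (2 * \<sigma>) < R"
      using real_sqrt_less_iff[of "2 * \<sigma>" "2 * ?S"] \<sigma> sR by simp
    ultimately have "((\<lambda>r. cumul w r / r) has_real_derivative - half_sq_slope \<sigma> * sqrt (2 * \<sigma>)) (at (sqrt (2 * \<sigma>)))"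
      using inner_slope[of "sqrt (2 * \<sigma>)"] by (simp add: profile_slope_def)
    then have "(V has_real_derivative - half_sq_slope \<sigma>) (at \<sigma>)"
      unfolding V_def using \<sigma> assms by (intro sqrt_chain) auto
    then have "((\<lambda>\<sigma>. - V \<sigma>) has_real_derivative half_sq_slope \<sigma>) (at \<sigma>)"
      using DERIV_minus by fastforce
    then show "(F has_real_derivative half_sq_slope \<sigma>) (at \<sigma>)"
      by (rule has_field_derivative_transform_within_open[where S = "{s<..}"])
         (use \<sigma> in \<open>auto simp: F_def max_def\<close>)
  qed (use True in auto)
  have "tail half_sq_slope s = (LINT \<sigma>|lborel. indicator {s..?S} \<sigma> * half_sq_slope \<sigma> + indicator {?S..} \<sigma> * half_sq_slope \<sigma>)"
    unfolding tail_def
  proof (rule integral_cong_AE)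
    have "AE \<sigma> in lborel. \<sigma> \<notin> {?S}"
      by (intro AE_not_in countable_imp_null_set_lborel) simp
    then show "AE \<sigma> in lborel. indicator {s..} \<sigma> * half_sq_slope \<sigma> = indicator {s..?S} \<sigma> * half_sq_slope \<sigma> + indicator {?S..} \<sigma> * half_sq_slope \<sigma>"
      by eventually_elim (use True in \<open>auto simp: indicator_def\<close>)
  qed measurable
  also have "\<dots> = (LINT \<sigma>|lborel. indicator {s..?S} \<sigma> * half_sq_slope \<sigma>) + tail half_sq_slope ?S"
    unfolding tail_def
  proof (rule Bochner_Integration.integral_add)
    have pos: "0 < ?S" using RL by simp
    have int: "integrable lborel (\<lambda>\<sigma>. indicator {s'..} \<sigma> * half_sq_slope \<sigma>)" if "s' > 0" for s'
    proof -
      have "integrable lborel (\<lambda>\<sigma>. indicator {s'..} \<sigma> * (indicator {s'..} \<sigma> * half_sq_slope \<sigma>))"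
        using cutoff_profile_integrable[OF cutoff_profile_half_sq_slope[OF that], of s'] that by simp
      also have "(\<lambda>\<sigma>. indicator {s'..} \<sigma> * (indicator {s'..} \<sigma> * half_sq_slope \<sigma>)) = (\<lambda>\<sigma>. indicator {s'..} \<sigma> * half_sq_slope \<sigma>)"
        by (auto simp: indicator_def)
      finally show ?thesis .
    qed
    show "integrable lborel (\<lambda>\<sigma>. indicator {?S..} \<sigma> * half_sq_slope \<sigma>)" by (rule int[OF pos])
    have "integrable lborel (\<lambda>\<sigma>. indicator {s..?S} \<sigma> *\<^sub>R (indicator {s..} \<sigma> * half_sq_slope \<sigma>))"
      by (intro integrable_mult_indicator int assms) simp
    also have "(\<lambda>\<sigma>. indicator {s..?S} \<sigma> *\<^sub>R (indicator {s..} \<sigma> * half_sq_slope \<sigma>)) = (\<lambda>\<sigma>. indicator {s..?S} \<sigma> * half_sq_slope \<sigma>)"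
      by (auto simp: indicator_def)
    finally show "integrable lborel (\<lambda>\<sigma>. indicator {s..?S} \<sigma> * half_sq_slope \<sigma>)" .
  qed
  also have "tail half_sq_slope ?S = cumul w R / R"
    using tail_profile_outer[of ?S] RL outer_coeff_matching power_strict_mono[of R L 2] by (simp add: sR)
  also have "(LINT \<sigma>|lborel. indicator {s..?S} \<sigma> * half_sq_slope \<sigma>) = V s - cumul w R / R"
    unfolding FTC F_def using True RL by (simp add: V_def)
  also have "V s - cumul w R / R + cumul w R / R = profile w N R L (sqrt (2 * s))"
    using real_sqrt_less_iff[of "2 * s" "R\<^sup>2"] True RL by (simp add: V_def profile_def)
  finally show ?thesis .
qed

lemma half_sq_slope_continuous:
  assumes "\<sigma> > 0" "\<sigma> \<notin> (\<lambda>r. r\<^sup>2 / 2) ` ({r. \<not> isCont w r} \<union> {R, L})"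
  shows "isCont half_sq_slope \<sigma>"
proof -
  define r where "r = sqrt (2 * \<sigma>)"
  have r: "r > 0" "\<sigma> = r\<^sup>2 / 2" using assms(1) by (simp_all add: r_def)
  with assms(2) have cont: "isCont w r" and "r \<noteq> R" "r \<noteq> L" by auto
  then consider "r < R" | "R < r" "r < L" | "L < r" by linarith
  then have "isCont (profile_slope w N R L) r"
  proof cases
    case 1
    have "isCont (\<lambda>r. (cumul w r / r - w r) / r\<^sup>2) r"
      using r cont by (intro continuous_intros cumul_continuous[OF w_anti w_pos]) auto
    moreover have "\<forall>\<^sub>F y in nhds r. profile_slope w N R L y = (cumul w y / y - w y) / y\<^sup>2"
      unfolding eventually_nhds using 1 r
      by (intro exI[of _ "{0<..<R}"]) (auto simp: profile_slope_def)
    ultimately show ?thesis by (subst isCont_cong)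
  next
    case 2
    have "isCont (\<lambda>r. outer_coeff w N R L * (real N / r ^ (N + 2))) r"
      using r by (intro continuous_intros) auto
    moreover have "\<forall>\<^sub>F y in nhds r. profile_slope w N R L y = outer_coeff w N R L * (real N / y ^ (N + 2))"
      unfolding eventually_nhds using 2 RL
      by (intro exI[of _ "{R<..<L}"]) (auto simp: profile_slope_def)
    ultimately show ?thesis by (subst isCont_cong)
  next
    case 3
    have "\<forall>\<^sub>F y in nhds r. profile_slope w N R L y = 0"
      unfolding eventually_nhds using 3 RL
      by (intro exI[of _ "{L<..}"]) (auto simp: profile_slope_def)
    then show ?thesis by (subst isCont_cong) auto
  qed
  moreover have "isCont (\<lambda>\<sigma>. sqrt (2 * \<sigma>)) \<sigma>"
    by (intro continuous_intros)
  ultimately show ?thesis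
    unfolding r_def by (rule isCont_o2[rotated])
qed

end

section \<open>The energy inequality\<close>

text \<open>Inside the ball: \<open>V\<close> stands for \<open>W/r\<close>, \<open>A\<close> and \<open>B\<close> for \<open>\<bar>v\<bar>\<^sup>2\<close> and \<open>\<bar>b\<bar>\<^sup>2\<close>, and \<open>a\<close> and \<open>d\<close> for the squares of
  the radial components. The difference of the two sides is
  \<open>(V - w)(A - a) + w A/2 + (V - w) d + B V (n - 3)/2\<close>; the last term is where the dimension matters.\<close>

lemma inner_integrand_bound:
  fixes V w A B a d p n :: real
  assumes "0 \<le> w" "w \<le> V" "3 \<le> n" "a \<le> A" "0 \<le> a" "d \<le> B" "0 \<le> d"
  shows "p * (w + (n - 1) * V) + w * (A + B) / 2
    \<le> V * (A - B + n * (p + B / 2)) - (V - w) * (a - d + (p + B / 2))"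
proof -
  have "0 \<le> (V - w) * (A - a)" "0 \<le> w * A" "0 \<le> (V - w) * d" "0 \<le> B * V * (n - 3)"
    using assms by simp_all
  moreover have "V * (A - B + n * (p + B / 2)) - (V - w) * (a - d + (p + B / 2))
      - (p * (w + (n - 1) * V) + w * (A + B) / 2)
    = (V - w) * (A - a) + w * A / 2 + (V - w) * d + B * V * (n - 3) / 2"
    by (simp add: field_simps)
  ultimately show ?thesis by linarith
qed

text \<open>In the shell, with \<open>\<rho> = r\<^sup>-\<^sup>n\<close> and \<open>\<tau> = L\<^sup>-\<^sup>n\<close>: the terms \<open>c n \<rho> p\<close> cancel, so the pressure keeps only the small
  factor \<open>c n \<tau>\<close>.\<close>

lemma outer_integrand_bound:
  fixes c \<rho> \<tau> A B a d p n :: real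
  assumes "0 \<le> c" "0 \<le> \<tau>" "\<tau> \<le> \<rho>" "2 \<le> n" "a \<le> A" "0 \<le> a" "d \<le> B" "0 \<le> d"
  shows "- (c * n * \<rho> * (A + B)) - c * n * \<tau> * \<bar>p\<bar>
    \<le> c * (\<rho> - \<tau>) * (A - B + n * (p + B / 2)) - c * n * \<rho> * (a - d + (p + B / 2))"
proof -
  have "0 \<le> (\<rho> - \<tau>) * A" "0 \<le> \<tau> * B" "0 \<le> n * \<rho> * (A - a)" "0 \<le> n * \<rho> * d" "0 \<le> n * \<tau> * (\<bar>p\<bar> - p)"
    "0 \<le> \<rho> * B * (n - 2)" "0 \<le> n * (\<rho> - \<tau>) * B"
    using assms by simp_all
  then have "0 \<le> c * ((\<rho> - \<tau>) * A + \<tau> * B + n * \<rho> * (A - a) + n * \<rho> * d + n * \<tau> * (\<bar>p\<bar> - p)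
      + \<rho> * B * (n - 2) / 2 + n * (\<rho> - \<tau>) * B / 2)"
    using assms(1) by (intro mult_nonneg_nonneg) auto
  also have "\<dots> = c * (\<rho> - \<tau>) * (A - B + n * (p + B / 2)) - c * n * \<rho> * (a - d + (p + B / 2))
      - (- (c * n * \<rho> * (A + B)) - c * n * \<tau> * \<bar>p\<bar>)"
    by (simp add: field_simps)
  finally show ?thesis by linarith
qed

lemma outer_coeff_le:
  assumes "antimono w" "\<And>r. w r > 0" "0 < R" "2 * R \<le> L" "N > 0"
  shows "outer_coeff w N R L \<le> 2 * cumul w R * R ^ N / R"
proof -
  have "2 * R ^ N \<le> L ^ N"
  proof -
    have "2 * R ^ N \<le> 2 ^ N * R ^ N"
      using assms(3,5) by (intro mult_right_mono self_le_power) auto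
    also have "\<dots> = (2 * R) ^ N" by (simp add: power_mult_distrib)
    also have "\<dots> \<le> L ^ N" using assms by (intro power_mono) auto
    finally show ?thesis .
  qed
  then have "1 / L ^ N \<le> 1 / (2 * R ^ N)"
    using assms by (intro divide_left_mono) auto
  then have gap: "1 / (2 * R ^ N) \<le> 1 / R ^ N - 1 / L ^ N"
    using assms by (simp add: field_simps)
  moreover have "0 < 1 / (2 * R ^ N)" using assms by simp
  ultimately have gap_pos: "0 < 1 / R ^ N - 1 / L ^ N" by linarith
  from gap have "outer_coeff w N R L \<le> (cumul w R / R) / (1 / (2 * R ^ N))"
    unfolding outer_coeff_def using assms cumul_nonneg[OF assms(1,2), of R]
    by (intro divide_left_mono mult_pos_pos gap_pos) auto
  also have "\<dots> = 2 * cumul w R * R ^ N / R" by simp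
  finally show ?thesis .
qed

definition pressure_weight :: "(real \<Rightarrow> real) \<Rightarrow> real ^ 'n::finite \<Rightarrow> real"
  where "pressure_weight w x = w (norm x) + (real CARD('n) - 1) / norm x * cumul w (norm x)"

context
  fixes w :: "real \<Rightarrow> real"
  assumes w_anti: "antimono w" and w_pos: "\<And>r. w r > 0"
begin

lemma pressure_weight_bounds:
  "0 \<le> pressure_weight w (x :: real ^ 'n::finite)" "pressure_weight w x \<le> real CARD('n) * w 0"
proof -
  have N: "real CARD('n) \<ge> 1" by (simp add: Suc_leI)
  have "cumul w (norm x) / norm x \<le> w 0"
    using cumul_bounds(2)[OF w_anti w_pos, of "norm x"] w_pos[of 0]
    by (cases "x = 0") (auto simp: field_simps)
  then have "(real CARD('n) - 1) * (cumul w (norm x) / norm x) \<le> (real CARD('n) - 1) * w 0"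
    using N by (intro mult_left_mono) auto
  moreover have "w (norm x) \<le> w 0"
    by (rule antimonoD[OF w_anti]) simp
  ultimately show "pressure_weight w x \<le> real CARD('n) * w 0"
    by (simp add: pressure_weight_def algebra_simps)
  have "0 \<le> (real CARD('n) - 1) / norm x * cumul w (norm x)"
    using N cumul_nonneg[OF w_anti w_pos, of "norm x"] by simp
  then show "0 \<le> pressure_weight w x"
    using w_pos[of "norm x"] by (simp add: pressure_weight_def less_imp_le)
qed

lemma borel_measurable_norm_comp:
  "h \<in> borel_measurable borel \<Longrightarrow> (\<lambda>x :: real ^ 'n::finite. h (norm x)) \<in> borel_measurable lebesgue"
  by (rule borel_measurable_lebesgueI, rule measurable_compose[where g = h and N = borel]) simp_all

lemma pressure_weight_measurable: "(pressure_weight w :: real ^ 'n::finite \<Rightarrow> real) \<in> borel_measurable lebesgue"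
proof -
  have [measurable]: "w \<in> borel_measurable borel" "cumul w \<in> borel_measurable borel"
    by (rule weight_borel[OF w_anti w_pos], rule cumul_borel[OF w_anti w_pos])
  have "(\<lambda>r. w r + (real CARD('n) - 1) / r * cumul w r) \<in> borel_measurable borel"
    by measurable
  from borel_measurable_norm_comp[OF this] show ?thesis
    by (simp add: pressure_weight_def[abs_def])
qed

lemma loc_integrable_pressure_weight:
  fixes p :: "real ^ 'n::finite \<Rightarrow> real"
  assumes "loc_integrable p"
  shows "loc_integrable (\<lambda>x. p x * pressure_weight w x)"
proof (rule loc_integrable_bound[OF assms, where C = "\<lambda>_. real CARD('n) * w 0"])
  show "(\<lambda>x. p x * pressure_weight w x) \<in> borel_measurable lebesgue"
    by (intro borel_measurable_times borel_measurable_loc_integrable[OF assms] pressure_weight_measurable)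
  show "\<bar>p x * pressure_weight w x\<bar> \<le> real CARD('n) * w 0 * \<bar>p x\<bar>" for x
    using mult_right_mono[OF pressure_weight_bounds(2)[of x], of "\<bar>p x\<bar>"] pressure_weight_bounds(1)[of x]
    by (simp add: abs_mult mult.commute)
qed

lemma loc_integrable_w_mult:
  fixes u :: "real ^ 'n::finite \<Rightarrow> real"
  assumes "loc_integrable u"
  shows "loc_integrable (\<lambda>x. w (norm x) * u x)"
proof (rule loc_integrable_bound[OF assms, where C = "\<lambda>_. w 0"])
  show "(\<lambda>x. w (norm x) * u x) \<in> borel_measurable lebesgue"
    by (intro borel_measurable_times borel_measurable_loc_integrable[OF assms]
        borel_measurable_norm_comp weight_borel[OF w_anti w_pos])
  show "\<bar>w (norm x) * u x\<bar> \<le> w 0 * \<bar>u x\<bar>" for x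
    using mult_right_mono[OF antimonoD[OF w_anti, of 0 "norm x"], of "\<bar>u x\<bar>"] w_pos[of "norm x"]
    by (simp add: abs_mult)
qed

text \<open>The identity for the truncated profile, integrated over the ball, where the integrand is bounded below by
  the weighted pressure and energy, and over the shell, where it is an error. The condition \<open>L \<ge> 2 R\<close> keeps
  \<open>R\<^sup>-\<^sup>N - L\<^sup>-\<^sup>N\<close> of order \<open>R\<^sup>-\<^sup>N\<close>, and \<open>r \<ge> R \<ge> 1\<close> allows to replace \<open>1/r\<close> by \<open>2/(1 + r)\<close>.\<close>

lemma energy_inequality:
  fixes v b :: "real ^ 'n::finite \<Rightarrow> real ^ 'n" and p :: "real ^ 'n \<Rightarrow> real"
  assumes state: "MHD_state v b p"
    and grid: "\<And>j m :: nat. balances (stress_trace v b p) (stress_radial v b p)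
                 (indicator {real j / real (Suc m)<..<real (Suc j) / real (Suc m)})"
    and card: "CARD('n) \<ge> 3"
    and decay: "integrable lebesgue (\<lambda>x. ((norm (v x))\<^sup>2 + (norm (b x))\<^sup>2) / (1 + norm x))"
    and M: "\<And>r. r \<ge> 0 \<Longrightarrow> cumul w r \<le> M" and RL: "1 \<le> R" "2 * R \<le> L"
  shows "(LINT x|lebesgue. indicator (ball 0 R) x * (p x * pressure_weight w x))
      + (LINT x|lebesgue. indicator (ball 0 R) x * (w (norm x) * ((norm (v x))\<^sup>2 + (norm (b x))\<^sup>2))) / 2
    \<le> 4 * real CARD('n) * M * (LINT x|lebesgue. indicator (- ball 0 R) x * (((norm (v x))\<^sup>2 + (norm (b x))\<^sup>2) / (1 + norm x)))
      + 2 * real CARD('n) * M * R ^ CARD('n) / R * ((LINT x|lebesgue. indicator (cball 0 L) x * \<bar>p x\<bar>) / L ^ CARD('n))"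
proof -
  let ?N = "CARD('n)" and ?n = "real CARD('n)"
  let ?\<alpha> = "stress_trace v b p" and ?\<beta> = "stress_radial v b p"
  let ?P = "\<lambda>x :: real ^ 'n. profile w ?N R L (norm x)" and ?K = "\<lambda>x :: real ^ 'n. profile_slope w ?N R L (norm x)"
  let ?c = "outer_coeff w ?N R L"
  let ?\<kappa> = "\<lambda>\<sigma>. profile_slope w ?N R L (sqrt (2 * \<sigma>))"
  define u where "u x = (norm (v x))\<^sup>2 + (norm (b x))\<^sup>2" for x
  define \<gamma> where "\<gamma> x = (norm (v x))\<^sup>2 + 2 * (norm (b x))\<^sup>2 + \<bar>p x\<bar>" for x
  have N: "?N > 0" and RL': "0 < R" "R < L" using RL by auto
  note [simp] = N
  note prof = w_anti w_pos N RL'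
  have M0: "M \<ge> 0" using M[of 0] by (simp add: cumul_0[OF w_anti w_pos])
  have v: "loc_integrable (\<lambda>x. (norm (v x))\<^sup>2)" and b: "loc_integrable (\<lambda>x. (norm (b x))\<^sup>2)" and p: "loc_integrable p"
    using state by (simp_all add: MHD_state_def)
  have abs_p: "loc_integrable (\<lambda>x. \<bar>p x\<bar>)"
  proof (rule loc_integrable_bound[OF p, where C = "\<lambda>_. 1"])
    show "(\<lambda>x. \<bar>p x\<bar>) \<in> borel_measurable lebesgue"
      using borel_measurable_loc_integrable[OF p] by (rule borel_measurable_abs)
  qed simp
  have u: "loc_integrable u"
    unfolding u_def using v b by (rule loc_integrable_add)
  have \<gamma>: "loc_integrable \<gamma>"
    unfolding \<gamma>_def by (intro loc_integrable_add loc_integrable_cmult v b abs_p)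
  note \<alpha>\<beta> = loc_integrable_stress[OF state]
  have rad: "0 \<le> (y \<bullet> x)\<^sup>2 / (norm x)\<^sup>2" "(y \<bullet> x)\<^sup>2 / (norm x)\<^sup>2 \<le> (norm y)\<^sup>2" for x y :: "real ^ 'n"
  proof -
    have "(y \<bullet> x)\<^sup>2 \<le> (norm y)\<^sup>2 * (norm x)\<^sup>2"
      using power_mono[OF Cauchy_Schwarz_ineq2[of y x], of 2] by (simp add: power_mult_distrib)
    then show "(y \<bullet> x)\<^sup>2 / (norm x)\<^sup>2 \<le> (norm y)\<^sup>2"
      by (cases "x = 0") (simp_all add: divide_le_eq)
  qed simp
  have \<beta>_eq: "?\<beta> x = (norm x)\<^sup>2 * ((v x \<bullet> x)\<^sup>2 / (norm x)\<^sup>2 - (b x \<bullet> x)\<^sup>2 / (norm x)\<^sup>2 + (p x + (norm (b x))\<^sup>2 / 2))" for x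
    by (cases "x = 0") (simp_all add: stress_radial_def field_simps)
  have \<beta>\<gamma>: "\<bar>?\<beta> x\<bar> \<le> (norm x)\<^sup>2 * \<gamma> x" for x
  proof -
    have "\<bar>(v x \<bullet> x)\<^sup>2 / (norm x)\<^sup>2 - (b x \<bullet> x)\<^sup>2 / (norm x)\<^sup>2 + (p x + (norm (b x))\<^sup>2 / 2)\<bar> \<le> \<gamma> x"
      using rad[of "v x" x] rad[of "b x" x] zero_le_power2[of "norm (b x)"] unfolding \<gamma>_def by linarith
    then show ?thesis
      unfolding \<beta>_eq abs_mult by (simp add: mult_left_mono)
  qed
  let ?C = "w 0 + ?c * ?n / R ^ ?N"
  have c0: "?c \<ge> 0" by (rule outer_coeff_nonneg[OF prof])
  have C0: "?C \<ge> 0" using w_pos[of 0] c0 RL' by (simp add: less_imp_le)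
  have "balances ?\<alpha> ?\<beta> ?\<kappa>"
  proof (rule balances_singular_profile[OF \<alpha>\<beta> \<gamma> \<beta>\<gamma> grid])
    show "?\<kappa> \<in> borel_measurable borel" by (rule half_sq_slope_borel[OF prof])
    show "\<bar>?\<kappa> \<sigma>\<bar> \<le> ?C / \<sigma> * indicator {..L\<^sup>2 / 2} \<sigma>" if "\<sigma> > 0" for \<sigma>
      by (rule profile_slope_bound[OF prof that])
    show "\<bar>tail ?\<kappa> s\<bar> \<le> w 0" if "s > 0" for s
      using profile_bounds[OF prof, of "sqrt (2 * s)"] that by (simp add: tail_profile[OF prof that])
    show "countable ((\<lambda>r. r\<^sup>2 / 2) ` ({r. \<not> isCont w r} \<union> {R, L}))"
      using weight_discontinuities[OF w_anti w_pos] by simp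
    show "isCont ?\<kappa> \<sigma>" if "\<sigma> > 0" "\<sigma> \<notin> (\<lambda>r. r\<^sup>2 / 2) ` ({r. \<not> isCont w r} \<union> {R, L})" for \<sigma>
      by (rule half_sq_slope_continuous[OF prof that])
  qed (use C0 in auto)
  then have balance: "(LINT x|lebesgue. tail ?\<kappa> (x \<bullet> x / 2) * ?\<alpha> x) = (LINT x|lebesgue. ?\<kappa> (x \<bullet> x / 2) * ?\<beta> x)"
    unfolding balances_def .
  have sq: "sqrt (2 * (x \<bullet> x / 2)) = norm x" for x :: "real ^ 'n"
    by (simp add: norm_eq_sqrt_inner)
  \<comment> \<open>At the origin the integral that defines the tail need not exist.\<close>
  have nonzero: "AE x :: real ^ 'n in lebesgue. x \<noteq> 0"
    by (rule eventually_mono[OF AE_half_norm_sq_notin_countable[of "{0}"]]) auto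
  have P_meas: "?P \<in> borel_measurable lebesgue"
  proof (rule borel_measurable_norm_comp)
    have [measurable]: "cumul w \<in> borel_measurable borel" by (rule cumul_borel[OF w_anti w_pos])
    show "profile w ?N R L \<in> borel_measurable borel"
      unfolding profile_def[abs_def] by measurable
  qed
  have K_meas: "?K \<in> borel_measurable lebesgue"
    by (intro borel_measurable_norm_comp profile_slope_borel[OF prof])
  note meas = borel_measurable_loc_integrable[OF \<alpha>\<beta>(1)] borel_measurable_loc_integrable[OF \<alpha>\<beta>(2)]
  have "(LINT x|lebesgue. tail ?\<kappa> (x \<bullet> x / 2) * ?\<alpha> x) = (LINT x|lebesgue. ?P x * ?\<alpha> x)"
  proof (rule integral_cong_AE)
    show "(\<lambda>x. tail ?\<kappa> (x \<bullet> x / 2) * ?\<alpha> x) \<in> borel_measurable lebesgue"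
      by (intro borel_measurable_times meas borel_measurable_radial borel_measurable_tail half_sq_slope_borel[OF prof])
    show "(\<lambda>x. ?P x * ?\<alpha> x) \<in> borel_measurable lebesgue"
      by (intro borel_measurable_times meas P_meas)
    show "AE x in lebesgue. tail ?\<kappa> (x \<bullet> x / 2) * ?\<alpha> x = ?P x * ?\<alpha> x"
      using nonzero
    proof eventually_elim
      case (elim x)
      have "tail ?\<kappa> (x \<bullet> x / 2) = profile w ?N R L (sqrt (2 * (x \<bullet> x / 2)))"
        using elim by (intro tail_profile[OF prof]) simp
      then show ?case by (simp only: sq)
    qed
  qed
  with balance have balance': "(LINT x|lebesgue. ?P x * ?\<alpha> x) = (LINT x|lebesgue. ?K x * ?\<beta> x)"
    by (simp only: sq)
  have int_P: "integrable lebesgue (\<lambda>x. ?P x * ?\<alpha> x)"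
  proof (rule integrable_cutoff_mult[OF \<alpha>\<beta>(1) P_meas])
    show "\<bar>?P x\<bar> \<le> w 0 * indicator (cball 0 L) x" for x
    proof (cases "x = 0")
      case True
      then show ?thesis using w_pos[of 0] RL' by (simp add: profile_def)
    next
      case False
      show ?thesis
      proof (cases "norm x < L")
        case True
        then show ?thesis using profile_bounds[OF prof, of "norm x"] False by simp
      next
        case False
        then show ?thesis using w_pos[of 0] RL' by (simp add: profile_def)
      qed
    qed
  qed
  have int_K: "integrable lebesgue (\<lambda>x. ?K x * ?\<beta> x)"
  proof (rule Bochner_Integration.integrable_bound)
    have "(\<lambda>x :: real ^ 'n. (norm x)\<^sup>2) \<in> borel_measurable lebesgue"
      by (intro borel_measurable_norm_comp[of "\<lambda>r. r\<^sup>2"]) simp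
    then have meas': "(\<lambda>x. ?K x * (norm x)\<^sup>2) \<in> borel_measurable lebesgue"
      by (intro borel_measurable_times K_meas)
    show "integrable lebesgue (\<lambda>x. (?K x * (norm x)\<^sup>2) * \<gamma> x)"
    proof (rule integrable_cutoff_mult[OF \<gamma> meas'])
      show "\<bar>?K x * (norm x)\<^sup>2\<bar> \<le> 2 * ?C * indicator (cball 0 (sqrt (2 * (L\<^sup>2 / 2)))) x" for x
      proof (cases "x = 0")
        case False
        then have pos: "x \<bullet> x / 2 > 0" by simp
        have "\<bar>?K x * (norm x)\<^sup>2\<bar> = \<bar>?\<kappa> (x \<bullet> x / 2)\<bar> * (2 * (x \<bullet> x / 2))"
          unfolding sq power2_norm_eq_inner abs_mult by simp
        also have "\<dots> \<le> (?C / (x \<bullet> x / 2) * indicator {..L\<^sup>2 / 2} (x \<bullet> x / 2)) * (2 * (x \<bullet> x / 2))"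
          using pos by (intro mult_right_mono profile_slope_bound[OF prof pos]) simp
        also have "\<dots> = 2 * ?C * indicator {..L\<^sup>2 / 2} (x \<bullet> x / 2)"
          using False by simp
        also have "\<dots> \<le> 2 * ?C * indicator (cball 0 (sqrt (2 * (L\<^sup>2 / 2)))) x"
          using C0 by (intro mult_left_mono radial_indicator_le) simp
        finally show ?thesis .
      qed (use C0 in simp)
    qed
    show "(\<lambda>x. ?K x * ?\<beta> x) \<in> borel_measurable lebesgue"
      by (intro borel_measurable_times meas K_meas)
    show "AE x in lebesgue. norm (?K x * ?\<beta> x) \<le> norm ((?K x * (norm x)\<^sup>2) * \<gamma> x)"
    proof (rule AE_I2)
      fix x
      have "\<bar>?K x\<bar> * \<bar>?\<beta> x\<bar> \<le> \<bar>?K x\<bar> * ((norm x)\<^sup>2 * \<bar>\<gamma> x\<bar>)"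
        by (intro mult_left_mono order_trans[OF \<beta>\<gamma>]) auto
      then show "norm (?K x * ?\<beta> x) \<le> norm ((?K x * (norm x)\<^sup>2) * \<gamma> x)"
        by (simp add: abs_mult mult.assoc)
    qed
  qed
  \<comment> \<open>The weighted pressure and energy inside radius \<open>R\<close>, the energy outside, and the pressure inside radius \<open>L\<close>.\<close>
  define X1 where "X1 x = indicator (ball 0 R) x * (p x * pressure_weight w x)" for x
  define X2 where "X2 x = indicator (ball 0 R) x * (w (norm x) * u x)" for x
  define X3 where "X3 x = indicator (- ball 0 R) x * (u x / (1 + norm x))" for x
  define X4 where "X4 x = indicator (cball 0 L) x * \<bar>p x\<bar>" for x
  have int_ball: "integrable lebesgue (\<lambda>x. indicator (ball 0 R) x * f x)" if "loc_integrable f" for f :: "real ^ 'n \<Rightarrow> real"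
  proof (rule integrable_cutoff_mult[OF that, where C = 1 and R = R])
    show "indicator (ball 0 R) \<in> borel_measurable lebesgue"
      by (intro borel_measurable_indicator) simp
  qed (auto simp: indicator_def)
  have X: "integrable lebesgue X1" "integrable lebesgue X2" "integrable lebesgue X3" "integrable lebesgue X4"
  proof -
    show "integrable lebesgue X1" unfolding X1_def
      by (intro int_ball loc_integrable_pressure_weight p)
    show "integrable lebesgue X2" unfolding X2_def
      by (intro int_ball loc_integrable_w_mult u)
    show "integrable lebesgue X3" unfolding X3_def u_def
      using integrable_mult_indicator[OF _ decay, of "- ball 0 R"] by simp
    show "integrable lebesgue X4" unfolding X4_def
      using abs_p by (simp add: loc_integrable_def)
  qed
  have c_le: "?c \<le> 2 * M * R ^ ?N / R"
  proof -
    have "?c \<le> 2 * cumul w R * R ^ ?N / R"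
      by (rule outer_coeff_le[OF w_anti w_pos RL'(1) RL(2) N])
    also have "\<dots> \<le> 2 * M * R ^ ?N / R"
      using M[of R] RL' by (intro divide_right_mono mult_right_mono mult_left_mono) auto
    finally show ?thesis .
  qed
  have pointwise: "X1 x + X2 x / 2 - 4 * ?n * M * X3 x - 2 * ?n * M * R ^ ?N / R * (X4 x / L ^ ?N)
      \<le> ?P x * ?\<alpha> x - ?K x * ?\<beta> x" if "x \<noteq> 0" for x
  proof -
    define r where "r = norm x"
    define a d where "a = (v x \<bullet> x)\<^sup>2 / r\<^sup>2" and "d = (b x \<bullet> x)\<^sup>2 / r\<^sup>2"
    have r: "r > 0" using that by (simp add: r_def)
    have ad: "0 \<le> a" "a \<le> (norm (v x))\<^sup>2" "0 \<le> d" "d \<le> (norm (b x))\<^sup>2"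
      using rad[of "v x" x] rad[of "b x" x] by (simp_all add: a_def d_def r_def)
    have \<beta>: "?\<beta> x = r\<^sup>2 * (a - d + (p x + (norm (b x))\<^sup>2 / 2))"
      unfolding \<beta>_eq a_def d_def r_def ..
    have \<alpha>: "?\<alpha> x = (norm (v x))\<^sup>2 - (norm (b x))\<^sup>2 + ?n * (p x + (norm (b x))\<^sup>2 / 2)"
      by (simp add: stress_trace_def)
    have X4: "0 \<le> 2 * ?n * M * R ^ ?N / R * (X4 x / L ^ ?N)"
      using M0 RL' by (simp add: X4_def)
    have u0: "u x \<ge> 0" by (simp add: u_def)
    consider "r < R" | "R \<le> r" "r < L" | "L \<le> r" by linarith
    then show ?thesis
    proof cases
      case 1
      have "w r \<le> cumul w r / r"
        using cumul_bounds(1)[OF w_anti w_pos, of r] r by (simp add: field_simps)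
      from inner_integrand_bound[OF less_imp_le[OF w_pos] this _ ad(2,1,4,3), of ?n "p x"]
      have "p x * pressure_weight w x + w r * u x / 2 \<le> cumul w r / r * ?\<alpha> x
          - (cumul w r / r - w r) * (a - d + (p x + (norm (b x))\<^sup>2 / 2))"
        using card unfolding \<alpha> u_def pressure_weight_def r_def by simp
      also have "\<dots> = ?P x * ?\<alpha> x - ?K x * ?\<beta> x"
        unfolding \<beta> using 1 r by (simp add: profile_def profile_slope_def r_def)
      finally show ?thesis
        using 1 X4 by (simp add: X1_def X2_def X3_def r_def)
    next
      case 2
      have rho: "1 / L ^ ?N \<le> 1 / r ^ ?N"
        using 2 r by (intro divide_left_mono power_mono) auto
      from outer_integrand_bound[OF c0 _ rho _ ad(2,1,4,3), of ?n "p x"]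
      have "- (?c * ?n * (1 / r ^ ?N) * u x) - ?c * ?n * (1 / L ^ ?N) * \<bar>p x\<bar>
          \<le> ?c * (1 / r ^ ?N - 1 / L ^ ?N) * ?\<alpha> x - ?c * ?n * (1 / r ^ ?N) * (a - d + (p x + (norm (b x))\<^sup>2 / 2))"
        using card RL' unfolding \<alpha> u_def by simp
      also have "\<dots> = ?P x * ?\<alpha> x - ?K x * ?\<beta> x"
        unfolding \<beta> using 2 r RL' by (simp add: profile_def profile_slope_def r_def power_add power2_eq_square)
      finally have lower: "- (?c * ?n * (1 / r ^ ?N) * u x) - ?c * ?n * (1 / L ^ ?N) * \<bar>p x\<bar> \<le> ?P x * ?\<alpha> x - ?K x * ?\<beta> x" .
      have "?c * ?n * (1 / L ^ ?N) * \<bar>p x\<bar> \<le> (2 * M * R ^ ?N / R) * ?n * (1 / L ^ ?N) * \<bar>p x\<bar>"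
        using RL' by (intro mult_right_mono c_le) auto
      also have "\<dots> = 2 * ?n * M * R ^ ?N / R * (X4 x / L ^ ?N)"
        using 2 by (simp add: X4_def r_def)
      finally have e1: "?c * ?n * (1 / L ^ ?N) * \<bar>p x\<bar> \<le> 2 * ?n * M * R ^ ?N / R * (X4 x / L ^ ?N)" .
      have "?c * (1 / r ^ ?N) \<le> 4 * M * (1 / (1 + r))"
      proof -
        obtain k where k: "?N = Suc k" using N by (cases "?N") auto
        have "?c * (1 / r ^ ?N) \<le> (2 * M * R ^ ?N / R) * (1 / r ^ ?N)"
          using r by (intro mult_right_mono c_le) auto
        also have "\<dots> = 2 * M * (R ^ k / r ^ k) * (1 / r)"
          unfolding k using RL' by (simp add: mult_ac)
        also have "\<dots> \<le> 2 * M * 1 * (1 / r)"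
          using 2 RL' r M0 by (intro mult_right_mono mult_left_mono) (auto intro!: power_mono)
        also have "\<dots> \<le> 2 * M * 1 * (2 / (1 + r))"
          using 2 RL r M0 by (intro mult_left_mono) (auto simp: field_simps)
        finally show ?thesis by simp
      qed
      then have "?c * (1 / r ^ ?N) * (?n * u x) \<le> 4 * M * (1 / (1 + r)) * (?n * u x)"
        using u0 by (intro mult_right_mono) auto
      also have "\<dots> = 4 * ?n * M * X3 x"
        using 2 by (simp add: X3_def r_def)
      finally have e2: "?c * ?n * (1 / r ^ ?N) * u x \<le> 4 * ?n * M * X3 x"
        by (simp add: mult_ac)
      have "X1 x = 0" "X2 x = 0"
        using 2 by (simp_all add: X1_def X2_def r_def)
      with lower e1 e2 show ?thesis by linarith
    next
      case 3
      have "X1 x = 0" "X2 x = 0" "?P x = 0" "?K x = 0"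
        using 3 RL' by (simp_all add: X1_def X2_def r_def profile_def profile_slope_def)
      moreover have "0 \<le> 4 * ?n * M * X3 x"
        using M0 u0 by (simp add: X3_def)
      moreover from calculation have "?P x * ?\<alpha> x - ?K x * ?\<beta> x = 0" by simp
      ultimately show ?thesis using X4 by linarith
    qed
  qed
  have "(LINT x|lebesgue. X1 x + X2 x / 2 - 4 * ?n * M * X3 x - 2 * ?n * M * R ^ ?N / R * (X4 x / L ^ ?N))
      \<le> (LINT x|lebesgue. ?P x * ?\<alpha> x - ?K x * ?\<beta> x)"
  proof (rule integral_mono_AE)
    show "AE x in lebesgue. X1 x + X2 x / 2 - 4 * ?n * M * X3 x - 2 * ?n * M * R ^ ?N / R * (X4 x / L ^ ?N)
        \<le> ?P x * ?\<alpha> x - ?K x * ?\<beta> x"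
      using nonzero by (rule eventually_mono) (rule pointwise)
  qed (use X int_P int_K in auto)
  also have "\<dots> = 0"
    using int_P int_K balance' by simp
  also have "(LINT x|lebesgue. X1 x + X2 x / 2 - 4 * ?n * M * X3 x - 2 * ?n * M * R ^ ?N / R * (X4 x / L ^ ?N))
      = (LINT x|lebesgue. X1 x) + (LINT x|lebesgue. X2 x) / 2 - 4 * ?n * M * (LINT x|lebesgue. X3 x)
        - 2 * ?n * M * R ^ ?N / R * ((LINT x|lebesgue. X4 x) / L ^ ?N)"
    using X by simp
  finally show ?thesis
    unfolding X1_def X2_def X3_def X4_def u_def by linarith
qed

end

section \<open>Decay at infinity\<close>

text \<open>On the dyadic shell \<open>2\<^sup>j \<le> 1 + \<bar>x\<bar> < 2\<^sup>j\<^sup>+\<^sup>1\<close> the function is at most \<open>2\<^sup>-\<^sup>j\<^sup>s\<close>, and the volume of the shell is at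
  most a multiple of \<open>2\<^sup>j\<^sup>N\<close>, so the integral is dominated by a geometric series.\<close>

lemma integrable_power_decay:
  assumes s: "s > real CARD('n)"
  shows "integrable lebesgue (\<lambda>x :: real ^ 'n::finite. (1 + norm x) powr (- s))"
proof -
  let ?N = "CARD('n)"
  define a where "a j = (2 ^ j) powr (- s)" for j :: nat
  have meas: "(\<lambda>x :: real ^ 'n. (1 + norm x) powr (- s)) \<in> borel_measurable lborel"
    by measurable
  have term_le: "ennreal ((1 + norm x) powr (- s)) \<le> (\<Sum>j. ennreal (a j) * indicator (cball 0 (2 ^ Suc j)) x)" for x :: "real ^ 'n"
  proof -
    define j where "j = nat \<lfloor>log 2 (1 + norm x)\<rfloor>"
    have log: "0 \<le> log 2 (1 + norm x)"
      by (subst zero_le_log_cancel_iff) (auto simp: add_pos_nonneg)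
    have "real j \<le> log 2 (1 + norm x)" "log 2 (1 + norm x) < real j + 1"
      unfolding j_def using log by linarith+
    then have "2 powr real j \<le> 1 + norm x" "1 + norm x < 2 powr (real j + 1)"
      by (simp_all add: le_log_iff log_less_iff add_pos_nonneg)
    then have j: "2 ^ j \<le> 1 + norm x" "1 + norm x < 2 ^ Suc j"
      by (simp_all add: powr_realpow powr_add)
    have "ennreal ((1 + norm x) powr (- s)) \<le> ennreal (a j) * indicator (cball 0 (2 ^ Suc j)) x"
    proof -
      have "(1 + norm x) powr (- s) \<le> a j"
        unfolding a_def using j s by (intro powr_mono2') auto
      moreover have "x \<in> cball 0 (2 ^ Suc j)" using j by simp
      ultimately show ?thesis by (simp add: ennreal_leI)
    qed
    also have "\<dots> \<le> (\<Sum>j. ennreal (a j) * indicator (cball 0 (2 ^ Suc j)) x)"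
    proof -
      have "f j \<le> suminf f" for f :: "nat \<Rightarrow> ennreal"
        using sum_le_suminf[of f "{j}"] by simp
      then show ?thesis .
    qed
    finally show ?thesis .
  qed
  have "(\<integral>\<^sup>+ x. ennreal ((1 + norm x) powr (- s)) \<partial>(lborel :: (real ^ 'n) measure))
      \<le> (\<integral>\<^sup>+ x. (\<Sum>j. ennreal (a j) * indicator (cball 0 (2 ^ Suc j)) x) \<partial>(lborel :: (real ^ 'n) measure))"
    by (intro nn_integral_mono term_le)
  also have "\<dots> = (\<Sum>j. \<integral>\<^sup>+ x. ennreal (a j) * indicator (cball 0 (2 ^ Suc j)) x \<partial>(lborel :: (real ^ 'n) measure))"
    by (rule nn_integral_suminf)
       (intro borel_measurable_times_ennreal borel_measurable_const borel_measurable_indicator, simp)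
  also have "\<dots> = (\<Sum>j. ennreal (unit_ball_vol (real ?N) * 2 ^ ?N * (2 powr (real ?N - s)) ^ j))"
  proof (intro suminf_cong)
    fix j
    have "(\<integral>\<^sup>+ x. ennreal (a j) * indicator (cball 0 (2 ^ Suc j)) x \<partial>(lborel :: (real ^ 'n) measure))
        = ennreal (a j * (unit_ball_vol (real ?N) * (2 ^ Suc j) ^ ?N))"
      by (subst nn_integral_cmult_indicator) (simp_all add: emeasure_cball ennreal_mult a_def)
    also have "a j * (unit_ball_vol (real ?N) * (2 ^ Suc j) ^ ?N) = unit_ball_vol (real ?N) * 2 ^ ?N * (2 powr (real ?N - s)) ^ j"
    proof -
      have "a j = (2 powr (- s)) ^ j"
      proof -
        have "a j = (2 powr real j) powr (- s)"
          unfolding a_def by (simp only: powr_realpow[of 2 j] zero_less_numeral)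
        also have "\<dots> = (2 powr (- s)) powr real j"
          by (simp only: powr_powr mult.commute)
        also have "\<dots> = (2 powr (- s)) ^ j"
          by (rule powr_realpow) simp
        finally show ?thesis .
      qed
      moreover have "(2 ^ Suc j) ^ ?N = 2 ^ ?N * (2 powr real ?N) ^ j"
      proof -
        have "(2 ^ Suc j) ^ ?N = (2 :: real) ^ (?N + ?N * j)"
          by (simp only: power_mult[symmetric] mult_Suc mult.commute[of j])
        also have "\<dots> = 2 ^ ?N * (2 ^ ?N) ^ j"
          by (simp only: power_add power_mult)
        finally show ?thesis by (simp add: powr_realpow)
      qed
      moreover have "2 powr (real ?N - s) = 2 powr real ?N * 2 powr (- s)"
        by (simp flip: powr_add)
      ultimately show ?thesis by (simp add: power_mult_distrib)
    qed
    finally show "(\<integral>\<^sup>+ x. ennreal (a j) * indicator (cball 0 (2 ^ Suc j)) x \<partial>(lborel :: (real ^ 'n) measure))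
        = ennreal (unit_ball_vol (real ?N) * 2 ^ ?N * (2 powr (real ?N - s)) ^ j)" .
  qed
  also have "\<dots> < \<infinity>"
  proof -
    have "2 powr (real ?N - s) < 2 powr 0"
      using s by (intro powr_less_mono) auto
    then have "summable (\<lambda>j. unit_ball_vol (real ?N) * 2 ^ ?N * (2 powr (real ?N - s)) ^ j)"
      by (intro summable_mult summable_geometric) simp
    then show ?thesis
      by (subst suminf_ennreal2) auto
  qed
  finally have "integrable lborel (\<lambda>x :: real ^ 'n. (1 + norm x) powr (- s))"
    using meas by (intro integrableI_nonneg) auto
  then show ?thesis
    using meas by (simp add: integrable_completion)
qed

text \<open>Young's inequality with exponents \<open>q/2\<close> and \<open>q/(q - 2)\<close>, without the optimal constants.\<close>

lemma square_mult_le_powr_add: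
  fixes a Y q :: real
  assumes "0 \<le> a" "0 < Y" "q > 2"
  shows "a\<^sup>2 * Y \<le> a powr q + Y powr (q / (q - 2))"
proof (cases "Y \<le> a powr (q - 2)")
  case True
  have "a\<^sup>2 * Y \<le> a\<^sup>2 * a powr (q - 2)"
    using True by (intro mult_left_mono) auto
  also have "\<dots> = a powr q"
  proof (cases "a = 0")
    case False
    then have "a powr 2 * a powr (q - 2) = a powr q"
      by (subst powr_add[symmetric]) simp
    with assms(1) show ?thesis by simp
  qed (use assms in simp)
  finally show ?thesis by (simp add: add_increasing2)
next
  case False
  then have "a powr (q - 2) \<le> Y" by simp
  then have "(a powr (q - 2)) powr (2 / (q - 2)) \<le> Y powr (2 / (q - 2))"
    using assms by (intro powr_mono2) auto
  moreover have "(q - 2) * (2 / (q - 2)) = 2"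
  proof -
    have "d * (2 / d) = 2" if "d > 0" for d :: real
      using that by simp
    then show ?thesis using assms(3) diff_gt_0_iff_gt by blast
  qed
  ultimately have "a powr 2 \<le> Y powr (2 / (q - 2))"
    by (simp only: powr_powr)
  then have "a\<^sup>2 \<le> Y powr (2 / (q - 2))"
    using assms by simp
  then have "a\<^sup>2 * Y \<le> Y powr (2 / (q - 2)) * Y powr 1"
    using assms by (simp add: mult_right_mono)
  also have "\<dots> = Y powr (2 / (q - 2) + 1)"
    by (rule powr_add[symmetric])
  also have "2 / (q - 2) + 1 = q / (q - 2)"
    using assms by (simp add: field_simps)
  finally show ?thesis by (simp add: add_increasing)
qed

lemma weighted_energy_integrable_of_Lq:
  fixes v b :: "real ^ 'n::finite \<Rightarrow> real ^ 'n"
  assumes card: "CARD('n) \<ge> 2" and meas: "v \<in> borel_measurable lebesgue" "b \<in> borel_measurable lebesgue"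
    and Lq: "in_L q UNIV (\<lambda>x. norm (v x) + norm (b x))"
    and q: "2 < q" "q < 2 * real CARD('n) / (real CARD('n) - 1)"
  shows "integrable lebesgue (\<lambda>x. ((norm (v x))\<^sup>2 + (norm (b x))\<^sup>2) / (1 + norm x))"
proof (rule Bochner_Integration.integrable_bound)
  let ?s = "q / (q - 2)"
  have "q * (real CARD('n) - 1) < 2 * real CARD('n)"
    using q(2) card by (simp add: less_divide_eq)
  then have "real CARD('n) < ?s"
    using q(1) by (simp add: less_divide_eq algebra_simps)
  then have "integrable lebesgue (\<lambda>x :: real ^ 'n. (1 + norm x) powr (- ?s))"
    by (rule integrable_power_decay)
  moreover have "integrable lebesgue (\<lambda>x. (norm (v x) + norm (b x)) powr q)"
    using Lq by (simp add: in_L_def lebesgue_on_UNIV_eq)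
  ultimately show "integrable lebesgue (\<lambda>x. (norm (v x) + norm (b x)) powr q + (1 + norm x) powr (- ?s))"
    by (intro Bochner_Integration.integrable_add)
  have "(\<lambda>x :: real ^ 'n. 1 + norm x) \<in> borel_measurable lebesgue"
    by (intro borel_measurable_lebesgueI) simp
  note den = this
  show "(\<lambda>x. ((norm (v x))\<^sup>2 + (norm (b x))\<^sup>2) / (1 + norm x)) \<in> borel_measurable lebesgue"
    by (intro borel_measurable_divide[OF _ den] borel_measurable_add borel_measurable_power
        measurable_compose[OF _ borel_measurable_norm] meas)
  show "AE x in lebesgue. norm (((norm (v x))\<^sup>2 + (norm (b x))\<^sup>2) / (1 + norm x))
      \<le> norm ((norm (v x) + norm (b x)) powr q + (1 + norm x) powr (- ?s))"
  proof (rule AE_I2)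
    fix x :: "real ^ 'n"
    have pos: "1 + norm x > 0" by (simp add: add_pos_nonneg)
    have "(norm (v x))\<^sup>2 + (norm (b x))\<^sup>2 \<le> (norm (v x) + norm (b x))\<^sup>2"
      by (simp add: power2_sum)
    then have "((norm (v x))\<^sup>2 + (norm (b x))\<^sup>2) / (1 + norm x) \<le> (norm (v x) + norm (b x))\<^sup>2 * (1 / (1 + norm x))"
      using pos by (simp add: divide_right_mono)
    also have "\<dots> \<le> (norm (v x) + norm (b x)) powr q + (1 / (1 + norm x)) powr ?s"
      using q pos by (intro square_mult_le_powr_add) auto
    also have "(1 / (1 + norm x)) powr ?s = (1 + norm x) powr (- ?s)"
      using pos by (simp add: powr_minus powr_divide inverse_eq_divide)
    finally show "norm (((norm (v x))\<^sup>2 + (norm (b x))\<^sup>2) / (1 + norm x))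
        \<le> norm ((norm (v x) + norm (b x)) powr q + (1 + norm x) powr (- ?s))"
      using pos by simp
  qed
qed

lemma pressure_mean_tendsto_0_weighted:
  fixes p :: "real ^ 'n::finite \<Rightarrow> real"
  assumes p: "loc_integrable p" and int: "integrable lebesgue (\<lambda>x. \<bar>p x\<bar> / (1 + norm x))" and card: "CARD('n) \<ge> 2"
  shows "(\<lambda>n. (LINT x|lebesgue. indicator (cball 0 (real n)) x * \<bar>p x\<bar>) / real n ^ CARD('n)) \<longlonglongrightarrow> 0"
proof -
  let ?I = "\<lambda>n. LINT x|lebesgue. indicator (cball 0 (real n)) x * \<bar>p x\<bar>" and ?N = "CARD('n)"
  define A where "A = (LINT x|lebesgue. \<bar>p x\<bar> / (1 + norm x))"
  have A: "A \<ge> 0" unfolding A_def by (intro integral_nonneg_AE) auto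
  have I: "?I n \<le> (1 + real n) * A" for n
  proof -
    have "?I n \<le> (LINT x|lebesgue. (1 + real n) * (\<bar>p x\<bar> / (1 + norm x)))"
    proof (rule integral_mono)
      show "integrable lebesgue (\<lambda>x. indicator (cball 0 (real n)) x * \<bar>p x\<bar>)"
        using integrable_abs[of lebesgue "\<lambda>x. indicator (cball 0 (real n)) x * p x"] p
        by (simp add: loc_integrable_def abs_mult)
      show "integrable lebesgue (\<lambda>x. (1 + real n) * (\<bar>p x\<bar> / (1 + norm x)))"
        using int by (rule integrable_mult_right)
      fix x :: "real ^ 'n"
      have pos: "1 + norm x > 0" by (simp add: add_pos_nonneg)
      show "indicator (cball 0 (real n)) x * \<bar>p x\<bar> \<le> (1 + real n) * (\<bar>p x\<bar> / (1 + norm x))"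
      proof (cases "norm x \<le> real n")
        case True
        then have "\<bar>p x\<bar> * (1 + norm x) \<le> (1 + real n) * \<bar>p x\<bar>"
          by (subst mult.commute) (intro mult_right_mono, auto)
        with True pos show ?thesis by (simp add: pos_le_divide_eq)
      qed simp
    qed
    then show ?thesis unfolding integral_mult_right_zero A_def[symmetric] .
  qed
  show ?thesis
  proof (rule real_tendsto_sandwich)
    show "\<forall>\<^sub>F n in sequentially. 0 \<le> ?I n / real n ^ ?N"
      by (intro always_eventually allI divide_nonneg_nonneg integral_nonneg_AE) auto
    show "\<forall>\<^sub>F n in sequentially. ?I n / real n ^ ?N \<le> 2 * A * inverse (real n)"
      using eventually_ge_at_top[of 1]
    proof eventually_elim
      case (elim n)
      then have n: "real n \<ge> 1" by simp
      have "real n ^ 2 \<le> real n ^ ?N" using n card by (intro power_increasing) auto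
      have "?I n / real n ^ ?N \<le> ((1 + real n) * A) / real n ^ ?N"
        using I n by (intro divide_right_mono) auto
      also have "\<dots> \<le> (2 * real n * A) / real n ^ ?N"
        using n A by (intro divide_right_mono mult_right_mono) auto
      also have "\<dots> \<le> (2 * real n * A) / real n ^ 2"
        using n A \<open>real n ^ 2 \<le> real n ^ ?N\<close> by (intro divide_left_mono) auto
      also have "\<dots> = 2 * A * inverse (real n)"
        using n by (simp add: field_simps power2_eq_square)
      finally show ?case .
    qed
    have "(\<lambda>n. 2 * A * inverse (real n)) \<longlonglongrightarrow> 2 * A * 0"
      by (intro tendsto_intros lim_inverse_n)
    then show "(\<lambda>n. 2 * A * inverse (real n)) \<longlonglongrightarrow> 0" by simp
  qed simp
qed

text \<open>Outside a fixed ball \<open>\<bar>p\<bar> < \<epsilon>\<close>, which contributes at most \<open>\<epsilon>\<close> times the volume of the unit ball to the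
  quotient; the fixed ball contributes a constant divided by \<open>n\<^sup>N\<close>.\<close>

lemma pressure_mean_tendsto_0_decay:
  fixes p :: "real ^ 'n::finite \<Rightarrow> real"
  assumes p: "loc_integrable p"
    and decay: "\<forall>\<epsilon>>0. \<exists>R. AE x in lebesgue. norm x > R \<longrightarrow> \<bar>p x\<bar> < \<epsilon>"
  shows "(\<lambda>n. (LINT x|lebesgue. indicator (cball 0 (real n)) x * \<bar>p x\<bar>) / real n ^ CARD('n)) \<longlonglongrightarrow> 0"
proof -
  let ?N = "CARD('n)"
  define V where "V = unit_ball_vol (real ?N)"
  have V: "V \<ge> 0" by (simp add: V_def)
  have int: "integrable lebesgue (\<lambda>x. indicator (cball 0 R) x * \<bar>p x\<bar>)" for R
    using integrable_abs[of lebesgue "\<lambda>x. indicator (cball 0 R) x * p x"] p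
    by (simp add: loc_integrable_def abs_mult)
  show ?thesis
  proof (rule LIMSEQ_I)
    fix e :: real
    assume e: "e > 0"
    define \<epsilon> where "\<epsilon> = e / 2 / (V + 1)"
    have \<epsilon>: "\<epsilon> > 0" using e V by (simp add: \<epsilon>_def)
    obtain R where R: "AE x in lebesgue. norm x > R \<longrightarrow> \<bar>p x\<bar> < \<epsilon>"
      using decay[rule_format, OF \<epsilon>] by (elim exE)
    define A where "A = (LINT x|lebesgue. indicator (cball 0 R) x * \<bar>p x\<bar>)"
    have A: "A \<ge> 0" unfolding A_def by (intro integral_nonneg_AE) auto
    have bound: "(LINT x|lebesgue. indicator (cball 0 (real n)) x * \<bar>p x\<bar>) \<le> A + \<epsilon> * (V * real n ^ ?N)" for n
    proof -
      have ball: "integrable lebesgue (indicator (cball 0 (real n)) :: real ^ 'n \<Rightarrow> real)"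
        by (simp add: integrable_indicator_iff emeasure_cball)
      have "(LINT x|lebesgue. indicator (cball 0 (real n)) x * \<bar>p x\<bar>)
          \<le> (LINT x|lebesgue. indicator (cball 0 R) x * \<bar>p x\<bar> + \<epsilon> * indicator (cball 0 (real n)) x)"
      proof (rule integral_mono_AE[OF int])
        show "integrable lebesgue (\<lambda>x. indicator (cball 0 R) x * \<bar>p x\<bar> + \<epsilon> * indicator (cball 0 (real n)) x)"
          using int ball by (intro Bochner_Integration.integrable_add integrable_mult_right)
        show "AE x in lebesgue. indicator (cball 0 (real n)) x * \<bar>p x\<bar> \<le> indicator (cball 0 R) x * \<bar>p x\<bar> + \<epsilon> * indicator (cball 0 (real n)) x"
          using R
        proof (rule eventually_mono)
          fix x :: "real ^ 'n"
          assume "R < norm x \<longrightarrow> \<bar>p x\<bar> < \<epsilon>"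
          then show "indicator (cball 0 (real n)) x * \<bar>p x\<bar> \<le> indicator (cball 0 R) x * \<bar>p x\<bar> + \<epsilon> * indicator (cball 0 (real n)) x"
            using \<epsilon> by (cases "norm x \<le> R"; cases "norm x \<le> real n") simp_all
        qed
      qed
      also have "\<dots> = A + \<epsilon> * measure lebesgue (cball (0 :: real ^ 'n) (real n))"
        using int ball by (simp add: A_def)
      also have "measure lebesgue (cball (0 :: real ^ 'n) (real n)) = V * real n ^ ?N"
        by (simp add: V_def content_cball)
      finally show ?thesis .
    qed
    have "(\<lambda>n. A * inverse (real n)) \<longlonglongrightarrow> A * 0"
      by (intro tendsto_intros lim_inverse_n)
    from order_tendstoD(2)[OF this, of "e / 2"] e
    have "\<forall>\<^sub>F n in sequentially. A * inverse (real n) < e / 2" by simp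
    moreover have "\<forall>\<^sub>F n in sequentially. n \<ge> 1" by (rule eventually_ge_at_top)
    ultimately have "\<forall>\<^sub>F n in sequentially.
        norm ((LINT x|lebesgue. indicator (cball 0 (real n)) x * \<bar>p x\<bar>) / real n ^ ?N - 0) < e"
    proof eventually_elim
      case (elim n)
      have pos: "real n ^ ?N > 0" using elim by simp
      have "1 \<le> real n" using elim by simp
      then have "real n \<le> real n ^ ?N" by (rule self_le_power) simp
      then have "A / real n ^ ?N \<le> A / real n"
        using A pos \<open>1 \<le> real n\<close> by (intro divide_left_mono mult_pos_pos) linarith+
      then have "A / real n ^ ?N \<le> A * inverse (real n)"
        unfolding divide_inverse .
      moreover have "(LINT x|lebesgue. indicator (cball 0 (real n)) x * \<bar>p x\<bar>) / real n ^ ?N \<le> (A + \<epsilon> * (V * real n ^ ?N)) / real n ^ ?N"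
        by (rule divide_right_mono[OF bound less_imp_le[OF pos]])
      moreover have "(A + \<epsilon> * (V * real n ^ ?N)) / real n ^ ?N = A / real n ^ ?N + \<epsilon> * V"
        using pos by (simp add: add_divide_distrib)
      moreover have "\<epsilon> * V \<le> e / 2"
      proof -
        have "\<epsilon> * V \<le> \<epsilon> * (V + 1)" using \<epsilon> by (intro mult_left_mono) auto
        also have "\<dots> = e / 2"
        proof -
          have "a / d * d = a" if "d > 0" for a d :: real using that by simp
          then show ?thesis unfolding \<epsilon>_def using V by (metis add_nonneg_pos zero_less_one)
        qed
        finally show ?thesis .
      qed
      moreover have "0 \<le> (LINT x|lebesgue. indicator (cball 0 (real n)) x * \<bar>p x\<bar>) / real n ^ ?N"
        by (intro divide_nonneg_nonneg integral_nonneg_AE) auto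
      ultimately have "0 \<le> (LINT x|lebesgue. indicator (cball 0 (real n)) x * \<bar>p x\<bar>) / real n ^ ?N"
        "(LINT x|lebesgue. indicator (cball 0 (real n)) x * \<bar>p x\<bar>) / real n ^ ?N < e"
        using elim(1) by linarith+
      then show ?case by (simp only: real_norm_def diff_zero abs_of_nonneg)
    qed
    then show "\<exists>no. \<forall>n\<ge>no. norm ((LINT x|lebesgue. indicator (cball 0 (real n)) x * \<bar>p x\<bar>) / real n ^ ?N - 0) < e"
      unfolding eventually_sequentially .
  qed
qed

section \<open>Vanishing of the energy\<close>

lemma nn_integral_balls_tendsto:
  fixes f :: "'a::euclidean_space \<Rightarrow> real"
  assumes "f \<in> borel_measurable lebesgue"
  shows "(\<lambda>n. \<integral>\<^sup>+ x. ennreal (indicator (ball 0 (real n)) x * f x) \<partial>lebesgue) \<longlonglongrightarrow> (\<integral>\<^sup>+ x. ennreal (f x) \<partial>lebesgue)"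
proof (rule nn_integral_LIMSEQ)
  show "incseq (\<lambda>n x. ennreal (indicator (ball 0 (real n)) x * f x))"
    by (intro incseq_SucI le_funI) (auto simp: indicator_def)
  show "(\<lambda>x. ennreal (indicator (ball 0 (real n)) x * f x)) \<in> borel_measurable lebesgue" for n
    by (intro measurable_compose[OF _ measurable_ennreal] borel_measurable_times assms borel_measurable_indicator) simp
  fix x :: 'a
  have "\<forall>\<^sub>F n in sequentially. norm x < real n"
    using filterlim_real_sequentially by (simp add: filterlim_at_top_dense)
  then show "(\<lambda>n. ennreal (indicator (ball 0 (real n)) x * f x)) \<longlonglongrightarrow> ennreal (f x)"
    by (intro tendsto_eventually) (erule eventually_mono, simp)
qed

lemma integrable_split_parts:
  assumes "integrable M f"
  obtains A B where "A \<ge> 0" "B \<ge> 0" "(\<integral>\<^sup>+ x. ennreal (f x) \<partial>M) = ennreal A"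
    "(\<integral>\<^sup>+ x. ennreal (- f x) \<partial>M) = ennreal B" "(LINT x|M. f x) = A - B"
proof -
  have fin: "(\<integral>\<^sup>+ x. ennreal (f x) \<partial>M) \<noteq> \<infinity>" "(\<integral>\<^sup>+ x. ennreal (- f x) \<partial>M) \<noteq> \<infinity>"
    using assms by (auto simp: real_integrable_def)
  show ?thesis
    by (rule that[of "enn2real (\<integral>\<^sup>+ x. ennreal (f x) \<partial>M)" "enn2real (\<integral>\<^sup>+ x. ennreal (- f x) \<partial>M)"])
       (use fin in \<open>auto simp: real_lebesgue_integral_def[OF assms] less_top\<close>)
qed

text \<open>The integrals over balls tend to the extended integral, but may do so through infinite values of one of its
  parts. Separating the positive and negative parts \<open>P\<close> and \<open>Q\<close> gives \<open>P + E \<le> Q\<close> in the limit; if \<open>Q\<close> were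
  infinite then \<open>P\<close> would be finite and the extended integral \<open>-\<infinity>\<close>, and otherwise \<open>P \<ge> Q\<close> forces \<open>E = 0\<close>.\<close>

lemma ext_integral_nonneg_bound:
  fixes f :: "'a::euclidean_space \<Rightarrow> real"
  assumes f: "loc_integrable f" and ex: "ext_integral_exists lebesgue f" and nonneg: "ext_integral lebesgue f \<ge> 0"
    and e: "e \<longlonglongrightarrow> 0" and E: "E \<ge> 0"
    and bound: "\<forall>\<^sub>F n in sequentially. (LINT x|lebesgue. indicator (ball 0 (real n)) x * f x) + E \<le> e n"
  shows "E = 0"
proof -
  define P Q where "P = (\<integral>\<^sup>+ x. ennreal (f x) \<partial>lebesgue)" and "Q = (\<integral>\<^sup>+ x. ennreal (- f x) \<partial>lebesgue)"
  define A where "A n = (\<integral>\<^sup>+ x. ennreal (indicator (ball 0 (real n)) x * f x) \<partial>lebesgue)" for n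
  define B where "B n = (\<integral>\<^sup>+ x. ennreal (indicator (ball 0 (real n)) x * - f x) \<partial>lebesgue)" for n
  have meas: "f \<in> borel_measurable lebesgue"
    by (rule borel_measurable_loc_integrable[OF f])
  have "A \<longlonglongrightarrow> P" "B \<longlonglongrightarrow> Q"
    unfolding A_def[abs_def] B_def[abs_def] P_def Q_def
    using nn_integral_balls_tendsto[OF meas] nn_integral_balls_tendsto[OF borel_measurable_uminus[OF meas]]
    by simp_all
  have "\<forall>\<^sub>F n in sequentially. A n + ennreal E \<le> B n + ennreal (max 0 (e n))"
    using bound
  proof eventually_elim
    case (elim n)
    have int: "integrable lebesgue (\<lambda>x. indicator (ball 0 (real n)) x * f x)"
    proof (rule integrable_cutoff_mult[OF f, where C = 1 and R = "real n"])
      show "indicator (ball 0 (real n)) \<in> borel_measurable lebesgue"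
        by (intro borel_measurable_indicator) simp
    qed (auto simp: indicator_def)
    obtain a b where ab: "a \<ge> 0" "b \<ge> 0" "A n = ennreal a" "B n = ennreal b"
      "(LINT x|lebesgue. indicator (ball 0 (real n)) x * f x) = a - b"
      by (rule integrable_split_parts[OF int]) (simp add: A_def B_def)
    have "a + E \<le> b + max 0 (e n)" using elim ab(5) by linarith
    then show ?case
      using ab E by (simp flip: ennreal_plus)
  qed
  moreover have "(\<lambda>n. A n + ennreal E) \<longlonglongrightarrow> P + ennreal E"
    by (intro tendsto_add \<open>A \<longlonglongrightarrow> P\<close> tendsto_const)
  moreover have "(\<lambda>n. B n + ennreal (max 0 (e n))) \<longlonglongrightarrow> Q + ennreal (max 0 0)"
    by (intro tendsto_add \<open>B \<longlonglongrightarrow> Q\<close> tendsto_ennrealI tendsto_max tendsto_const e)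
  ultimately have le: "P + ennreal E \<le> Q"
    using tendsto_le[OF trivial_limit_sequentially] by fastforce
  have "P < \<infinity> \<or> Q < \<infinity>"
    using ex by (simp add: ext_integral_exists_def P_def Q_def)
  then have "P < \<infinity>"
    using le by (auto simp: less_top[symmetric] top_unique)
  then obtain x where x: "P = ennreal x" "x \<ge> 0" by (cases P) auto
  have ge: "0 \<le> enn2ereal P - enn2ereal Q"
    using nonneg by (simp add: ext_integral_def P_def Q_def)
  show ?thesis
  proof (cases Q)
    case (real y)
    with ge le x E show ?thesis by (simp flip: ennreal_plus)
  next
    case top
    with ge x show ?thesis by (simp add: top_ereal_def)
  qed
qed

context
  fixes w :: "real \<Rightarrow> real"
  assumes w_anti: "antimono w" and w_pos: "\<And>r. w r > 0"
begin

text \<open>In \<open>energy_inequality\<close>, first \<open>L \<rightarrow> \<infinity>\<close> removes the pressure of the shell and then \<open>R \<rightarrow> \<infinity>\<close> the outer energy.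
  In the limit, half of the weighted energy of a fixed ball cannot exceed minus the weighted pressure integral,
  which is not positive.\<close>

lemma energy_vanishes:
  fixes v b :: "real ^ 'n::finite \<Rightarrow> real ^ 'n" and p :: "real ^ 'n \<Rightarrow> real"
  assumes state: "MHD_state v b p"
    and grid: "\<And>j m :: nat. balances (stress_trace v b p) (stress_radial v b p)
                 (indicator {real j / real (Suc m)<..<real (Suc j) / real (Suc m)})"
    and card: "CARD('n) \<ge> 3"
    and decay: "integrable lebesgue (\<lambda>x. ((norm (v x))\<^sup>2 + (norm (b x))\<^sup>2) / (1 + norm x))"
    and mean: "(\<lambda>n. (LINT x|lebesgue. indicator (cball 0 (real n)) x * \<bar>p x\<bar>) / real n ^ CARD('n)) \<longlonglongrightarrow> 0"
    and M: "\<And>r. r \<ge> 0 \<Longrightarrow> cumul w r \<le> M"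
    and ext: "ext_integral_exists lebesgue (\<lambda>x. p x * pressure_weight w x)"
      "ext_integral lebesgue (\<lambda>x. p x * pressure_weight w x) \<ge> 0"
  shows "AE x in lebesgue. v x = 0 \<and> b x = 0"
proof -
  let ?n = "real CARD('n)"
  define u where "u x = (norm (v x))\<^sup>2 + (norm (b x))\<^sup>2" for x
  define H where "H n = (LINT x|lebesgue. indicator (ball 0 (real n)) x * (p x * pressure_weight w x))" for n
  define E where "E n = (LINT x|lebesgue. indicator (ball 0 (real n)) x * (w (norm x) * u x))" for n
  define X where "X n = (LINT x|lebesgue. indicator (- ball 0 (real n)) x * (u x / (1 + norm x)))" for n
  have u: "loc_integrable u" "\<And>x. u x \<ge> 0"
    using state unfolding MHD_state_def u_def by (auto intro: loc_integrable_add)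
  have p: "loc_integrable p" using state by (simp add: MHD_state_def)
  \<comment> \<open>This is the limit \<open>L \<rightarrow> \<infinity>\<close> with \<open>R = m\<close> fixed.\<close>
  have ineq: "H m + E m / 2 \<le> 4 * ?n * M * X m" if m: "m \<ge> 1" for m
  proof -
    let ?C = "2 * ?n * M * real m ^ CARD('n) / real m"
    let ?Q = "\<lambda>n. (LINT x|lebesgue. indicator (cball 0 (real n)) x * \<bar>p x\<bar>) / real n ^ CARD('n)"
    have "(\<lambda>n. 4 * ?n * M * X m + ?C * ?Q n) \<longlonglongrightarrow> 4 * ?n * M * X m + ?C * 0"
      by (intro tendsto_intros mean)
    moreover have "H m + E m / 2 \<le> 4 * ?n * M * X m + ?C * ?Q n" if "n \<ge> 2 * m" for n
    proof -
      have "1 \<le> real m" "2 * real m \<le> real n" using m that by linarith+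
      from energy_inequality[OF w_anti w_pos state grid card decay M this]
      show ?thesis by (simp only: H_def E_def X_def u_def)
    qed
    ultimately show ?thesis
      by (intro LIMSEQ_le_const[of _ "4 * ?n * M * X m"]) auto
  qed
  have "X \<longlonglongrightarrow> (LINT x|(lebesgue :: (real ^ 'n) measure). 0)"
    unfolding X_def[abs_def]
  proof (rule integral_dominated_convergence[where w = "\<lambda>x. u x / (1 + norm x)"])
    show int: "integrable lebesgue (\<lambda>x. u x / (1 + norm x))"
      using decay by (simp add: u_def)
    show "(\<lambda>x. indicator (- ball 0 (real n)) x * (u x / (1 + norm x))) \<in> borel_measurable lebesgue" for n
      using int by (intro borel_measurable_times borel_measurable_indicator borel_measurable_integrable) auto
    show "AE x in lebesgue. norm (indicator (- ball 0 (real n)) x * (u x / (1 + norm x))) \<le> u x / (1 + norm x)" for n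
      using u(2) by (intro AE_I2) (auto simp: indicator_def)
    show "AE x in lebesgue. (\<lambda>n. indicator (- ball 0 (real n)) x * (u x / (1 + norm x))) \<longlonglongrightarrow> 0"
    proof (rule AE_I2)
      fix x :: "real ^ 'n"
      have "\<forall>\<^sub>F n in sequentially. norm x < real n"
        using filterlim_real_sequentially by (simp add: filterlim_at_top_dense)
      then show "(\<lambda>n. indicator (- ball 0 (real n)) x * (u x / (1 + norm x))) \<longlonglongrightarrow> 0"
        by (intro tendsto_eventually) (erule eventually_mono, simp)
    qed
  qed simp
  then have "(\<lambda>n. 4 * ?n * M * X n) \<longlonglongrightarrow> 4 * ?n * M * 0"
    by (intro tendsto_intros) simp
  then have lim: "(\<lambda>n. 4 * ?n * M * X n) \<longlonglongrightarrow> 0" by simp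
  have int_E: "integrable lebesgue (\<lambda>x. indicator (ball 0 (real n)) x * (w (norm x) * u x))" for n
  proof (rule integrable_cutoff_mult[OF loc_integrable_w_mult[OF w_anti w_pos u(1)], where C = 1 and R = "real n"])
    show "indicator (ball 0 (real n)) \<in> borel_measurable lebesgue"
      by (intro borel_measurable_indicator) simp
  qed (auto simp: indicator_def)
  have nonneg: "0 \<le> indicator (ball 0 (real n)) x * (w (norm x) * u x)" for n x
    by (intro mult_nonneg_nonneg u(2) less_imp_le[OF w_pos]) simp
  then have E_nonneg: "E n \<ge> 0" for n
    unfolding E_def by (intro integral_nonneg_AE AE_I2)
  have E0: "E m = 0" for m
  proof -
    have "E m / 2 = 0"
    proof (rule ext_integral_nonneg_bound[OF loc_integrable_pressure_weight[OF w_anti w_pos p] ext lim])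
      show "E m / 2 \<ge> 0" using E_nonneg by simp
      show "\<forall>\<^sub>F n in sequentially. (LINT x|lebesgue. indicator (ball 0 (real n)) x * (p x * pressure_weight w x)) + E m / 2
          \<le> 4 * ?n * M * X n"
        using eventually_ge_at_top[of "max 1 m"]
      proof eventually_elim
        case (elim n)
        have "E m \<le> E n"
          unfolding E_def
        proof (rule integral_mono[OF int_E int_E])
          fix x
          have "0 \<le> w (norm x) * u x" using u(2)[of x] w_pos[of "norm x"] by (simp add: less_imp_le)
          then show "indicator (ball 0 (real m)) x * (w (norm x) * u x) \<le> indicator (ball 0 (real n)) x * (w (norm x) * u x)"
            using elim by (auto simp: indicator_def)
        qed
        with ineq[of n] elim show ?case unfolding H_def by simp
      qed
    qed
    then show ?thesis by simp
  qed
  have "AE x in lebesgue. \<forall>n. indicator (ball 0 (real n)) x * (w (norm x) * u x) = 0"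
    unfolding AE_all_countable
  proof
    fix n
    have "AE x in lebesgue. 0 \<le> indicator (ball 0 (real n)) x * (w (norm x) * u x)"
      by (intro AE_I2 nonneg)
    from integral_nonneg_eq_0_iff_AE[OF int_E this] E0[of n]
    show "AE x in lebesgue. indicator (ball 0 (real n)) x * (w (norm x) * u x) = 0"
      by (simp add: E_def)
  qed
  then show ?thesis
  proof (rule eventually_mono)
    fix x
    assume *: "\<forall>n. indicator (ball 0 (real n)) x * (w (norm x) * u x) = 0"
    obtain n where "norm x < real n" using reals_Archimedean2 by blast
    with *[rule_format, of n] w_pos[of "norm x"] have "u x = 0" by simp
    then show "v x = 0 \<and> b x = 0"
      by (simp add: u_def sum_power2_eq_zero_iff)
  qed
qed

end

section \<open>The Liouville theorem\<close>

text \<open>The grid and the approximation index are countable, so a single null set of times serves for all of them.\<close>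

lemma AE_balances_grid:
  assumes f: "in_LLloc_sigma 1 T 1 f" and sol: "MHD_weak_solution \<mu> \<nu> T f g v b p"
  shows "AE t in lebesgue_on {0<..<T}. \<forall>j m :: nat. balances (stress_trace (v t) (b t) (p t)) (stress_radial (v t) (b t) (p t))
           (indicator {real j / real (Suc m)<..<real (Suc j) / real (Suc m)})"
proof -
  have "AE t in lebesgue_on {0<..<T}. \<forall>j m n :: nat. balances (stress_trace (v t) (b t) (p t)) (stress_radial (v t) (b t) (p t))
           (bump n (real j / real (Suc m)) (real (Suc j) / real (Suc m)))"
    unfolding AE_all_countable balances_def
  proof (intro allI radial_momentum_identity[OF f sol])
    fix j m n :: nat
    show "C_real k (bump n (real j / real (Suc m)) (real (Suc j) / real (Suc m)))" for k
      by (rule C_real_bump)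
    show "bump n (real j / real (Suc m)) (real (Suc j) / real (Suc m)) \<sigma> = 0"
      if "real (Suc j) / real (Suc m) \<le> \<sigma>" for \<sigma>
      by (rule bump_support) (use that in auto)
    show "0 < real (Suc j) / real (Suc m)" by simp
  qed
  then show ?thesis
    using AE_MHD_state[OF sol]
  proof eventually_elim
    case (elim t)
    show ?case
    proof (intro allI)
      fix j m :: nat
      show "balances (stress_trace (v t) (b t) (p t)) (stress_radial (v t) (b t) (p t))
           (indicator {real j / real (Suc m)<..<real (Suc j) / real (Suc m)})"
      proof (rule balances_indicator[OF loc_integrable_stress[OF elim(2)]])
        show "real j / real (Suc m) \<le> real (Suc j) / real (Suc m)"
          by (intro divide_right_mono) auto
      qed (use elim(1) in auto)
    qed
  qed
qed

text \<open>The common consequence of the two decay hypotheses, at a single time.\<close>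

definition spatial_decay :: "(real ^ 'n::finite \<Rightarrow> real ^ 'n) \<Rightarrow> (real ^ 'n \<Rightarrow> real ^ 'n) \<Rightarrow> (real ^ 'n \<Rightarrow> real) \<Rightarrow> bool"
  where "spatial_decay v b p \<longleftrightarrow>
    integrable lebesgue (\<lambda>x. ((norm (v x))\<^sup>2 + (norm (b x))\<^sup>2) / (1 + norm x)) \<and>
    (\<lambda>n. (LINT x|lebesgue. indicator (cball 0 (real n)) x * \<bar>p x\<bar>) / real n ^ CARD('n)) \<longlonglongrightarrow> 0"

lemma AE_decay_weighted:
  fixes v b :: "real \<Rightarrow> real ^ 'n::finite \<Rightarrow> real ^ 'n"
  assumes sol: "MHD_weak_solution \<mu> \<nu> T f g v b p" and card: "CARD('n) \<ge> 2"
    and decay: "(\<integral>\<^sup>+ t. (\<integral>\<^sup>+ x. ennreal (((norm (v t x))\<^sup>2 + (norm (b t x))\<^sup>2 + \<bar>p t x\<bar>) / (1 + norm x)) \<partial>lebesgue)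
          \<partial>lebesgue_on {0<..<T}) < \<infinity>"
  shows "AE t in lebesgue_on {0<..<T}. spatial_decay (v t) (b t) (p t)"
proof -
  have vbp: "in_LLloc 2 T 2 v" "in_LLloc 2 T 2 b" "in_LLloc 1 T 1 p"
    using sol by (simp_all add: MHD_weak_solution_def in_LLloc_sigma_def)
  define F where "F t x = ((norm (v t x))\<^sup>2 + (norm (b t x))\<^sup>2 + \<bar>p t x\<bar>) / (1 + norm x)" for t x
  have pos: "1 + norm x > 0" for x :: "real ^ 'n" by (simp add: add_pos_nonneg)
  have norm_meas: "(\<lambda>z. 1 + norm (snd z)) \<in> borel_measurable (lebesgue :: (real \<times> (real ^ 'n)) measure)"
    by (intro borel_measurable_lebesgueI borel_measurable_continuous_onI continuous_intros)
  have "(\<lambda>z. ((norm (slab_ext T v z))\<^sup>2 + (norm (slab_ext T b z))\<^sup>2 + \<bar>slab_ext T p z\<bar>) / (1 + norm (snd z)))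
      \<in> borel_measurable lebesgue"
    by (intro borel_measurable_divide[OF _ norm_meas] borel_measurable_add borel_measurable_power borel_measurable_abs
        measurable_compose[OF _ borel_measurable_norm] borel_measurable_slab_ext[OF vbp(1)]
        borel_measurable_slab_ext[OF vbp(2)] borel_measurable_slab_ext[OF vbp(3)])
  also have "(\<lambda>z. ((norm (slab_ext T v z))\<^sup>2 + (norm (slab_ext T b z))\<^sup>2 + \<bar>slab_ext T p z\<bar>) / (1 + norm (snd z)))
      = slab_ext T F"
    by (auto simp: slab_ext_def F_def fun_eq_iff)
  finally have meas: "slab_ext T F \<in> borel_measurable lebesgue" .
  have "(\<integral>\<^sup>+ t. (\<integral>\<^sup>+ x. ennreal (slab_ext T F (t, x)) \<partial>lebesgue) \<partial>lebesgue)
      = (\<integral>\<^sup>+ t. (\<integral>\<^sup>+ x. ennreal (F t x) \<partial>lebesgue) * indicator {0<..<T} t \<partial>lebesgue)"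
    by (intro nn_integral_cong) (auto simp: slab_ext_def indicator_def)
  also have "\<dots> < \<infinity>"
    using decay by (simp add: nn_integral_restrict_space F_def)
  finally have "AE t in lebesgue. (\<integral>\<^sup>+ x. ennreal (slab_ext T F (t, x)) \<partial>lebesgue) < \<infinity>"
    by (rule AE_finite_nn_integral_section[OF meas])
  then have "AE t in lebesgue. t \<in> {0<..<T} \<longrightarrow> (\<integral>\<^sup>+ x. ennreal (F t x) \<partial>lebesgue) < \<infinity>"
    by (rule eventually_mono) (auto simp: slab_ext_def)
  then have "AE t in lebesgue_on {0<..<T}. (\<integral>\<^sup>+ x. ennreal (F t x) \<partial>lebesgue) < \<infinity>"
    by (subst AE_lebesgue_on_iff) simp_all
  then show ?thesis
    using AE_MHD_state[OF sol]
  proof eventually_elim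
    case (elim t)
    have den: "(\<lambda>x :: real ^ 'n. 1 + norm x) \<in> borel_measurable lebesgue"
      by (intro borel_measurable_lebesgueI) simp
    have meas: "v t \<in> borel_measurable lebesgue" "b t \<in> borel_measurable lebesgue" "p t \<in> borel_measurable lebesgue"
      using elim(2) borel_measurable_loc_integrable[of "p t"] by (simp_all add: MHD_state_def)
    have "F t \<in> borel_measurable lebesgue"
      unfolding F_def
      by (intro borel_measurable_divide[OF _ den] borel_measurable_add borel_measurable_power borel_measurable_abs
          measurable_compose[OF _ borel_measurable_norm] meas)
    then have F: "integrable lebesgue (F t)"
      using elim(1) pos by (intro integrableI_nonneg) (auto simp: F_def less_imp_le)
    have u: "integrable lebesgue (\<lambda>x. ((norm (v t x))\<^sup>2 + (norm (b t x))\<^sup>2) / (1 + norm x))"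
    proof (rule Bochner_Integration.integrable_bound[OF F])
      show "(\<lambda>x. ((norm (v t x))\<^sup>2 + (norm (b t x))\<^sup>2) / (1 + norm x)) \<in> borel_measurable lebesgue"
        by (intro borel_measurable_divide[OF _ den] borel_measurable_add borel_measurable_power
            measurable_compose[OF _ borel_measurable_norm] meas)
      show "AE x in lebesgue. norm (((norm (v t x))\<^sup>2 + (norm (b t x))\<^sup>2) / (1 + norm x)) \<le> norm (F t x)"
        using pos by (intro AE_I2) (simp add: F_def divide_right_mono less_imp_le)
    qed
    have "integrable lebesgue (\<lambda>x. \<bar>p t x\<bar> / (1 + norm x))"
    proof (rule Bochner_Integration.integrable_bound[OF F])
      show "(\<lambda>x. \<bar>p t x\<bar> / (1 + norm x)) \<in> borel_measurable lebesgue"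
        by (intro borel_measurable_divide[OF _ den] borel_measurable_abs meas)
      show "AE x in lebesgue. norm (\<bar>p t x\<bar> / (1 + norm x)) \<le> norm (F t x)"
        using pos by (intro AE_I2) (simp add: F_def divide_right_mono less_imp_le)
    qed
    moreover have "loc_integrable (p t)" using elim(2) by (simp add: MHD_state_def)
    ultimately have "(\<lambda>n. (LINT x|lebesgue. indicator (cball 0 (real n)) x * \<bar>p t x\<bar>) / real n ^ CARD('n)) \<longlonglongrightarrow> 0"
      using card by (intro pressure_mean_tendsto_0_weighted)
    with u show ?case by (simp add: spatial_decay_def)
  qed
qed

lemma AE_decay_Lq:
  fixes v b :: "real \<Rightarrow> real ^ 'n::finite \<Rightarrow> real ^ 'n"
  assumes sol: "MHD_weak_solution \<mu> \<nu> T f g v b p" and card: "CARD('n) \<ge> 2"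
    and p: "AE t in lebesgue_on {0<..<T}. \<forall>\<epsilon>>0. \<exists>R. AE x in lebesgue. norm x > R \<longrightarrow> \<bar>p t x\<bar> < \<epsilon>"
    and q: "2 < q" "q < 2 * real CARD('n) / (real CARD('n) - 1)"
    and vb: "in_LL 2 T q UNIV (\<lambda>t x. norm (v t x) + norm (b t x))"
  shows "AE t in lebesgue_on {0<..<T}. spatial_decay (v t) (b t) (p t)"
proof -
  have "AE t in lebesgue_on {0<..<T}. in_L q UNIV (\<lambda>x. norm (v t x) + norm (b t x))"
    using vb by (simp add: in_LL_def)
  then show ?thesis
    using p AE_MHD_state[OF sol]
  proof eventually_elim
    case (elim t)
    then have "integrable lebesgue (\<lambda>x. ((norm (v t x))\<^sup>2 + (norm (b t x))\<^sup>2) / (1 + norm x))"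
      by (intro weighted_energy_integrable_of_Lq[OF card _ _ elim(1) q]) (simp_all add: MHD_state_def)
    moreover have "(\<lambda>n. (LINT x|lebesgue. indicator (cball 0 (real n)) x * \<bar>p t x\<bar>) / real n ^ CARD('n)) \<longlonglongrightarrow> 0"
      using elim(3) by (intro pressure_mean_tendsto_0_decay[OF _ elim(2)]) (simp add: MHD_state_def)
    ultimately show ?case by (simp add: spatial_decay_def)
  qed
qed

lemma AE_slab_zero:
  assumes v: "in_LLloc s T q v" and zero: "AE t in lebesgue_on {0<..<T}. AE x in lebesgue. v t x = 0"
  shows "AE z in lebesgue_on ({0<..<T} \<times> UNIV). v (fst z) (snd z) = 0"
proof -
  have S: "{0<..<T} \<times> (UNIV :: 'a set) \<in> sets lebesgue"
    by (intro sets_completionI_sets) (auto intro!: borel_Times)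
  have "(\<lambda>z. norm (slab_ext T v z)) \<in> borel_measurable lebesgue"
    by (intro measurable_compose[OF _ borel_measurable_norm] borel_measurable_slab_ext[OF v])
  moreover have "AE t in lebesgue. AE x in lebesgue. norm (slab_ext T v (t, x)) = 0"
  proof -
    have "AE t in lebesgue. t \<in> {0<..<T} \<longrightarrow> (AE x in lebesgue. v t x = 0)"
      using zero by (subst (asm) AE_lebesgue_on_iff) simp_all
    then show ?thesis
      by (rule eventually_mono) (auto simp: slab_ext_def)
  qed
  ultimately have "AE z in lebesgue. norm (slab_ext T v z) = 0"
    by (rule AE_lebesgue_product)
  then have "AE z in lebesgue. z \<in> {0<..<T} \<times> UNIV \<longrightarrow> v (fst z) (snd z) = 0"
    by (rule eventually_mono) (auto simp: slab_ext_def)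
  then show ?thesis
    using S by (subst AE_lebesgue_on_iff)
qed

theorem theorem3p2:
  fixes v b f g :: "real \<Rightarrow> real ^ 'n::finite \<Rightarrow> real ^ 'n"
    and p :: "real \<Rightarrow> real ^ 'n \<Rightarrow> real"
    and T \<mu> \<nu> :: real
  assumes N: "CARD('n) \<ge> 3"
    and T: "T > 0"
    and viscosities: "\<mu> \<ge> 0" "\<nu> \<ge> 0"
    and forces: "in_LLloc_sigma 1 T 1 f" "in_LLloc_sigma 1 T 1 g"
    and sol: "MHD_weak_solution \<mu> \<nu> T f g v b p"
    and decay:
      "(\<integral>\<^sup>+ t. (\<integral>\<^sup>+ x. ennreal (((norm (v t x))\<^sup>2 + (norm (b t x))\<^sup>2 + \<bar>p t x\<bar>) / (1 + norm x)) \<partial>lebesgue)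
          \<partial>lebesgue_on {0<..<T}) < \<infinity>
       \<or>
       (AE t in lebesgue_on {0<..<T}. \<forall>\<epsilon>>0. \<exists>R. AE x in lebesgue. norm x > R \<longrightarrow> \<bar>p t x\<bar> < \<epsilon>) \<and>
       (\<exists>q. 2 < q \<and> q < 2 * real CARD('n) / (real CARD('n) - 1) \<and>
            in_LL 2 T q UNIV (\<lambda>t x. norm (v t x) + norm (b t x)))"
    and pressure:
      "\<exists>w :: real \<Rightarrow> real.
         integrable (lebesgue_on {0<..}) w \<and>
         (\<forall>r\<ge>0. w r > 0) \<and> antimono_on {0..} w \<and>
         (\<exists>C>0. AE r in lebesgue_on {0..}. 0 < w r \<and> w r \<le> C / (1 + r)) \<and>
         (AE t in lebesgue_on {0<..<T}.
            let h = (\<lambda>x. p t x * (w (norm x) + (real CARD('n) - 1) / norm x *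
                                    (LINT s|lebesgue_on {0..norm x}. w s)))
            in ext_integral_exists lebesgue h \<and> ext_integral lebesgue h \<ge> 0)"
  shows "AE z in lebesgue_on ({0<..<T} \<times> UNIV). v (fst z) (snd z) = 0 \<and> b (fst z) (snd z) = 0"
proof -
  have card: "CARD('n) \<ge> 2" using N by simp
  obtain w where w_int: "integrable (lebesgue_on {0<..}) w" and w_pos: "\<forall>r\<ge>0. w r > 0"
    and w_anti: "antimono_on {0..} w"
    and sign: "AE t in lebesgue_on {0<..<T}.
            let h = (\<lambda>x. p t x * (w (norm x) + (real CARD('n) - 1) / norm x *
                                    (LINT s|lebesgue_on {0..norm x}. w s)))
            in ext_integral_exists lebesgue h \<and> ext_integral lebesgue h \<ge> 0"
    using pressure by (elim exE conjE)
  \<comment> \<open>Only the values on the half line are prescribed; the extension is monotone on the whole line.\<close>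
  define W where "W r = w (max r 0)" for r
  have W_anti: "antimono W"
    using w_anti by (auto simp: W_def monotone_on_def)
  have W_pos: "W r > 0" for r
    using w_pos by (simp add: W_def)
  have W_cumul: "cumul W r = (LINT s|lebesgue_on {0..r}. w s)" for r
    unfolding cumul_def by (intro Bochner_Integration.integral_cong) (auto simp: W_def)
  have weight: "pressure_weight W x = w (norm x) + (real CARD('n) - 1) / norm x * (LINT s|lebesgue_on {0..norm x}. w s)"
    for x :: "real ^ 'n"
    by (simp add: pressure_weight_def W_cumul) (simp add: W_def)
  have W_bound: "cumul W r \<le> (LINT s|lebesgue. indicator {0<..} s * w s)" for r
  proof -
    have "cumul W r = (LINT s|lebesgue. indicator {0..r} s * W s)"
      unfolding cumul_def by (simp add: integral_restrict_space)
    also have "\<dots> \<le> (LINT s|lebesgue. indicator {0<..} s * w s)"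
    proof (rule integral_mono_AE)
      show "integrable lebesgue (\<lambda>s. indicator {0..r} s * W s)"
        using weight_integrable[OF W_anti W_pos, of 0 r] by (simp add: integrable_lebesgue_on_iff)
      show "integrable lebesgue (\<lambda>s. indicator {0<..} s * w s)"
        using w_int by (simp add: integrable_lebesgue_on_iff)
      have "AE s in lebesgue. s \<notin> {0 :: real}"
        unfolding AE_completion_iff by (intro AE_not_in countable_imp_null_set_lborel) simp
      then show "AE s in lebesgue. indicator {0..r} s * W s \<le> indicator {0<..} s * w s"
        by (rule eventually_mono) (use w_pos in \<open>auto simp: indicator_def W_def less_imp_le\<close>)
    qed
    finally show ?thesis .
  qed
  have "AE t in lebesgue_on {0<..<T}. spatial_decay (v t) (b t) (p t)"
    using decay
  proof (elim disjE conjE exE)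
    assume "(\<integral>\<^sup>+ t. (\<integral>\<^sup>+ x. ennreal (((norm (v t x))\<^sup>2 + (norm (b t x))\<^sup>2 + \<bar>p t x\<bar>) / (1 + norm x)) \<partial>lebesgue)
          \<partial>lebesgue_on {0<..<T}) < \<infinity>"
    then show "AE t in lebesgue_on {0<..<T}. spatial_decay (v t) (b t) (p t)"
      by (rule AE_decay_weighted[OF sol card])
  next
    fix q
    assume "AE t in lebesgue_on {0<..<T}. \<forall>\<epsilon>>0. \<exists>R. AE x in lebesgue. norm x > R \<longrightarrow> \<bar>p t x\<bar> < \<epsilon>"
      "2 < q" "q < 2 * real CARD('n) / (real CARD('n) - 1)" "in_LL 2 T q UNIV (\<lambda>t x. norm (v t x) + norm (b t x))"
    then show "AE t in lebesgue_on {0<..<T}. spatial_decay (v t) (b t) (p t)"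
      by (rule AE_decay_Lq[OF sol card])
  qed
  then have "AE t in lebesgue_on {0<..<T}. AE x in lebesgue. v t x = 0 \<and> b t x = 0"
    using sign AE_MHD_state[OF sol] AE_balances_grid[OF forces(1) sol]
  proof eventually_elim
    case (elim t)
    have ext: "ext_integral_exists lebesgue (\<lambda>x. p t x * pressure_weight W x)"
      "ext_integral lebesgue (\<lambda>x. p t x * pressure_weight W x) \<ge> 0"
      using elim(2) by (simp_all add: weight Let_def)
    show ?case
      by (rule energy_vanishes[OF W_anti W_pos elim(3) elim(4)[rule_format] N _ _ W_bound ext])
         (use elim(1) in \<open>auto simp: spatial_decay_def\<close>)
  qed
  then have zero: "AE t in lebesgue_on {0<..<T}. AE x in lebesgue. v t x = 0"
    "AE t in lebesgue_on {0<..<T}. AE x in lebesgue. b t x = 0"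
    by (simp_all add: AE_conj_iff)
  have "in_LLloc 2 T 2 v" "in_LLloc 2 T 2 b"
    using sol by (simp_all add: MHD_weak_solution_def in_LLloc_sigma_def)
  from AE_slab_zero[OF this(1) zero(1)] AE_slab_zero[OF this(2) zero(2)]
  show ?thesis by eventually_elim simp
qed

end
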